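(* Let $D_n$ be $n$ i.i.d. samples from the non-parametric regression model $y=m(x)+\varepsilon$, where $x\sim\mathcal D_x$ on $\{0,1\}^d$, $m(x)\in[-1/2,1/2]$, $\varepsilon\sim\mathcal E$, $\mathbb E[\varepsilon]=0$, $\varepsilon\in[-1/2,1/2]$. Suppose that $\mathcal D_x$ is $(\zeta,r)$-lower bounded and that $m$ is $(\beta,r)$-strongly partition sparse. Let $m_{n,s}$ be the forest estimator built with sub-sampling of size $s$ from the training set, where every tree $m(\cdot;D_s)$ is built using Breiman's Tree Construction Algorithm (see context) with $\log(t)$ large enough so that every leaf has two or three samples, training set $D_s$, and honesty flag $h=1$. Let $\delta\in(0,1)$. If $s=\tilde\Theta\left(\frac{2^r\log(d/\delta)}{\zeta\beta^2}\right)$, then $$\mathbb P_{D_n\sim\mathcal D^n}\left(\mathbb E_{x\sim\mathcal D_x}[(m(x)-m_{n,s}(x))^2]>\tilde\Omega\left(\frac{2^r\log(d/\delta)}{n\,\zeta\,\beta^2}\right)\right)\le\delta .$$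
   Context: **Model.** $D_n=\{(x^{(i)},y^{(i)})\}_{i=1}^n$ is i.i.d. from $\mathcal D$: $x^{(i)}$ is drawn from a distribution $\mathcal D_x$ with support $\{0,1\}^d$, $\varepsilon^{(i)}\in[-1/2,1/2]$ is drawn from a zero-mean distribution $\mathcal E$, and $y^{(i)}=m(x^{(i)})+\varepsilon^{(i)}$ with $m:\{0,1\}^d\to[-1/2,1/2]$. $x_S$ is the sub-vector of $x$ with coordinates in $S\subseteq[d]$. $m$ is $r$-sparse if there is $R\subseteq[d]$, $|R|=r$ (relevant features), and $h_0$ with $m(z)=h_0(z_R)$ for all $z$. **Cells.** A cell is a subset $A\subseteq\{0,1\}^d$ obtained by fixing the values of some (possibly no) coordinates. For $i\in[d]$, $A^i_k=\{x\in A:x_i=k\}$, $k=0,1$. For $I\subseteq[d]$, define $$\bar V_\ell(A,I)=\mathbb E_{x\sim\mathcal D_x}\left[\left(\mathbb E_{z\sim\mathcal D_x}[m(z)\mid z\in A,\ z_I=x_I]\right)^2\,\middle|\,x\in A\right].$$ **$(\beta,r)$-strong partition sparsity:** $m$ is $r$-sparse with relevant features $R$ and $\bar V_\ell(A,T\cup\{j\})-\bar V_\ell(A,T)+\beta\le\bar V_\ell(A,T\cup\{i\})-\bar V_\ell(A,T)$ for all cells $A$, all $T\subseteq[d]$, all $j\in[d]\setminus R$, and all $i\in R\setminus T$ whose coordinate is not fixed in $A$. **$(\zeta,q)$-lower bounded:** for every $Q\subset[d]$ with $|Q|=q$ and every $w\in\{0,1\}^q$, $\mathbb P_{x\sim\mathcal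 D_x}(x_Q=w)\ge\zeta/2^q$. **Breiman's Tree Construction Algorithm with honesty** (inputs: $t$, $D_s$, flag $h=1$). Split $D_s$ randomly into two halves: a structure sample and an estimation sample. For a cell $A$ let $N(A)$ be the number of structure points in $A$, $g(A)$ the average of $y$ over them, and $V^\ell(A,i)=\sum_{z\in\{0,1\}}\frac{N(A^i_z)}{N(A)}g(A^i_z)^2$ (terms with $N(A^i_z)=0$ omitted). Start from the partition $\{\{0,1\}^d\}$ with node counter 1 and process cells breadth-first, level by level. When processing a cell $A$: if it contains at most one covariate vector of the estimation sample it is left unsplit; otherwise select $i\in[d]$ maximizing $V^\ell(A,i)$ (ties broken randomly), replace $A$ by $A_0^i,A_1^i$ at the next level, and increase the counter by one. Stop when the counter reaches $t$ (or no cell can be split). The tree prediction $m(x;D_s)$ is the average of $y$ over the estimation points in the leaf cell containing $x$ (if there are none, in its closest ancestor cell in the tree containing an estimation point). **Forest.** $m_{n,s}(x)=\binom ns^{-1}\sum_{D_s\subseteq D_n,|D_s|=s}\mathbb E_\omega[m(x;D_s)]$, where $\omega$ is the internal randomness of the tree algorithm. **Conventions.** $\log$ is base 2. $\tilde\Theta(a),\tilde\Omega(a)$ denote quantities of the form $K\cdot a\cdot L$ with $K$ a universal constant and $L$ a suitable factor polylogarithmic in $n,2^r,1/\beta,1/\zeta$; the conclusion says that the error exceeds such a threshold with probability at most $\delta$.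
   Formalization: Adds β ≤ 1 (automatic unless r = 0 or r = d) and d/δ ≥ 2 (automatic for d ≥ 2), since the claim fails otherwise; "two or three samples" per leaf, which the algorithm cannot guarantee, is read as t large enough for fully grown trees; splits use unfixed coordinates only. *)

theory Defs
  imports "HOL-Probability.Probability"
begin

text \<open>Points of \<open>{0,1}^d\<close> are Boolean lists of length \<open>d\<close>; coordinates are numbered from 0.
  The sub-vector \<open>x_S\<close> is the library term \<open>nths x S\<close>.
  Lists are used, rather than a vector type, because the constants in the theorem must not
  depend on \<open>d\<close>, so \<open>d\<close> has to be quantified inside the statement.\<close>

type_synonym point = "bool list"
type_synonym cell = "point set"

definition cube :: "nat \<Rightarrow> point set" where
  "cube d = {x. length x = d}"

definition cells :: "nat \<Rightarrow> cell set" where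
  "cells d = {{x \<in> cube d. \<forall>i\<in>F. x ! i = v i} | F v. F \<subseteq> {..<d}}"

definition half :: "cell \<Rightarrow> nat \<Rightarrow> bool \<Rightarrow> cell" where
  "half A i k = {x \<in> A. x ! i = k}"

definition fixed_in :: "cell \<Rightarrow> nat \<Rightarrow> bool" where
  "fixed_in A i \<longleftrightarrow> (\<exists>k. \<forall>x\<in>A. x ! i = k)"

definition Vbar :: "point pmf \<Rightarrow> (point \<Rightarrow> real) \<Rightarrow> cell \<Rightarrow> nat set \<Rightarrow> real" where
  "Vbar Dx m A I =
     measure_pmf.expectation (cond_pmf Dx A)
       (\<lambda>x. (measure_pmf.expectation (cond_pmf Dx {z \<in> A. nths z I = nths x I}) m)\<^sup>2)"

definition sparse_with :: "nat \<Rightarrow> (point \<Rightarrow> real) \<Rightarrow> nat \<Rightarrow> nat set \<Rightarrow> bool" where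
  "sparse_with d m r R \<longleftrightarrow>
     R \<subseteq> {..<d} \<and> card R = r \<and> (\<exists>h0. \<forall>z\<in>cube d. m z = h0 (nths z R))"

definition strongly_partition_sparse ::
  "nat \<Rightarrow> point pmf \<Rightarrow> (point \<Rightarrow> real) \<Rightarrow> real \<Rightarrow> nat \<Rightarrow> bool" where
  "strongly_partition_sparse d Dx m \<beta> r \<longleftrightarrow>
     (\<exists>R. sparse_with d m r R \<and>
       (\<forall>A\<in>cells d. \<forall>T. T \<subseteq> {..<d} \<longrightarrow>
         (\<forall>j\<in>{..<d} - R. \<forall>i\<in>R - T. \<not> fixed_in A i \<longrightarrow>
           Vbar Dx m A (T \<union> {j}) - Vbar Dx m A T + \<beta>
             \<le> Vbar Dx m A (T \<union> {i}) - Vbar Dx m A T)))"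

definition lower_bounded :: "nat \<Rightarrow> point pmf \<Rightarrow> real \<Rightarrow> nat \<Rightarrow> bool" where
  "lower_bounded d Dx \<zeta> q \<longleftrightarrow>
     (\<forall>Q. Q \<subseteq> {..<d} \<longrightarrow> card Q = q \<longrightarrow>
       (\<forall>w\<in>cube q. measure_pmf.prob Dx {x. nths x Q = w} \<ge> \<zeta> / 2 ^ q))"

text \<open>The covariate law \<open>Dx\<close> has support exactly the cube, and \<open>E\<close> is the law of the noise,
  which is independent of the covariate.\<close>

definition regression_model :: "nat \<Rightarrow> point pmf \<Rightarrow> real measure \<Rightarrow> (point \<Rightarrow> real) \<Rightarrow> bool" where
  "regression_model d Dx E m \<longleftrightarrow>
     set_pmf Dx = cube d \<and>
     prob_space E \<and> sets E = sets borel \<and>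
     (AE e in E. e \<in> {-1/2..1/2}) \<and> (\<integral>e. e \<partial>E) = 0 \<and>
     (\<forall>x\<in>cube d. m x \<in> {-1/2..1/2})"

definition data_dist ::
  "point pmf \<Rightarrow> real measure \<Rightarrow> (point \<Rightarrow> real) \<Rightarrow> (point \<times> real) measure" where
  "data_dist Dx E m =
     distr (measure_pmf Dx \<Otimes>\<^sub>M E) (count_space UNIV \<Otimes>\<^sub>M borel) (\<lambda>(x, e). (x, m x + e))"

type_synonym dataset = "nat \<Rightarrow> point \<times> real"

definition sample_dist ::
  "nat \<Rightarrow> point pmf \<Rightarrow> real measure \<Rightarrow> (point \<Rightarrow> real) \<Rightarrow> dataset measure" where
  "sample_dist n Dx E m = (\<Pi>\<^sub>M i\<in>{..<n}. data_dist Dx E m)"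

text \<open>A sub-sample of a data set \<open>D\<close> is given by its set \<open>J\<close> of indices.\<close>

definition covariates :: "dataset \<Rightarrow> nat set \<Rightarrow> point set" where
  "covariates D J = (\<lambda>j. fst (D j)) ` J"

definition idx_in :: "dataset \<Rightarrow> nat set \<Rightarrow> cell \<Rightarrow> nat set" where
  "idx_in D J A = {j \<in> J. fst (D j) \<in> A}"

definition cell_mean :: "dataset \<Rightarrow> nat set \<Rightarrow> cell \<Rightarrow> real" where
  "cell_mean D J A = (\<Sum>j\<in>idx_in D J A. snd (D j)) / real (card (idx_in D J A))"

text \<open>Since \<open>0 / 0 = 0\<close>, halves without structure points contribute nothing to \<open>Vsplit\<close>, and
  \<open>Vsplit\<close> vanishes for all coordinates when the cell itself has no structure point.\<close>

definition Vsplit :: "dataset \<Rightarrow> nat set \<Rightarrow> cell \<Rightarrow> nat \<Rightarrow> real" where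
  "Vsplit D J A i =
     (\<Sum>k\<in>{False, True}.
        real (card (idx_in D J (half A i k))) / real (card (idx_in D J A))
          * (cell_mean D J (half A i k))\<^sup>2)"

text \<open>Candidate coordinates are those not fixed in the cell. Cutting along a fixed
  coordinate would leave the cell unchanged and produce an empty set, which is not a cell; such a
  coordinate never has a larger \<open>Vsplit\<close> than one that is not fixed.\<close>

definition best_splits :: "nat \<Rightarrow> dataset \<Rightarrow> nat set \<Rightarrow> cell \<Rightarrow> nat set" where
  "best_splits d D J A =
     {i. is_arg_max (Vsplit D J A) (\<lambda>i. i < d \<and> \<not> fixed_in A i) i}"

text \<open>A node stores the coordinate cut there; its left subtree belongs to value 0 (\<open>False\<close>)
  and its right subtree to value 1 (\<open>True\<close>). The cell of a node is determined by the path to it.\<close>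

datatype split_tree = Leaf | Node nat split_tree split_tree

primrec leaf_cells :: "split_tree \<Rightarrow> cell \<Rightarrow> cell set" where
  "leaf_cells Leaf A = {A}"
| "leaf_cells (Node i l r) A = leaf_cells l (half A i False) \<union> leaf_cells r (half A i True)"

text \<open>One pass over the current leaves from left to right, with structure sample \<open>J\<close>, estimation
  sample \<open>H\<close>, root cell \<open>A\<close> and node counter \<open>c\<close>. Leaves left unsplit in an
  earlier pass are left unsplit again, so the passes are exactly the levels of the
  breadth-first construction. Ties are broken uniformly at random.\<close>

primrec process_level ::
  "nat \<Rightarrow> nat \<Rightarrow> dataset \<Rightarrow> nat set \<Rightarrow> nat set \<Rightarrow> split_tree \<Rightarrow> cell \<Rightarrow> nat
    \<Rightarrow> (split_tree \<times> nat) pmf" where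
  "process_level d t D J H Leaf A c =
     (if t \<le> c \<or> card (covariates D H \<inter> A) \<le> 1 then return_pmf (Leaf, c)
      else map_pmf (\<lambda>i. (Node i Leaf Leaf, c + 1)) (pmf_of_set (best_splits d D J A)))"
| "process_level d t D J H (Node i l r) A c =
     do { (l', c1) \<leftarrow> process_level d t D J H l (half A i False) c;
          (r', c2) \<leftarrow> process_level d t D J H r (half A i True) c1;
          return_pmf (Node i l' r', c2) }"

primrec grow_levels ::
  "nat \<Rightarrow> nat \<Rightarrow> dataset \<Rightarrow> nat set \<Rightarrow> nat set \<Rightarrow> nat \<Rightarrow> (split_tree \<times> nat) pmf" where
  "grow_levels d t D J H 0 = return_pmf (Leaf, 1)"
| "grow_levels d t D J H (Suc k) =
     do { (T, c) \<leftarrow> grow_levels d t D J H k; process_level d t D J H T (cube d) c }"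

text \<open>Random tree on the sub-sample with index set \<open>I\<close>, together with its estimation sample.
  Every cut fixes one further coordinate, so nothing can be cut after \<open>d\<close> levels.
  If \<open>card I\<close> is odd, the estimation half is the larger one.\<close>

definition honest_tree :: "nat \<Rightarrow> nat \<Rightarrow> dataset \<Rightarrow> nat set \<Rightarrow> (split_tree \<times> nat set) pmf" where
  "honest_tree d t D I =
     do { J \<leftarrow> pmf_of_set {J. J \<subseteq> I \<and> card J = card I div 2};
          (T, c) \<leftarrow> grow_levels d t D J (I - J) d;
          return_pmf (T, I - J) }"

text \<open>The cells of the tree that contain \<open>x\<close>, from the leaf up to the root.\<close>

primrec branch :: "split_tree \<Rightarrow> cell \<Rightarrow> point \<Rightarrow> cell list" where
  "branch Leaf A x = [A]"
| "branch (Node i l r) A x =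
     (if x ! i then branch r (half A i True) x else branch l (half A i False) x) @ [A]"

text \<open>The case \<open>None\<close> occurs only for an empty estimation sample.\<close>

definition tree_predict :: "nat \<Rightarrow> dataset \<Rightarrow> nat set \<Rightarrow> split_tree \<Rightarrow> point \<Rightarrow> real" where
  "tree_predict d D H T x =
     (case find (\<lambda>A. idx_in D H A \<noteq> {}) (branch T (cube d) x) of
        Some A \<Rightarrow> cell_mean D H A
      | None \<Rightarrow> 0)"

definition forest :: "nat \<Rightarrow> nat \<Rightarrow> nat \<Rightarrow> nat \<Rightarrow> dataset \<Rightarrow> point \<Rightarrow> real" where
  "forest d n s t D x =
     inverse (real (n choose s)) *
       (\<Sum>I\<in>{I. I \<subseteq> {..<n} \<and> card I = s}.
          measure_pmf.expectation (honest_tree d t D I) (\<lambda>(T, H). tree_predict d D H T x))"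

text \<open>The requirement that \<open>t\<close> is large enough for trees to be fully grown: almost surely, for all
  sub-samples and all outcomes of the internal randomness, the growth is not cut short by the
  bound \<open>t\<close> on the node counter, i.e. every leaf has reached the stopping rule of the algorithm.\<close>

definition fully_grown ::
  "nat \<Rightarrow> nat \<Rightarrow> nat \<Rightarrow> nat \<Rightarrow> point pmf \<Rightarrow> real measure \<Rightarrow> (point \<Rightarrow> real) \<Rightarrow> bool" where
  "fully_grown d n s t Dx E m \<longleftrightarrow>
     (AE D in sample_dist n Dx E m.
        \<forall>I. I \<subseteq> {..<n} \<longrightarrow> card I = s \<longrightarrow>
          (\<forall>(T, H)\<in>set_pmf (honest_tree d t D I).
             \<forall>A\<in>leaf_cells T (cube d). card (covariates D H \<inter> A) \<le> 1))"

definition mse :: "point pmf \<Rightarrow> (point \<Rightarrow> real) \<Rightarrow> (point \<Rightarrow> real) \<Rightarrow> real" where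
  "mse Dx m f = measure_pmf.expectation Dx (\<lambda>x. (m x - f x)\<^sup>2)"

text \<open>Logarithmic factors: powers of the sum of the binary logarithms of \<open>n\<close>, \<open>2^r\<close>,
  \<open>1/\<beta>\<close> and \<open>1/\<zeta>\<close>. The summand 1 keeps them at least 1.\<close>

definition polylog :: "nat \<Rightarrow> nat \<Rightarrow> nat \<Rightarrow> real \<Rightarrow> real \<Rightarrow> real" where
  "polylog p n r \<beta> \<zeta> =
     (1 + log 2 (real n) + log 2 (2 ^ r) + log 2 (1 / \<beta>) + log 2 (1 / \<zeta>)) ^ p"

definition size_rate :: "nat \<Rightarrow> nat \<Rightarrow> real \<Rightarrow> real \<Rightarrow> real \<Rightarrow> real" where
  "size_rate d r \<beta> \<zeta> \<delta> = 2 ^ r * log 2 (real d / \<delta>) / (\<zeta> * \<beta>\<^sup>2)"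

definition error_rate :: "nat \<Rightarrow> nat \<Rightarrow> nat \<Rightarrow> real \<Rightarrow> real \<Rightarrow> real \<Rightarrow> real" where
  "error_rate d n r \<beta> \<zeta> \<delta> = 2 ^ r * log 2 (real d / \<delta>) / (real n * \<zeta> * \<beta>\<^sup>2)"

end

theory Submission
  imports Defs "HOL-Combinatorics.Permutations"
begin

text \<open>The forest averages, over all permutations of the indices, the mean of \<open>N\<close> trees that share
  one structure sample \<open>J\<close> and have disjoint estimation samples \<open>H 0, \<dots>, H (N - 1)\<close>, where
  \<open>N\<close> is of order \<open>n / s\<close>. By convexity it suffices to bound the error of one such block mean, and
  of one tree grown from \<open>J\<close> without a stopping rule: by honesty that tree is independent of the
  estimation samples, which only determine where it is pruned.

  By Bernstein's inequality the structure sample makes the tree split all relevant coordinates first,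
  so that the error of a pruned tree at \<open>x\<close> is the mean of the noise over the cell of \<open>x\<close>. The mean
  square error of the block mean is therefore a quadratic form in the noise. A Bernstein or Hoeffding
  bound for the block mean as a sum of \<open>N\<close> independent functions would lose a factor
  \<open>log (1 / \<delta>)\<close>; instead one uses that a single estimation point influences the prediction on a mass of
  order \<open>1 / s\<close> only, up to logarithms. This makes the row sums of the quadratic form so small that
  its deviations do not exceed its mean except with probability \<open>exp (- s / 3)\<close>. The influence bound
  holds away from the nodes that are undersampled by the estimation sample; their total mass, summed
  over the blocks, is bounded through its exponential moment.\<close>

section \<open>Trees as prunings of a full tree\<close>

text \<open>The target error is \<open>s / n\<close> up to logarithms, and \<open>s\<close> already
  contains \<open>log 2 (d / \<delta>)\<close>. A tail bound for a mean of \<open>N\<close> bounded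
  independent errors has scale \<open>1 / N\<close>, so confidence \<open>1 - \<delta>\<close> would
  cost a second such logarithm. The quadratic form has at most \<open>2 * N * h\<close> noise
  variables, where \<open>h\<close> is the size of an estimation sample, entries at most
  \<open>w / N\<^sup>2\<close> and row sums at most \<open>w / N\<close>, with \<open>w\<close> of
  order \<open>1 / h\<close> up to logarithms. Its mean is of order at most
  \<open>h * w / N\<close>, but its exponential tail has the much finer scale \<open>w / N\<close>.
  A deviation as large as the mean thus has a probability exponentially small in \<open>h\<close>,
  and \<open>h\<close> is large enough to bring this below \<open>\<delta>\<close>.

  The other obstacle is that permutations and trees are far too numerous for a union bound. Failures
  are averaged instead: the structure sample fixes the weights of the trees, independently of the
  other data, and Markov's inequality at level \<open>1 / n\<close>, applied once to the averaged
  failure, costs only a factor \<open>n\<close>, which a logarithm in \<open>s\<close>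
  absorbs.\<close>

primrec full_tree :: "(cell \<Rightarrow> nat set) \<Rightarrow> nat \<Rightarrow> cell \<Rightarrow> split_tree pmf" where
  "full_tree B 0 A = return_pmf Leaf"
| "full_tree B (Suc k) A =
     (if B A = {} then return_pmf Leaf
      else do { i \<leftarrow> pmf_of_set (B A);
                l \<leftarrow> full_tree B k (half A i False);
                r \<leftarrow> full_tree B k (half A i True);
                return_pmf (Node i l r) })"

primrec prune :: "point set \<Rightarrow> split_tree \<Rightarrow> cell \<Rightarrow> split_tree" where
  "prune S Leaf A = Leaf"
| "prune S (Node i l r) A =
     (if card (S \<inter> A) \<le> 1 then Leaf
      else Node i (prune S l (half A i False)) (prune S r (half A i True)))"

text \<open>Depth-first growth with the stopping rule: the common form to which both the pruning of
  an unstopped tree and the repeated passes over the leaves are reduced.\<close>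

primrec grow_tree :: "(cell \<Rightarrow> nat set) \<Rightarrow> point set \<Rightarrow> nat \<Rightarrow> cell \<Rightarrow> split_tree pmf" where
  "grow_tree B S 0 A = return_pmf Leaf"
| "grow_tree B S (Suc k) A =
     (if card (S \<inter> A) \<le> 1 then return_pmf Leaf
      else do { i \<leftarrow> pmf_of_set (B A);
                l \<leftarrow> grow_tree B S k (half A i False);
                r \<leftarrow> grow_tree B S k (half A i True);
                return_pmf (Node i l r) })"

primrec split_leaves :: "(cell \<Rightarrow> nat set) \<Rightarrow> point set \<Rightarrow> split_tree \<Rightarrow> cell \<Rightarrow> split_tree pmf" where
  "split_leaves B S Leaf A =
     (if card (S \<inter> A) \<le> 1 then return_pmf Leaf
      else map_pmf (\<lambda>i. Node i Leaf Leaf) (pmf_of_set (B A)))"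
| "split_leaves B S (Node i l r) A =
     do { l' \<leftarrow> split_leaves B S l (half A i False);
          r' \<leftarrow> split_leaves B S r (half A i True);
          return_pmf (Node i l' r') }"

primrec split_levels ::
  "(cell \<Rightarrow> nat set) \<Rightarrow> point set \<Rightarrow> nat \<Rightarrow> split_tree \<Rightarrow> cell \<Rightarrow> split_tree pmf" where
  "split_levels B S 0 T A = return_pmf T"
| "split_levels B S (Suc k) T A = bind_pmf (split_levels B S k T A) (\<lambda>T'. split_leaves B S T' A)"

lemma half_subset: "half A i k \<subseteq> A"
  by (auto simp: half_def)

lemma half_disjoint: "half A i False \<inter> half A i True = {}"
  by (auto simp: half_def)

lemma half_Un: "half A i False \<union> half A i True = A"
  by (auto simp: half_def)

text \<open>A subtree cut off by pruning is integrated out, its law having total mass 1. The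
  hypothesis excludes that the full tree ends for lack of a coordinate where two points of
  \<open>S\<close> still demand a cut.\<close>

lemma map_prune_full_tree:
  assumes "\<And>C. C \<subseteq> A \<Longrightarrow> card (S \<inter> C) > 1 \<Longrightarrow> B C \<noteq> {}"
  shows "map_pmf (\<lambda>\<tau>. prune S \<tau> A) (full_tree B k A) = grow_tree B S k A"
  using assms
proof (induction k arbitrary: A)
  case (Suc k)
  have IH: "map_pmf (\<lambda>\<tau>. prune S \<tau> (half A i b)) (full_tree B k (half A i b))
      = grow_tree B S k (half A i b)" for i b
    by (rule Suc.IH) (use Suc.prems half_subset in blast)
  show ?case
  proof (cases "card (S \<inter> A) \<le> 1")
    case True
    then have "prune S \<tau> A = Leaf" for \<tau> by (cases \<tau>) auto
    then show ?thesis using True by (simp add: map_pmf_const)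
  next
    case False
    then have "B A \<noteq> {}" using Suc.prems[of A] by auto
    then show ?thesis using False
      by (simp add: map_bind_pmf IH[symmetric] bind_map_pmf)
  qed
qed simp

text \<open>The random choices in the two subtrees are independent, so all passes over the left
  subtree can be moved in front of those over the right one; \<open>bind_commute_pmf\<close> makes
  the exchange.\<close>

lemma split_levels_Node:
  "split_levels B S k (Node i l r) A =
     do { l' \<leftarrow> split_levels B S k l (half A i False);
          r' \<leftarrow> split_levels B S k r (half A i True);
          return_pmf (Node i l' r') }"
proof (induction k)
  case (Suc k)
  show ?case
    by (simp add: Suc.IH bind_assoc_pmf bind_return_pmf)
       (subst bind_commute_pmf[of "split_levels B S k r (half A i True)"], rule refl)
qed (simp add: bind_return_pmf)

lemma split_levels_Suc:
  "split_levels B S (Suc k) T A = bind_pmf (split_leaves B S T A) (\<lambda>T'. split_levels B S k T' A)"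
  by (induction k) (simp_all add: bind_return_pmf bind_return_pmf' bind_assoc_pmf)

lemma grow_tree_stop: "card (S \<inter> A) \<le> 1 \<Longrightarrow> grow_tree B S k A = return_pmf Leaf"
  by (cases k) simp_all

text \<open>Once the first pass is peeled off, the other passes act on two separate subtrees, which
  is the recursion of \<open>grow_tree\<close>. Without a counter, breadth-first and depth-first
  growth have the same law.\<close>

lemma split_levels_Leaf: "split_levels B S k Leaf A = grow_tree B S k A"
proof (induction k arbitrary: A)
  case (Suc k)
  show ?case
    unfolding split_levels_Suc
    using grow_tree_stop[of S A]
    by (simp add: bind_return_pmf bind_map_pmf split_levels_Node Suc.IH)
qed simp

lemma process_level_exhausted:
  "t \<le> c \<Longrightarrow> process_level d t D J H T A c = return_pmf (T, c)"
  by (induction T arbitrary: A) (simp_all add: bind_return_pmf)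

lemma process_level_mono:
  "(T', c') \<in> set_pmf (process_level d t D J H T A c) \<Longrightarrow> c \<le> c'"
proof (induction T arbitrary: A T' c c')
  case (Node i l r)
  then obtain l' c1 r' where
    l': "(l', c1) \<in> set_pmf (process_level d t D J H l (half A i False) c)" and
    r': "(r', c') \<in> set_pmf (process_level d t D J H r (half A i True) c1)"
    by (auto simp: split_beta)
  show ?case using Node.IH(1)[OF l'] Node.IH(2)[OF r'] by simp
qed (auto split: if_splits)

lemma set_process_level_Node:
  assumes "(l', c1) \<in> set_pmf (process_level d t D J H l (half A i False) c)"
    and "(r', c2) \<in> set_pmf (process_level d t D J H r (half A i True) c1)"
  shows "(Node i l' r', c2) \<in> set_pmf (process_level d t D J H (Node i l r) A c)"
  unfolding process_level.simps set_bind_pmf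
  by (rule UN_I[OF assms(1)]) (use assms(2) in \<open>simp add: set_bind_pmf, rule bexI[rotated], auto\<close>)

text \<open>The counter blocks a leaf only when \<open>t \<le> c\<close>, and by hypothesis such a
  leaf is then stopped by the estimation sample anyway. Forgetting the counter therefore gives the
  pass without a counter.\<close>

lemma process_level_uncut:
  assumes "\<And>T' c' C. (T', c') \<in> set_pmf (process_level d t D J H T A c) \<Longrightarrow> t \<le> c'
     \<Longrightarrow> C \<in> leaf_cells T' A \<Longrightarrow> card (covariates D H \<inter> C) \<le> 1"
  shows "map_pmf fst (process_level d t D J H T A c)
    = split_leaves (best_splits d D J) (covariates D H) T A"
  using assms
proof (induction T arbitrary: A c)
  case Leaf
  show ?case
  proof (cases "t \<le> c")
    case True
    then show ?thesis using Leaf[of Leaf c A] by simp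
  next
    case False
    then show ?thesis by (simp add: pmf.map_comp o_def)
  qed
next
  case (Node i l r)
  let ?A0 = "half A i False" and ?A1 = "half A i True"
  let ?P0 = "process_level d t D J H l ?A0 c"
  let ?P1 = "\<lambda>c1. process_level d t D J H r ?A1 c1"
  have l: "map_pmf fst ?P0 = split_leaves (best_splits d D J) (covariates D H) l ?A0"
  proof (rule Node.IH(1))
    fix T' c' C
    assume *: "(T', c') \<in> set_pmf ?P0" "t \<le> c'" "C \<in> leaf_cells T' ?A0"
    \<comment> \<open>The hypothesis speaks of outcomes for the whole node, so the outcome on the
      left is completed by an arbitrary one on the right.\<close>
    obtain r' c2 where r': "(r', c2) \<in> set_pmf (?P1 c')"
      using set_pmf_not_empty[of "?P1 c'"] by (metis ex_in_conv surj_pair)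
    have "t \<le> c2" using process_level_mono[OF r'] *(2) by simp
    then show "card (covariates D H \<inter> C) \<le> 1"
      using * set_process_level_Node[OF *(1) r'] by (intro Node.prems[of "Node i T' r'" c2]) simp_all
  qed
  have r: "map_pmf fst (?P1 c1) = split_leaves (best_splits d D J) (covariates D H) r ?A1"
    if "(l', c1) \<in> set_pmf ?P0" for l' c1
  proof (rule Node.IH(2))
    fix T' c' C
    assume *: "(T', c') \<in> set_pmf (?P1 c1)" "t \<le> c'" "C \<in> leaf_cells T' ?A1"
    then show "card (covariates D H \<inter> C) \<le> 1"
      using set_process_level_Node[OF that *(1)] by (intro Node.prems[of "Node i l' T'" c']) simp_all
  qed
  have "map_pmf fst (process_level d t D J H (Node i l r) A c)
      = bind_pmf ?P0 (\<lambda>x. bind_pmf (?P1 (snd x)) (\<lambda>y. return_pmf (Node i (fst x) (fst y))))"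
    by (simp add: map_bind_pmf split_beta)
  also have "\<dots> = bind_pmf ?P0 (\<lambda>x. bind_pmf (map_pmf fst (?P1 (snd x)))
      (\<lambda>r'. return_pmf (Node i (fst x) r')))"
    by (simp add: bind_map_pmf)
  also have "\<dots> = bind_pmf ?P0 (\<lambda>x. bind_pmf (split_leaves (best_splits d D J) (covariates D H) r ?A1)
      (\<lambda>r'. return_pmf (Node i (fst x) r')))"
    using r[of "fst x" "snd x" for x] by (intro bind_pmf_cong refl) simp
  also have "\<dots> = bind_pmf (map_pmf fst ?P0) (\<lambda>l'. bind_pmf (split_leaves (best_splits d D J) (covariates D H) r ?A1)
      (\<lambda>r'. return_pmf (Node i l' r')))"
    by (simp add: bind_map_pmf)
  finally show ?case by (simp add: l)
qed

lemma grow_levels_uncut: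
  assumes "\<And>T c C. (T, c) \<in> set_pmf (grow_levels d t D J H K) \<Longrightarrow> C \<in> leaf_cells T (cube d)
     \<Longrightarrow> card (covariates D H \<inter> C) \<le> 1"
    and "k \<le> K"
  shows "map_pmf fst (grow_levels d t D J H k)
    = grow_tree (best_splits d D J) (covariates D H) k (cube d)"
proof -
  \<comment> \<open>Once the counter has reached \<open>t\<close>, later passes change nothing. A
    tree stopped early is thus also a possible final tree, and the hypothesis on final trees applies
    to it.\<close>
  have stay: "(T, c) \<in> set_pmf (grow_levels d t D J H (k + i))"
    if "(T, c) \<in> set_pmf (grow_levels d t D J H k)" "t \<le> c" for T c k i
  proof (induction i)
    case (Suc i)
    then show ?case
      using process_level_exhausted[OF that(2), of d D J H T "cube d"]
      by (auto intro!: bexI[of _ "(T, c)"])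
  qed (use that in simp)
  have uncut: "card (covariates D H \<inter> C) \<le> 1"
    if "(T, c) \<in> set_pmf (grow_levels d t D J H k)" "t \<le> c" "k \<le> K" "C \<in> leaf_cells T (cube d)"
    for T c k C
    using stay[OF that(1,2), of "K - k"] that(3,4) assms(1)[of T c C] by simp
  show ?thesis
    unfolding split_levels_Leaf[symmetric] using \<open>k \<le> K\<close>
  proof (induction k)
    case (Suc k)
    have "map_pmf fst (grow_levels d t D J H (Suc k))
        = bind_pmf (grow_levels d t D J H k)
            (\<lambda>x. map_pmf fst (process_level d t D J H (fst x) (cube d) (snd x)))"
      by (simp add: map_bind_pmf split_beta)
    also have "\<dots> = bind_pmf (grow_levels d t D J H k)
            (\<lambda>x. split_leaves (best_splits d D J) (covariates D H) (fst x) (cube d))"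
    proof (intro bind_pmf_cong refl process_level_uncut)
      fix x T' c' C
      assume "x \<in> set_pmf (grow_levels d t D J H k)"
        "(T', c') \<in> set_pmf (process_level d t D J H (fst x) (cube d) (snd x))"
        "t \<le> c'" "C \<in> leaf_cells T' (cube d)"
      then show "card (covariates D H \<inter> C) \<le> 1"
        using Suc.prems by (intro uncut[of T' c' "Suc k"]) (auto simp: split_beta)
    qed
    also have "\<dots> = bind_pmf (map_pmf fst (grow_levels d t D J H k))
            (\<lambda>T. split_leaves (best_splits d D J) (covariates D H) T (cube d))"
      by (simp add: bind_map_pmf)
    finally show ?case using Suc by simp
  qed simp
qed

section \<open>Best splits exist wherever a cell holds two distinct points\<close>

lemma finite_cube: "finite (cube d)"
  using finite_lists_length_eq[of "UNIV :: bool set" d] by (simp add: cube_def)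

lemma best_splits_nonempty:
  assumes "i < d" "\<not> fixed_in A i"
  shows "best_splits d D J A \<noteq> {}"
proof -
  let ?I = "{i. i < d \<and> \<not> fixed_in A i}"
  have fin: "finite ?I" and ne: "?I \<noteq> {}" using assms by auto
  have "Max (Vsplit D J A ` ?I) \<in> Vsplit D J A ` ?I" using fin ne by (intro Max_in) auto
  then obtain j where "j \<in> ?I" "Max (Vsplit D J A ` ?I) = Vsplit D J A j" by auto
  moreover have "\<forall>k\<in>?I. Vsplit D J A k \<le> Max (Vsplit D J A ` ?I)" using fin by (auto intro: Max_ge)
  ultimately have "j \<in> best_splits d D J A"
    unfolding best_splits_def is_arg_max_def by (auto simp: not_less[symmetric])
  then show ?thesis by auto
qed

lemma best_splits_subset: "best_splits d D J A \<subseteq> {i. i < d \<and> \<not> fixed_in A i}"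
  by (auto simp: best_splits_def is_arg_max_def)

lemma finite_best_splits [simp]: "finite (best_splits d D J A)"
  using finite_subset[OF best_splits_subset] by auto

lemma best_splits_nonempty_if_two_points:
  assumes "A \<subseteq> cube d" "card (S \<inter> A) > 1"
  shows "best_splits d D J A \<noteq> {}"
proof -
  have "finite (S \<inter> A)" using assms(2) by (rule_tac ccontr) simp
  then obtain x y where xy: "x \<in> A" "y \<in> A" "x \<noteq> y"
    using assms(2) card_le_Suc0_iff_eq[of "S \<inter> A"] by auto
  then have "length x = d" "length y = d" using assms(1) by (auto simp: cube_def)
  with xy obtain i where "i < d" "x ! i \<noteq> y ! i" using nth_equalityI[of x y] by auto
  with xy have "\<not> fixed_in A i" by (auto simp: fixed_in_def)
  with \<open>i < d\<close> show ?thesis by (rule best_splits_nonempty)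
qed

lemma grow_levels_eq_prune_full_tree:
  assumes "\<And>T c C. (T, c) \<in> set_pmf (grow_levels d t D J H d) \<Longrightarrow> C \<in> leaf_cells T (cube d)
     \<Longrightarrow> card (covariates D H \<inter> C) \<le> 1"
  shows "map_pmf fst (grow_levels d t D J H d)
    = map_pmf (\<lambda>\<tau>. prune (covariates D H) \<tau> (cube d)) (full_tree (best_splits d D J) d (cube d))"
proof -
  have "map_pmf (\<lambda>\<tau>. prune (covariates D H) \<tau> (cube d)) (full_tree (best_splits d D J) d (cube d))
      = grow_tree (best_splits d D J) (covariates D H) d (cube d)"
    by (rule map_prune_full_tree) (rule best_splits_nonempty_if_two_points)
  moreover have "map_pmf fst (grow_levels d t D J H d)
      = grow_tree (best_splits d D J) (covariates D H) d (cube d)"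
    by (rule grow_levels_uncut[of d t D J H d]) (rule assms, assumption+, rule order_refl)
  ultimately show ?thesis by simp
qed

section \<open>Cells used for prediction and their influence\<close>

text \<open>Merges pruning with the fallback to the closest ancestor that has data: the descent also
  ends where the half containing \<open>x\<close> has no estimation point. It is read off the
  unpruned tree, whose law does not involve the estimation sample.\<close>

primrec resolved_cell :: "dataset \<Rightarrow> nat set \<Rightarrow> split_tree \<Rightarrow> cell \<Rightarrow> point \<Rightarrow> cell" where
  "resolved_cell D H Leaf A x = A"
| "resolved_cell D H (Node i l r) A x =
     (if card (covariates D H \<inter> A) \<le> 1 \<or> idx_in D H (half A i (x ! i)) = {} then A
      else if x ! i then resolved_cell D H r (half A i True) x
      else resolved_cell D H l (half A i False) x)"

lemma branch_subset: "C \<in> set (branch T A x) \<Longrightarrow> C \<subseteq> A"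
proof (induction T arbitrary: A)
  case (Node i l r)
  then show ?case using half_subset by (auto split: if_splits) blast+
qed simp

lemma idx_in_mono: "A \<subseteq> B \<Longrightarrow> idx_in D H A \<subseteq> idx_in D H B"
  by (auto simp: idx_in_def)

lemma find_append: "find P (xs @ ys) = (case find P xs of None \<Rightarrow> find P ys | Some z \<Rightarrow> Some z)"
  by (induction xs) auto

text \<open>A cell without points has only subcells without points. Hence the first nonempty cell
  from the leaf upwards is the last one reached from the root through nonempty cells.\<close>

lemma find_branch_prune:
  assumes "idx_in D H A \<noteq> {}"
  shows "find (\<lambda>C. idx_in D H C \<noteq> {}) (branch (prune (covariates D H) \<tau> A) A x)
    = Some (resolved_cell D H \<tau> A x)"
  using assms
proof (induction \<tau> arbitrary: A)
  case (Node i l r)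
  have none: "find (\<lambda>C. idx_in D H C \<noteq> {}) (branch T B x) = None" if "idx_in D H B = {}" for T B
    using that idx_in_mono[OF branch_subset, of _ T B x D H]
    by (auto simp: find_None_iff)
  show ?case
    using Node.prems Node.IH none by (auto simp: find_append)
qed simp

lemma tree_predict_prune:
  assumes "idx_in D H (cube d) \<noteq> {}"
  shows "tree_predict d D H (prune (covariates D H) \<tau> (cube d)) x
    = cell_mean D H (resolved_cell D H \<tau> (cube d) x)"
  by (simp add: tree_predict_def find_branch_prune[OF assms])

lemma resolved_cell_subset: "resolved_cell D H \<tau> A x \<subseteq> A"
proof (induction \<tau> arbitrary: A)
  case (Node i l r)
  then show ?case using half_subset by simp blast
qed simp

lemma resolved_cell_nonempty:
  "idx_in D H A \<noteq> {} \<Longrightarrow> idx_in D H (resolved_cell D H \<tau> A x) \<noteq> {}"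
  by (induction \<tau> arbitrary: A) auto

lemma idx_in_cong: "(\<And>j. j \<in> H \<Longrightarrow> fst (D j) = fst (D' j)) \<Longrightarrow> idx_in D H A = idx_in D' H A"
  by (auto simp: idx_in_def)

lemma covariates_cong: "(\<And>j. j \<in> H \<Longrightarrow> fst (D j) = fst (D' j)) \<Longrightarrow> covariates D H = covariates D' H"
  by (auto simp: covariates_def)

lemma resolved_cell_cong:
  "(\<And>j. j \<in> H \<Longrightarrow> fst (D j) = fst (D' j)) \<Longrightarrow> resolved_cell D H \<tau> A x = resolved_cell D' H \<tau> A x"
  by (induction \<tau> arbitrary: A) (simp_all add: idx_in_cong[of H D D'] covariates_cong[of H D D'])

text \<open>Union of all nodes with property \<open>P\<close>. The recursion may stop at the topmost
  one on each path, because the nodes below are contained in it.\<close>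

primrec node_union :: "(cell \<Rightarrow> bool) \<Rightarrow> split_tree \<Rightarrow> cell \<Rightarrow> point set" where
  "node_union P Leaf A = (if P A then A else {})"
| "node_union P (Node i l r) A =
     (if P A then A else node_union P l (half A i False) \<union> node_union P r (half A i True))"

lemma node_union_subset: "node_union P \<tau> A \<subseteq> A"
proof (induction \<tau> arbitrary: A)
  case (Node i l r)
  then show ?case using half_subset by simp blast
qed simp

text \<open>The witness is the topmost \<open>P\<close>-node on the path of \<open>x\<close>; it
  puts \<open>x\<close> into the union for every other predicate that it satisfies. So predicates
  can be exchanged node by node.\<close>

lemma node_union_mono:
  assumes "x \<in> node_union P \<tau> A"
  shows "\<exists>C. P C \<and> C \<subseteq> A \<and> (\<forall>Q. Q C \<longrightarrow> x \<in> node_union Q \<tau> A)"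
  using assms
proof (induction \<tau> arbitrary: A)
  case (Node i l r)
  show ?case
  proof (cases "P A")
    case True
    then show ?thesis using Node.prems by (intro exI[of _ A]) simp
  next
    case False
    define b where "b = (x ! i)"
    let ?t = "if b then r else l"
    have x: "x \<in> node_union P ?t (half A i b)"
      using False Node.prems node_union_subset[of P l "half A i False"]
        node_union_subset[of P r "half A i True"] by (auto simp: b_def half_def)
    then obtain C where C: "P C" "C \<subseteq> half A i b" "\<And>Q. Q C \<Longrightarrow> x \<in> node_union Q ?t (half A i b)"
      using Node.IH(1)[of "half A i False"] Node.IH(2)[of "half A i True"] by (cases b) auto
    have "x \<in> A" using x node_union_subset half_subset by blast
    then have "x \<in> node_union Q (Node i l r) A" if "Q C" for Q
      using C(3)[of Q, OF that] by (cases b) simp_all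
    moreover have "C \<subseteq> A" using C(2) half_subset[of A i b] by simp
    ultimately show ?thesis using C(1) by blast
  qed
next
  case Leaf
  then show ?case by (intro exI[of _ A]) (simp split: if_splits)
qed

lemma node_union_cover:
  assumes "\<And>C. C \<subseteq> A \<Longrightarrow> P C \<Longrightarrow> \<exists>a\<in>S. Q a C"
  shows "node_union P \<tau> A \<subseteq> (\<Union>a\<in>S. node_union (Q a) \<tau> A)"
proof
  fix x assume "x \<in> node_union P \<tau> A"
  from node_union_mono[OF this] obtain C
    where C: "P C" "C \<subseteq> A" and mem: "\<forall>Q. Q C \<longrightarrow> x \<in> node_union Q \<tau> A"
    by (elim exE conjE)
  from assms[OF C(2,1)] obtain a where "a \<in> S" "Q a C" ..
  with mem show "x \<in> (\<Union>a\<in>S. node_union (Q a) \<tau> A)" by (intro UN_I[of a]) simp_all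
qed

text \<open>The minimal nodes of mass at least \<open>a\<close>: either both halves are lighter or
  the tree ends there. They are disjoint, so for \<open>a > 0\<close> there are at most
  \<open>1 / a\<close> of them, however large the tree.\<close>

primrec skeleton :: "point pmf \<Rightarrow> real \<Rightarrow> split_tree \<Rightarrow> cell \<Rightarrow> cell set" where
  "skeleton p a Leaf A = (if a \<le> measure_pmf.prob p A then {A} else {})"
| "skeleton p a (Node i l r) A =
     (if a \<le> measure_pmf.prob p A then
        if measure_pmf.prob p (half A i False) < a \<and> measure_pmf.prob p (half A i True) < a then {A}
        else skeleton p a l (half A i False) \<union> skeleton p a r (half A i True)
      else {})"

lemma prob_half_add:
  "measure_pmf.prob p (half A i False) + measure_pmf.prob p (half A i True) = measure_pmf.prob p A"
  using measure_pmf.finite_measure_Union[of "half A i False" p "half A i True"]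
  by (simp add: half_disjoint half_Un)

lemma skeleton_members: "C \<in> skeleton p a \<tau> A \<Longrightarrow> C \<subseteq> A \<and> a \<le> measure_pmf.prob p C"
proof (induction \<tau> arbitrary: A)
  case (Node i l r)
  then show ?case using half_subset[of A i] by (auto split: if_splits) blast+
qed (auto split: if_splits)

lemma skeleton_empty: "measure_pmf.prob p A < a \<Longrightarrow> skeleton p a \<tau> A = {}"
  by (cases \<tau>) auto

lemma skeleton_nonempty: "a \<le> measure_pmf.prob p A \<Longrightarrow> skeleton p a \<tau> A \<noteq> {}"
  by (induction \<tau> arbitrary: A) (auto simp: not_less)

lemma finite_skeleton: "finite (skeleton p a \<tau> A)"
  by (induction \<tau> arbitrary: A) auto

lemma skeleton_halves_disjoint:
  assumes "0 < a"
  shows "skeleton p a l (half A i False) \<inter> skeleton p a r (half A i True) = {}"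
proof -
  have False if "C \<in> skeleton p a l (half A i False)" "C \<in> skeleton p a r (half A i True)" for C
  proof -
    have "C = {}"
      using skeleton_members[OF that(1)] skeleton_members[OF that(2)] half_disjoint[of A i] by blast
    then show False using skeleton_members[OF that(1)] assms by simp
  qed
  then show ?thesis by blast
qed

lemma skeleton_disjoint:
  "C \<in> skeleton p a \<tau> A \<Longrightarrow> C' \<in> skeleton p a \<tau> A \<Longrightarrow> C \<noteq> C' \<Longrightarrow> C \<inter> C' = {}"
proof (induction \<tau> arbitrary: A)
  case (Node i l r)
  have *: "C \<inter> C' = {}" if "C \<in> skeleton p a l (half A i False)" "C' \<in> skeleton p a r (half A i True)"
    for C C'
    using skeleton_members[OF that(1)] skeleton_members[OF that(2)] half_disjoint[of A i] by blast
  show ?case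
    using Node.prems Node.IH *[of C C'] *[of C' C] by (auto split: if_splits)
qed (auto split: if_splits)

lemma card_skeleton:
  assumes "0 < a"
  shows "a * real (card (skeleton p a \<tau> A)) \<le> measure_pmf.prob p A"
proof (induction \<tau> arbitrary: A)
  case (Node i l r)
  have "card (skeleton p a l (half A i False) \<union> skeleton p a r (half A i True))
      = card (skeleton p a l (half A i False)) + card (skeleton p a r (half A i True))"
    by (intro card_Un_disjoint finite_skeleton skeleton_halves_disjoint assms)
  then show ?case
    using Node.IH(1)[of "half A i False"] Node.IH(2)[of "half A i True"] prob_half_add[of p A i]
    by (simp add: algebra_simps)
qed simp

text \<open>A node whose mass lies in \<open>[a, 2 * a)\<close> contains a skeleton cell carrying at least half of its
  mass; an undersampled node therefore forces an undersampled skeleton cell. This avoids a union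
  bound over the nodes of the tree, whose number grows with the dimension.\<close>

lemma prob_undersampled_le_skeleton:
  fixes h a :: real and p :: "point pmf" and D :: dataset
  assumes "0 < a" "finite H" "0 \<le> h"
  defines "P \<equiv> (\<lambda>C. a \<le> measure_pmf.prob p C \<and> measure_pmf.prob p C < 2 * a \<and>
      real (card (idx_in D H C)) < h * measure_pmf.prob p C / 4)"
  shows "measure_pmf.prob p (node_union P \<tau> A)
    \<le> (\<Sum>C\<in>skeleton p a \<tau> A. 2 * measure_pmf.prob p C *
         of_bool (real (card (idx_in D H C)) < h * measure_pmf.prob p C / 2))"
    (is "_ \<le> sum ?f _")
proof (induction \<tau> arbitrary: A)
  case (Node i l r)
  note IH = Node.IH
  have f0: "0 \<le> ?f C" for C by simp
  show ?case
  proof (cases "P A")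
    \<comment> \<open>All of \<open>A\<close> is counted here. The factor 2 in the summands pays for
      the mass of \<open>A\<close> being up to \<open>2 * a\<close>, and the threshold of a quarter
      for \<open>A\<close> turns into a half for \<open>C\<close>.\<close>
    case True
    then obtain C where C: "C \<in> skeleton p a (Node i l r) A"
      using skeleton_nonempty unfolding P_def by (metis ex_in_conv)
    have "?f C \<le> sum ?f (skeleton p a (Node i l r) A)"
      using C by (intro member_le_sum f0 finite_skeleton)
    moreover have "real (card (idx_in D H C)) < h * measure_pmf.prob p C / 2"
    proof -
      have "card (idx_in D H C) \<le> card (idx_in D H A)"
        using skeleton_members[OF C] assms(2) by (intro card_mono idx_in_mono) (auto simp: idx_in_def)
      moreover have "h * measure_pmf.prob p A / 4 \<le> h * measure_pmf.prob p C / 2"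
        using True skeleton_members[OF C] \<open>0 \<le> h\<close> mult_left_mono[of "measure_pmf.prob p A" "2 * measure_pmf.prob p C" h]
        by (auto simp: P_def)
      ultimately show ?thesis using True unfolding P_def by linarith
    qed
    ultimately show ?thesis using True skeleton_members[OF C] by (simp add: P_def)
  next
    case False
    have le: "measure_pmf.prob p (node_union P (Node i l r) A)
        \<le> sum ?f (skeleton p a l (half A i False)) + sum ?f (skeleton p a r (half A i True))"
      using False measure_Un_le[of "node_union P l (half A i False)" p
          "node_union P r (half A i True)"] IH(1)[of "half A i False"] IH(2)[of "half A i True"] by simp
    have eq: "sum ?f (skeleton p a l (half A i False)) + sum ?f (skeleton p a r (half A i True))
        = sum ?f (skeleton p a l (half A i False) \<union> skeleton p a r (half A i True))"
      by (intro sum.union_disjoint[symmetric] finite_skeleton skeleton_halves_disjoint assms)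
    have "skeleton p a l (half A i False) \<union> skeleton p a r (half A i True)
         \<subseteq> skeleton p a (Node i l r) A"
    proof (cases "a \<le> measure_pmf.prob p A")
      case False
      then have "measure_pmf.prob p (half A i False) < a" "measure_pmf.prob p (half A i True) < a"
        using prob_half_add[of p A i] measure_nonneg[of p "half A i True"]
          measure_nonneg[of p "half A i False"] by linarith+
      then show ?thesis by (simp add: skeleton_empty)
    qed (auto simp: skeleton_empty)
    then have "sum ?f (skeleton p a l (half A i False) \<union> skeleton p a r (half A i True))
        \<le> sum ?f (skeleton p a (Node i l r) A)"
      by (intro sum_mono2 finite_skeleton f0) auto
    with le eq show ?thesis by linarith
  qed
next
  case Leaf
  then show ?case using assms(3)
    mult_nonneg_nonneg[OF assms(3) measure_nonneg[of p A]] by (auto simp: P_def of_bool_def)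
qed

text \<open>The weight of sample point \<open>j\<close> in the prediction at \<open>x\<close>,
  integrated over the law of \<open>x\<close> away from \<open>U\<close>. Bounds on it become bounds
  on the row sums of the quadratic form in the noise.\<close>

definition influence :: "point pmf \<Rightarrow> dataset \<Rightarrow> nat set \<Rightarrow> (point set) \<Rightarrow> split_tree \<Rightarrow> cell \<Rightarrow> nat \<Rightarrow> real" where
  "influence p D H U \<tau> A j = (\<Sum>x\<in>A - U. pmf p x *
     (of_bool (fst (D j) \<in> resolved_cell D H \<tau> A x) / real (card (idx_in D H (resolved_cell D H \<tau> A x)))))"

lemma influence_le_prob:
  assumes "finite A"
  shows "influence p D H U \<tau> A j \<le> measure_pmf.prob p A"
proof -
  have *: "b / real c \<le> 1" if "b \<le> 1" "0 \<le> b" for c :: nat and b :: real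
    using that by (cases "c = 0") (auto simp: divide_le_eq)
  have "influence p D H U \<tau> A j \<le> (\<Sum>x\<in>A - U. pmf p x * 1)"
    unfolding influence_def by (intro sum_mono mult_left_mono *) auto
  also have "\<dots> \<le> (\<Sum>x\<in>A. pmf p x)" using assms by (auto intro: sum_mono2)
  finally show ?thesis using assms by (simp add: measure_measure_pmf_finite)
qed

text \<open>This is \<open>ln (1 - y) \<le> - y\<close> for \<open>y = e / u\<close>: splitting off
  mass \<open>e\<close> lowers the logarithm by at least the relative mass lost.\<close>

lemma ln_ratio_step:
  fixes u e v :: real
  assumes "0 < v" "v \<le> u - e" "0 \<le> e"
  shows "e / u + ln ((u - e) / v) \<le> ln (u / v)"
proof -
  have pos: "0 < u - e" "0 < u" using assms by linarith+
  have "ln ((u - e) / u) \<le> (u - e) / u - 1" using pos by (intro ln_le_minus_one) auto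
  moreover have "(u - e) / u - 1 = - (e / u)" using pos by (simp add: field_simps)
  ultimately show ?thesis using pos assms by (simp add: ln_div)
qed

text \<open>Along the path to a sample point every empty sibling of mass \<open>e\<close> split off from a node of
  mass \<open>u\<close> adds at most \<open>4 * e / (h * u)\<close>, and these contributions telescope to a logarithm.\<close>

lemma influence_le:
  fixes h v :: real and p :: "point pmf" and D :: dataset
  assumes "0 < v" "0 < h" "finite H" "finite A" "j \<in> H" "idx_in D H A \<noteq> {}"
  defines "P \<equiv> (\<lambda>C. v \<le> measure_pmf.prob p C \<and> real (card (idx_in D H C)) < h * measure_pmf.prob p C / 4)"
  shows "influence p D H (node_union P \<tau> A) \<tau> A j
    \<le> v + 4 / h * (1 + max 0 (ln (measure_pmf.prob p A / v)))"
  using assms(4,6)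
proof (induction \<tau> arbitrary: A)
  let ?\<mu> = "measure_pmf.prob p"
  \<comment> \<open>The bound as a function of the mass \<open>u\<close> of the root. The induction
    uses that it is monotone and that it is at least \<open>v\<close> and at least
    \<open>4 / h\<close>.\<close>
  let ?\<psi> = "\<lambda>u. v + 4 / h * (1 + max 0 (ln (u / v)))"
  let ?w = "\<lambda>\<tau> A x. of_bool (fst (D j) \<in> resolved_cell D H \<tau> A x) / real (card (idx_in D H (resolved_cell D H \<tau> A x)))"
  have \<psi>0: "0 \<le> ?\<psi> u" for u using assms(1,2) by (auto intro!: add_nonneg_nonneg mult_nonneg_nonneg)
  have \<psi>1: "v \<le> ?\<psi> u" "4 / h \<le> ?\<psi> u" for u
    using assms(1,2) mult_left_mono[of 1 "1 + max 0 (ln (u / v))" "4 / h"]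
    by (auto intro!: mult_nonneg_nonneg)
  have \<psi>mono: "?\<psi> u \<le> ?\<psi> u'" if "0 \<le> u" "u \<le> u'" for u u'
  proof -
    have "max 0 (ln (u / v)) \<le> max 0 (ln (u' / v))"
    proof (cases "u = 0")
      case False
      then have "ln (u / v) \<le> ln (u' / v)" using that assms(1) by (simp add: divide_right_mono)
      then show ?thesis by linarith
    qed simp
    then show ?thesis using assms(2) by (intro add_left_mono mult_left_mono) auto
  qed
  have cnt: "1 / real (card (idx_in D H A)) \<le> 4 / h / ?\<mu> A" if "\<not> P A" "v \<le> ?\<mu> A" for A
  proof -
    have "h * ?\<mu> A / 4 \<le> real (card (idx_in D H A))" using that by (auto simp: P_def)
    moreover have "0 < h * ?\<mu> A / 4" using that assms(1,2) by simp
    ultimately have "1 / real (card (idx_in D H A)) \<le> 1 / (h * ?\<mu> A / 4)"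
      by (intro divide_left_mono mult_pos_pos) auto
    then show ?thesis by simp
  qed
  \<comment> \<open>Every \<open>x\<close> resolved at \<open>A\<close> itself gives
    \<open>j\<close> a weight of at most one over the number of points in \<open>A\<close>, and that
    number is at least \<open>h / 4\<close> times the mass because \<open>P A\<close> fails.\<close>
  have unsplit: "(\<Sum>x\<in>Y - U. pmf p x * ?w \<tau> A x) \<le> ?\<mu> Y * (4 / h / ?\<mu> A)"
    if "\<not> P A" "v \<le> ?\<mu> A" "finite Y" "\<And>x. x \<in> Y \<Longrightarrow> resolved_cell D H \<tau> A x = A" for \<tau> A Y U
  proof -
    have "?w \<tau> A x \<le> 4 / h / ?\<mu> A" if "x \<in> Y" for x
    proof (cases "fst (D j) \<in> A")
      case True
      then show ?thesis using cnt[OF \<open>\<not> P A\<close> \<open>v \<le> ?\<mu> A\<close>] \<open>\<And>x. x \<in> Y \<Longrightarrow> resolved_cell D H \<tau> A x = A\<close>[OF that] by simp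
    next
      case False
      then show ?thesis using assms(2) \<open>\<And>x. x \<in> Y \<Longrightarrow> resolved_cell D H \<tau> A x = A\<close>[OF that] by simp
    qed
    then have "(\<Sum>x\<in>Y - U. pmf p x * ?w \<tau> A x) \<le> (\<Sum>x\<in>Y - U. pmf p x * (4 / h / ?\<mu> A))"
      by (intro sum_mono mult_left_mono) auto
    also have "\<dots> \<le> (\<Sum>x\<in>Y. pmf p x * (4 / h / ?\<mu> A))"
      using that(3) assms(2) by (intro sum_mono2) auto
    also have "\<dots> = ?\<mu> Y * (4 / h / ?\<mu> A)"
      by (simp only: measure_measure_pmf_finite[OF that(3)] sum_distrib_right)
    finally show ?thesis .
  qed
  have whole: "influence p D H (node_union P \<tau> A) \<tau> A j \<le> ?\<psi> (?\<mu> A)"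
    if fA: "finite A" and cond: "P A \<or> ?\<mu> A < v \<or> (\<forall>x\<in>A. resolved_cell D H \<tau> A x = A)" for \<tau> A
  proof -
    consider "P A" | "?\<mu> A < v" | "\<not> P A" "v \<le> ?\<mu> A" "\<forall>x\<in>A. resolved_cell D H \<tau> A x = A"
      using cond by (meson not_less)
    then show ?thesis
    proof cases
      case 1
      then have "node_union P \<tau> A = A" by (cases \<tau>) auto
      then show ?thesis using \<psi>0 by (simp add: influence_def)
    next
      case 2
      then show ?thesis
        using influence_le_prob[OF fA, of p D H "node_union P \<tau> A" \<tau> j] \<psi>1(1)[of "?\<mu> A"] by linarith
    next
      case 3
      have "influence p D H (node_union P \<tau> A) \<tau> A j \<le> ?\<mu> A * (4 / h / ?\<mu> A)"
        unfolding influence_def by (rule unsplit[OF 3(1,2) fA]) (use 3(3) in blast)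
      also have "\<dots> = 4 / h" using 3 assms(1) by simp
      finally show ?thesis using \<psi>1(2)[of "?\<mu> A"] by linarith
    qed
  qed
  {
    case Leaf
    then show ?case by (intro whole) auto
  next
    case (Node i l r)
    let ?\<tau> = "Node i l r"
    let ?t = "\<lambda>b. if b then r else l"
    let ?S = "\<lambda>b. \<Sum>x\<in>half A i b - node_union P (?t b) (half A i b). pmf p x * ?w ?\<tau> A x"
    show ?case
    proof (cases "P A \<or> ?\<mu> A < v \<or> (\<forall>x\<in>A. resolved_cell D H ?\<tau> A x = A)")
      case True
      then show ?thesis using Node.prems by (intro whole) auto
    next
      case False
      then have big: "\<not> P A" "v \<le> ?\<mu> A" "\<not> card (covariates D H \<inter> A) \<le> 1" by auto
      have fin: "finite (half A i b)" for b using Node.prems(1) half_subset finite_subset by metis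
      have split: "influence p D H (node_union P ?\<tau> A) ?\<tau> A j = ?S False + ?S True"
      proof -
        have "A - node_union P ?\<tau> A = (half A i False - node_union P l (half A i False))
            \<union> (half A i True - node_union P r (half A i True))"
          using big(1) node_union_subset[of P l "half A i False"]
            node_union_subset[of P r "half A i True"] half_Un[of A i] half_disjoint[of A i] by auto
        moreover have "(half A i False - node_union P l (half A i False))
            \<inter> (half A i True - node_union P r (half A i True)) = {}"
          using half_disjoint[of A i] by blast
        ultimately show ?thesis unfolding influence_def
          by (simp only: sum.union_disjoint[OF finite_Diff[OF fin] finite_Diff[OF fin]] if_False if_True)
      qed
      have ne: "?S b = influence p D H (node_union P (?t b) (half A i b)) (?t b) (half A i b) j"
        if "idx_in D H (half A i b) \<noteq> {}" for b
        unfolding influence_def using that big(3)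
        by (intro sum.cong refl arg_cong2[where f="(*)"]) (auto simp: half_def)
      have IH: "influence p D H (node_union P (?t b) (half A i b)) (?t b) (half A i b) j
          \<le> ?\<psi> (?\<mu> (half A i b))" if "idx_in D H (half A i b) \<noteq> {}" for b
        using Node.IH fin that by (cases b) auto
      have em: "?S b \<le> ?\<mu> (half A i b) * (4 / h / ?\<mu> A)" if "idx_in D H (half A i b) = {}" for b
        using that big fin by (intro unsplit) (auto simp: half_def)
      have away: "?S b = 0" if "fst (D j) \<notin> half A i b" "idx_in D H (half A i b) \<noteq> {}" for b
        unfolding ne[OF that(2)] influence_def
      proof (intro sum.neutral ballI)
        fix x
        have "fst (D j) \<notin> resolved_cell D H (?t b) (half A i b) x"
          using that(1) resolved_cell_subset[of D H "?t b" "half A i b" x] by blast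
        then show "pmf p x * ?w (?t b) (half A i b) x = 0" by simp
      qed
      have mono: "?\<mu> (half A i b) \<le> ?\<mu> A" for b
        by (intro measure_pmf.finite_measure_mono half_subset) auto
      \<comment> \<open>If both halves have points, \<open>j\<close> receives weight from one of
        them only. If one half is empty, the \<open>x\<close> in it are resolved at
        \<open>A\<close>, and the recursion continues in the other half alone.\<close>
      consider "idx_in D H (half A i False) \<noteq> {}" "idx_in D H (half A i True) \<noteq> {}"
        | b where "idx_in D H (half A i b) = {}" "idx_in D H (half A i (\<not> b)) \<noteq> {}"
      proof -
        have "idx_in D H (half A i False) \<noteq> {} \<or> idx_in D H (half A i True) \<noteq> {}"
          using Node.prems(2) by (auto simp: idx_in_def half_def)
        then show ?thesis using that(1) that(2)[of False] that(2)[of True] by auto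
      qed
      then show ?thesis
      proof cases
        case 1
        then have 2: "idx_in D H (half A i b) \<noteq> {}" for b by (cases b) auto
        obtain b where "fst (D j) \<notin> half A i (\<not> b)"
          by (metis (mono_tags, lifting) half_def mem_Collect_eq)
        then have "?S False + ?S True = ?S b" using away[OF _ 2, of "\<not> b"] by (cases b) auto
        also have "\<dots> \<le> ?\<psi> (?\<mu> (half A i b))" using ne[OF 2] IH[OF 2] by simp
        also have "\<dots> \<le> ?\<psi> (?\<mu> A)" using mono by (intro \<psi>mono) auto
        finally show ?thesis using split by simp
      next
        case 2
        define u where "u = ?\<mu> A"
        define e where "e = ?\<mu> (half A i b)"
        have ue: "?\<mu> (half A i (\<not> b)) = u - e" unfolding u_def e_def
          using prob_half_add[of p A i] by (cases b) auto
        have u: "v \<le> u" "0 < u" "0 \<le> e" "e \<le> u" using big(2) assms(1) mono by (auto simp: u_def e_def)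
        have "?S False + ?S True = ?S b + ?S (\<not> b)" by (cases b) auto
        also have "\<dots> \<le> e * (4 / h / u) + influence p D H (node_union P (?t (\<not> b)) (half A i (\<not> b))) (?t (\<not> b)) (half A i (\<not> b)) j"
          using em[OF 2(1)] ne[OF 2(2)] unfolding u_def e_def by simp
        also have "\<dots> \<le> ?\<psi> u"
        proof (cases "v \<le> u - e")
          case True
          have "e * (4 / h / u) + ?\<psi> (u - e) \<le> ?\<psi> u"
          proof -
            have l0: "0 \<le> ln ((u - e) / v)" using True assms(1) by simp
            have "e / u + ln ((u - e) / v) \<le> ln (u / v)" using assms(1) True u by (intro ln_ratio_step)
            moreover have "0 \<le> e / u" using u by simp
            ultimately have "e / u + (1 + max 0 (ln ((u - e) / v))) \<le> 1 + max 0 (ln (u / v))"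
              using l0 by linarith
            then have "4 / h * (e / u + (1 + max 0 (ln ((u - e) / v)))) \<le> 4 / h * (1 + max 0 (ln (u / v)))"
              using assms(2) by (intro mult_left_mono) auto
            then show ?thesis by (simp only: distrib_left) (simp add: mult.commute)
          qed
          then show ?thesis using IH[OF 2(2), unfolded ue] by linarith
        next
          \<comment> \<open>Below mass \<open>v\<close> the logarithm no longer telescopes; the
            remaining half is bounded by its own mass instead.\<close>
          case False
          have "e * (4 / h / u) = 4 / h * (e / u)" by simp
          also have "\<dots> \<le> 4 / h * 1" using u assms(2) by (intro mult_left_mono) (auto simp: divide_le_eq)
          finally have "e * (4 / h / u) \<le> 4 / h" by simp
          moreover have "influence p D H (node_union P (?t (\<not> b)) (half A i (\<not> b))) (?t (\<not> b)) (half A i (\<not> b)) j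
              \<le> ?\<mu> (half A i (\<not> b))"
            by (rule influence_le_prob[OF fin])
          then have "influence p D H (node_union P (?t (\<not> b)) (half A i (\<not> b))) (?t (\<not> b)) (half A i (\<not> b)) j \<le> v"
            using ue False by linarith
          moreover have "4 / h + v \<le> ?\<psi> u" using assms(2)
            mult_left_mono[of 1 "1 + max 0 (ln (u / v))" "4 / h"] by auto
          ultimately show ?thesis by linarith
        qed
        finally show ?thesis using split unfolding u_def by simp
      qed
    qed
  }
qed

section \<open>Exponential moments over product measures\<close>

lemma quadratic_form_insert:
  fixes z :: "'i \<Rightarrow> real"
  assumes "finite I" "a \<notin> I" "\<And>k l. W k l = W l k"
  shows "(\<Sum>k\<in>insert a I. \<Sum>l\<in>insert a I. W k l * z k * z l)
    = W a a * (z a)\<^sup>2 + 2 * z a * (\<Sum>l\<in>I. W a l * z l) + (\<Sum>k\<in>I. \<Sum>l\<in>I. W k l * z k * z l)"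
proof -
  have 1: "(\<Sum>k\<in>I. W k a * z k * z a) = z a * (\<Sum>l\<in>I. W a l * z l)"
    unfolding sum_distrib_left by (intro sum.cong refl) (simp add: assms(3)[of _ a])
  have 2: "(\<Sum>l\<in>I. W a l * z a * z l) = z a * (\<Sum>l\<in>I. W a l * z l)"
    unfolding sum_distrib_left by (intro sum.cong refl) simp
  have "(\<Sum>k\<in>insert a I. \<Sum>l\<in>insert a I. W k l * z k * z l)
      = W a a * z a * z a + (\<Sum>l\<in>I. W a l * z a * z l)
        + ((\<Sum>k\<in>I. W k a * z k * z a) + (\<Sum>k\<in>I. \<Sum>l\<in>I. W k l * z k * z l))"
    using assms(1,2) by (simp add: sum.distrib)
  then show ?thesis unfolding 1 2 by (simp add: power2_eq_square)
qed

text \<open>Integrating out one variable \<open>a\<close> replaces the matrix \<open>W\<close> by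
  \<open>W k l + \<kappa> / 2 * W a k * W a l\<close>. The bound \<open>\<rho>\<close> on the row sums is preserved, and the
  loss in the bound on the entries is paid for by the decrease of the row sums. The factors \<open>w i\<close>
  allow for conditioning on part of the \<open>i\<close>-th coordinate.\<close>

lemma nn_integral_exp_quadratic_form:
  fixes M :: "'i \<Rightarrow> 'a measure" and \<phi> w :: "'i \<Rightarrow> 'a \<Rightarrow> real" and W :: "'i \<Rightarrow> 'i \<Rightarrow> real"
  assumes "finite I" "\<And>i. prob_space (M i)"
    and meas: "\<And>i. \<phi> i \<in> borel_measurable (M i)" "\<And>i. w i \<in> borel_measurable (M i)"
    and w: "\<And>i y. 0 \<le> w i y" "\<And>i y. w i y \<noteq> 0 \<Longrightarrow> \<bar>\<phi> i y\<bar> \<le> 1 / 2" "\<And>i. 0 \<le> \<alpha> i"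
    and mgf: "\<And>i t. (\<integral>\<^sup>+y. ennreal (w i y * exp (t * \<phi> i y)) \<partial>M i) \<le> ennreal (\<alpha> i * exp (t\<^sup>2 / 8))"
    and const: "0 \<le> \<kappa>" "\<kappa> * \<rho> \<le> 2 / 3" "0 < \<rho>" "0 \<le> b"
    and W: "\<And>k l. W k l = W l k" "\<And>k l. 0 \<le> W k l"
      "\<And>k. k \<in> I \<Longrightarrow> (\<Sum>l\<in>I. W k l) \<le> \<rho>"
      "\<And>k l. k \<in> I \<Longrightarrow> l \<in> I \<Longrightarrow> W k l \<le> b * (2 - (\<Sum>l\<in>I. W k l) / \<rho>)"
  shows "(\<integral>\<^sup>+x. ennreal ((\<Prod>i\<in>I. w i (x i)) * exp (\<kappa> * (\<Sum>k\<in>I. \<Sum>l\<in>I. W k l * \<phi> k (x k) * \<phi> l (x l)))) \<partial>PiM I M)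
    \<le> ennreal ((\<Prod>i\<in>I. \<alpha> i) * exp (\<kappa> * b / 2 * real (card I)))"
  using assms(1) W
proof (induction I arbitrary: W rule: finite_induct)
  case empty
  show ?case by (simp add: PiM_empty nn_integral_count_space_finite)
next
  case (insert a I)
  note fin = insert.hyps(1) and a = insert.hyps(2) and sym = insert.prems(1) and W0 = insert.prems(2)
    and row = insert.prems(3) and entry = insert.prems(4)
  interpret product_sigma_finite M
    by (simp add: product_sigma_finite_def assms(2) prob_space_imp_sigma_finite)
  note meas[measurable]
  define R where "R k = (\<Sum>l\<in>insert a I. W k l)" for k
  have R: "R k = W k a + (\<Sum>l\<in>I. W k l)" for k using fin a by (simp add: R_def)
  have R0: "0 \<le> R k" for k unfolding R_def by (intro sum_nonneg W0)
  have R\<rho>: "R k \<le> \<rho>" if "k \<in> insert a I" for k using row that by (simp add: R_def)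
  have W2b: "W k l \<le> 2 * b" if "k \<in> insert a I" "l \<in> insert a I" for k l
  proof -
    have "W k l \<le> b * (2 - R k / \<rho>)" using entry[OF that] by (simp add: R_def)
    also have "\<dots> \<le> b * 2" using const R0[of k] by (intro mult_left_mono) auto
    finally show ?thesis by simp
  qed
  \<comment> \<open>The variable \<open>a\<close> enters linearly through
    \<open>2 * \<kappa> * s x * \<phi> a y\<close>. Its moment bound
    \<open>exp (t\<^sup>2 / 8)\<close> at \<open>t = 2 * \<kappa> * s x\<close> adds
    \<open>\<kappa> * (\<kappa> / 2 * (s x)\<^sup>2)\<close> to the exponent, which is the rank-one
    correction made here.\<close>
  define W' where "W' k l = W k l + \<kappa> / 2 * W a k * W a l" for k l
  have R': "(\<Sum>l\<in>I. W' k l) \<le> R k - (1 - \<kappa> * \<rho> / 2) * W k a" if "k \<in> I" for k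
  proof -
    have "(\<Sum>l\<in>I. W' k l) = (R k - W k a) + \<kappa> / 2 * W a k * (R a - W a a)"
      unfolding R W'_def by (simp add: sum.distrib sum_distrib_left)
    also have "\<kappa> / 2 * W a k * (R a - W a a) \<le> \<kappa> / 2 * W a k * \<rho>"
      using R\<rho>[of a] W0[of a a] W0[of a k] const by (intro mult_left_mono mult_nonneg_nonneg) auto
    finally show ?thesis using sym[of a k] by (simp add: algebra_simps)
  qed
  have shrink: "2 / 3 \<le> 1 - \<kappa> * \<rho> / 2" using const by simp
  have IH: "(\<integral>\<^sup>+x. ennreal ((\<Prod>i\<in>I. w i (x i)) * exp (\<kappa> * (\<Sum>k\<in>I. \<Sum>l\<in>I. W' k l * \<phi> k (x k) * \<phi> l (x l)))) \<partial>PiM I M)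
    \<le> ennreal ((\<Prod>i\<in>I. \<alpha> i) * exp (\<kappa> * b / 2 * real (card I)))"
  proof (rule insert.IH)
    show "W' k l = W' l k" for k l using sym[of k l] by (simp add: W'_def)
    show "0 \<le> W' k l" for k l using W0 const by (auto simp: W'_def intro!: add_nonneg_nonneg mult_nonneg_nonneg)
    show "(\<Sum>l\<in>I. W' k l) \<le> \<rho>" if "k \<in> I" for k
    proof -
      have "0 \<le> (1 - \<kappa> * \<rho> / 2) * W k a" using shrink W0 by (intro mult_nonneg_nonneg) auto
      then show ?thesis using R'[OF that] R\<rho>[of k] that by auto
    qed
    show "W' k l \<le> b * (2 - (\<Sum>l\<in>I. W' k l) / \<rho>)" if kl: "k \<in> I" "l \<in> I" for k l
    proof -
      have "W k l \<le> b * (2 - R k / \<rho>)" using entry[of k l] kl by (simp add: R_def)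
      moreover have "\<kappa> / 2 * W a k * W a l \<le> \<kappa> / 2 * W a k * (2 * b)"
        using W2b[of a l] kl W0 const by (intro mult_left_mono) auto
      moreover have "\<kappa> * W a k * b \<le> b * ((1 - \<kappa> * \<rho> / 2) * W k a / \<rho>)"
      proof -
        \<comment> \<open>Equivalent to \<open>\<kappa> * \<rho> \<le> 2 / 3\<close>. The entry may
          grow by \<open>\<kappa> * W a k * b\<close>, and the drop of the row sum by
          \<open>(1 - \<kappa> * \<rho> / 2) * W k a\<close> has to make room for it.\<close>
        have "\<kappa> * \<rho> \<le> 1 - \<kappa> * \<rho> / 2" using const by simp
        then have "\<kappa> \<le> (1 - \<kappa> * \<rho> / 2) / \<rho>" using const by (simp add: pos_le_divide_eq)
        then have "\<kappa> * (W k a * b) \<le> (1 - \<kappa> * \<rho> / 2) / \<rho> * (W k a * b)"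
          using W0 const by (intro mult_right_mono mult_nonneg_nonneg) auto
        then show ?thesis using sym[of a k] by (simp add: algebra_simps)
      qed
      ultimately have "W' k l \<le> b * (2 - R k / \<rho>) + b * ((1 - \<kappa> * \<rho> / 2) * W k a / \<rho>)"
        unfolding W'_def by (simp add: algebra_simps)
      also have "\<dots> = b * (2 - (R k - (1 - \<kappa> * \<rho> / 2) * W k a) / \<rho>)"
        using const by (simp add: field_simps)
      also have "\<dots> \<le> b * (2 - (\<Sum>l\<in>I. W' k l) / \<rho>)"
        using R'[OF kl(1)] const by (intro mult_left_mono diff_left_mono divide_right_mono) auto
      finally show ?thesis .
    qed
  qed
  define Q where "Q x = (\<Sum>k\<in>I. \<Sum>l\<in>I. W k l * \<phi> k (x k) * \<phi> l (x l))" for x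
  define s where "s x = (\<Sum>l\<in>I. W a l * \<phi> l (x l))" for x
  define P where "P x = (\<Prod>i\<in>I. w i (x i))" for x
  have P0: "0 \<le> P x" for x unfolding P_def using w by (intro prod_nonneg) auto
  let ?f = "\<lambda>x. ennreal ((\<Prod>i\<in>insert a I. w i (x i)) *
      exp (\<kappa> * (\<Sum>k\<in>insert a I. \<Sum>l\<in>insert a I. W k l * \<phi> k (x k) * \<phi> l (x l))))"
  have upd: "(\<Prod>i\<in>I. w i ((x(a := y)) i)) = P x" "Q (x(a := y)) = Q x" "s (x(a := y)) = s x" for x y
  proof -
    have eq: "(x(a := y)) i = x i" if "i \<in> I" for i using that a by auto
    show "(\<Prod>i\<in>I. w i ((x(a := y)) i)) = P x" unfolding P_def by (intro prod.cong refl) (simp only: eq)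
    show "Q (x(a := y)) = Q x" unfolding Q_def by (intro sum.cong refl) (simp only: eq)
    show "s (x(a := y)) = s x" unfolding s_def by (intro sum.cong refl) (simp only: eq)
  qed
  have f: "?f (x(a := y)) = ennreal (w a y * P x *
      exp (\<kappa> * (W a a * (\<phi> a y)\<^sup>2 + 2 * \<phi> a y * s x + Q x)))" for x y
  proof -
    have "(\<Prod>i\<in>insert a I. w i ((x(a := y)) i)) = w a y * P x"
      unfolding prod.insert[OF fin a] upd(1) by simp
    moreover have "(\<Sum>k\<in>insert a I. \<Sum>l\<in>insert a I. W k l * \<phi> k ((x(a := y)) k) * \<phi> l ((x(a := y)) l))
        = W a a * (\<phi> a y)\<^sup>2 + 2 * \<phi> a y * s x + Q x"
      using quadratic_form_insert[OF fin a sym, where z = "\<lambda>k. \<phi> k ((x(a := y)) k)"] upd(2,3)[of x y]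
      unfolding Q_def s_def by simp
    ultimately show ?thesis by simp
  qed
  have inner: "(\<integral>\<^sup>+y. ?f (x(a := y)) \<partial>M a) \<le> ennreal (P x * exp (\<kappa> * (Q x + \<kappa> / 2 * (s x)\<^sup>2))) *
      ennreal (\<alpha> a * exp (\<kappa> * b / 2))" for x
  proof -
    have "?f (x(a := y)) \<le> ennreal (P x * exp (\<kappa> * b / 2) * exp (\<kappa> * Q x)) * ennreal (w a y * exp (2 * \<kappa> * s x * \<phi> a y))" for y
    proof (cases "w a y = 0")
      case False
      have "(\<phi> a y)\<^sup>2 \<le> (1 / 2)\<^sup>2" using w(2)[OF False] by (simp add: abs_le_square_iff[symmetric])
      \<comment> \<open>The diagonal term is bounded, not integrated: entry at most
        \<open>2 * b\<close>, square at most \<open>1 / 4\<close>. This is the factor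
        \<open>exp (\<kappa> * b / 2)\<close> paid for each variable.\<close>
      then have "W a a * (\<phi> a y)\<^sup>2 \<le> (2 * b) * (1 / 2)\<^sup>2" using W2b[of a a] W0 const by (intro mult_mono) auto
      then have "\<kappa> * (W a a * (\<phi> a y)\<^sup>2) \<le> \<kappa> * (b / 2)"
        using const by (intro mult_left_mono) (auto simp: power2_eq_square)
      then have "exp (\<kappa> * (W a a * (\<phi> a y)\<^sup>2 + 2 * \<phi> a y * s x + Q x))
          \<le> exp (\<kappa> * b / 2 + \<kappa> * Q x + 2 * \<kappa> * s x * \<phi> a y)"
        by (simp add: algebra_simps)
      then have "w a y * P x * exp (\<kappa> * (W a a * (\<phi> a y)\<^sup>2 + 2 * \<phi> a y * s x + Q x))
         \<le> w a y * P x * exp (\<kappa> * b / 2 + \<kappa> * Q x + 2 * \<kappa> * s x * \<phi> a y)"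
        using w(1) P0 by (intro mult_left_mono) auto
      then show ?thesis unfolding f using P0 w(1)
        by (simp add: ennreal_mult[symmetric] exp_add algebra_simps)
    next
      case True
      then show ?thesis unfolding f by simp
    qed
    then have "(\<integral>\<^sup>+y. ?f (x(a := y)) \<partial>M a) \<le> (\<integral>\<^sup>+y. ennreal (P x * exp (\<kappa> * b / 2) * exp (\<kappa> * Q x)) * ennreal (w a y * exp (2 * \<kappa> * s x * \<phi> a y)) \<partial>M a)"
      by (intro nn_integral_mono)
    also have "\<dots> = ennreal (P x * exp (\<kappa> * b / 2) * exp (\<kappa> * Q x)) * (\<integral>\<^sup>+y. ennreal (w a y * exp (2 * \<kappa> * s x * \<phi> a y)) \<partial>M a)"
      by (intro nn_integral_cmult) measurable
    also have "\<dots> \<le> ennreal (P x * exp (\<kappa> * b / 2) * exp (\<kappa> * Q x)) * ennreal (\<alpha> a * exp ((2 * \<kappa> * s x)\<^sup>2 / 8))"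
      by (intro mult_left_mono mgf) auto
    also have "\<dots> = ennreal (P x * exp (\<kappa> * (Q x + \<kappa> / 2 * (s x)\<^sup>2))) * ennreal (\<alpha> a * exp (\<kappa> * b / 2))"
    proof -
      have "exp (\<kappa> * (Q x + \<kappa> / 2 * (s x)\<^sup>2)) = exp (\<kappa> * Q x) * exp ((2 * \<kappa> * s x)\<^sup>2 / 8)"
        by (simp add: exp_add[symmetric] power2_eq_square algebra_simps)
      then show ?thesis using P0 w(3) by (simp add: ennreal_mult[symmetric] mult_ac)
    qed
    finally show ?thesis .
  qed
  have Q': "Q x + \<kappa> / 2 * (s x)\<^sup>2 = (\<Sum>k\<in>I. \<Sum>l\<in>I. W' k l * \<phi> k (x k) * \<phi> l (x l))" for x
  proof -
    have s: "\<kappa> / 2 * (s x)\<^sup>2 = (\<Sum>k\<in>I. \<Sum>l\<in>I. \<kappa> / 2 * W a k * W a l * \<phi> k (x k) * \<phi> l (x l))"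
      unfolding s_def power2_eq_square
      by (subst sum_product, unfold sum_distrib_left) (intro sum.cong refl, simp)
    show ?thesis
      unfolding Q_def s sum.distrib[symmetric] by (intro sum.cong refl) (simp add: W'_def algebra_simps)
  qed
  have [measurable]: "?f \<in> borel_measurable (PiM (insert a I) M)"
    using fin by measurable
  have "(\<integral>\<^sup>+x. ?f x \<partial>PiM (insert a I) M) = (\<integral>\<^sup>+x. (\<integral>\<^sup>+y. ?f (x(a := y)) \<partial>M a) \<partial>PiM I M)"
    by (intro product_nn_integral_insert fin a) measurable
  also have "\<dots> \<le> (\<integral>\<^sup>+x. ennreal (P x * exp (\<kappa> * (Q x + \<kappa> / 2 * (s x)\<^sup>2))) *
      ennreal (\<alpha> a * exp (\<kappa> * b / 2)) \<partial>PiM I M)"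
    by (intro nn_integral_mono inner)
  also have "\<dots> = (\<integral>\<^sup>+x. ennreal (P x * exp (\<kappa> * (Q x + \<kappa> / 2 * (s x)\<^sup>2))) \<partial>PiM I M) * ennreal (\<alpha> a * exp (\<kappa> * b / 2))"
    unfolding P_def Q' by (intro nn_integral_multc) measurable
  also have "\<dots> \<le> ennreal ((\<Prod>i\<in>I. \<alpha> i) * exp (\<kappa> * b / 2 * real (card I))) * ennreal (\<alpha> a * exp (\<kappa> * b / 2))"
    unfolding P_def Q' by (intro mult_right_mono IH) auto
  also have "\<dots> = ennreal ((\<Prod>i\<in>insert a I. \<alpha> i) * exp (\<kappa> * b / 2 * real (card (insert a I))))"
    using fin a w(3) by (simp add: ennreal_mult[symmetric] prod_nonneg exp_add[symmetric] algebra_simps)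
  finally show ?case .
qed

text \<open>The product is regrouped by indices. An index lies in at most one block, and an index
  outside all blocks contributes the factor 1, so the integral factorizes over the
  coordinates.\<close>

lemma nn_integral_PiM_blocks:
  fixes f :: "nat \<Rightarrow> 'a \<Rightarrow> ennreal"
  assumes "prob_space M" "finite I" "disjoint_family_on H {..<N}" "\<And>b. b < N \<Longrightarrow> H b \<subseteq> I"
    and meas: "\<And>b. b < N \<Longrightarrow> f b \<in> borel_measurable M"
  shows "(\<integral>\<^sup>+D. (\<Prod>b<N. \<Prod>j\<in>H b. f b (D j)) \<partial>PiM I (\<lambda>_. M)) = (\<Prod>b<N. (\<integral>\<^sup>+z. f b z \<partial>M) ^ card (H b))"
proof -
  interpret M: prob_space M by fact
  interpret product_sigma_finite "\<lambda>_. M" by standard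
  define g where "g c j = (\<Prod>b<N. if j \<in> H b then c b else 1)" for c :: "nat \<Rightarrow> ennreal" and j
  have swap: "(\<Prod>b<N. \<Prod>j\<in>H b. c b j) = (\<Prod>j\<in>I. g (\<lambda>b. c b j) j)" for c
  proof -
    have "(\<Prod>j\<in>H b. c b j) = (\<Prod>j\<in>I. if j \<in> H b then c b j else 1)" if "b < N" for b
      using assms(4)[OF that] assms(2) by (simp add: prod.If_cases Int_absorb1)
    then have "(\<Prod>b<N. \<Prod>j\<in>H b. c b j) = (\<Prod>b<N. \<Prod>j\<in>I. if j \<in> H b then c b j else 1)" by simp
    also have "\<dots> = (\<Prod>j\<in>I. g (\<lambda>b. c b j) j)" unfolding g_def by (rule prod.swap)
    finally show ?thesis .
  qed
  have g: "(\<integral>\<^sup>+z. g (\<lambda>b. f b z) j \<partial>M) = g (\<lambda>b. \<integral>\<^sup>+z. f b z \<partial>M) j" for j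
  proof (cases "\<exists>b<N. j \<in> H b")
    case True
    then obtain b where b: "b < N" "j \<in> H b" by auto
    have "g c j = c b" for c
    proof -
      have "g c j = (\<Prod>b'\<in>{b}. if j \<in> H b' then c b' else 1)" unfolding g_def
      proof (rule prod.mono_neutral_right)
        show "\<forall>b'\<in>{..<N} - {b}. (if j \<in> H b' then c b' else 1) = 1"
          using assms(3) b unfolding disjoint_family_on_def by (auto simp: disjoint_iff)
      qed (use b in auto)
      then show ?thesis using b by simp
    qed
    then show ?thesis by simp
  next
    case False
    then have "g c j = 1" for c unfolding g_def by (intro prod.neutral) auto
    then show ?thesis by (simp add: M.emeasure_space_1)
  qed
  have "(\<integral>\<^sup>+D. (\<Prod>b<N. \<Prod>j\<in>H b. f b (D j)) \<partial>PiM I (\<lambda>_. M)) = (\<integral>\<^sup>+D. (\<Prod>j\<in>I. g (\<lambda>b. f b (D j)) j) \<partial>PiM I (\<lambda>_. M))"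
    unfolding swap ..
  also have "\<dots> = (\<Prod>j\<in>I. \<integral>\<^sup>+z. g (\<lambda>b. f b z) j \<partial>M)"
    using product_nn_integral_prod[of I "\<lambda>j z. g (\<lambda>b. f b z) j"] assms(2) meas
    unfolding g_def by (auto intro!: borel_measurable_prod_ennreal measurable_If)
  also have "\<dots> = (\<Prod>b<N. \<Prod>j\<in>H b. \<integral>\<^sup>+z. f b z \<partial>M)"
    unfolding g swap ..
  finally show ?thesis by simp
qed

section \<open>The regression model: one observation and its noise\<close>

locale regression =
  fixes d :: nat and Dx :: "point pmf" and E :: "real measure" and m :: "point \<Rightarrow> real"
  assumes model: "regression_model d Dx E m"
begin

sublocale E: prob_space E
  using model by (simp add: regression_model_def)

abbreviation "Z \<equiv> data_dist Dx E m"

abbreviation "\<mu> \<equiv> measure_pmf.prob Dx"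

lemma sets_E [measurable_cong]: "sets E = sets borel"
  using model by (simp add: regression_model_def)

lemma sets_Z [measurable_cong]: "sets Z = sets (count_space UNIV \<Otimes>\<^sub>M borel)"
  by (simp add: data_dist_def)

lemma data_map_measurable [measurable]:
  "(\<lambda>(x, e). (x, m x + e)) \<in> measure_pmf Dx \<Otimes>\<^sub>M E \<rightarrow>\<^sub>M count_space UNIV \<Otimes>\<^sub>M borel"
  by measurable

sublocale Z: prob_space Z
proof -
  interpret P: pair_prob_space "measure_pmf Dx" E ..
  show "prob_space Z" unfolding data_dist_def by (rule P.prob_space_distr) measurable
qed

lemma nn_integral_Z:
  assumes "f \<in> borel_measurable (count_space UNIV \<Otimes>\<^sub>M borel)"
  shows "(\<integral>\<^sup>+z. f z \<partial>Z) = (\<integral>\<^sup>+x. (\<integral>\<^sup>+e. f (x, m x + e) \<partial>E) \<partial>measure_pmf Dx)"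
proof -
  note assms[measurable]
  have "(\<integral>\<^sup>+z. f z \<partial>Z) = (\<integral>\<^sup>+xe. f (fst xe, m (fst xe) + snd xe) \<partial>(measure_pmf Dx \<Otimes>\<^sub>M E))"
    unfolding data_dist_def by (subst nn_integral_distr) (auto simp: split_beta)
  also have "\<dots> = (\<integral>\<^sup>+x. (\<integral>\<^sup>+e. f (x, m x + e) \<partial>E) \<partial>measure_pmf Dx)"
    by (subst E.nn_integral_fst[symmetric]) (auto simp: measurable_cong_sets[OF sets_pair_measure_cong[OF _ sets_E]])
  finally show ?thesis .
qed

lemma nn_integral_Z_fst: "(\<integral>\<^sup>+z. f (fst z) \<partial>Z) = (\<integral>\<^sup>+x. f x \<partial>measure_pmf Dx)"
  by (subst nn_integral_Z) (auto simp: E.emeasure_space_1)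

lemma set_pmf_Dx: "set_pmf Dx = cube d"
  using model by (simp add: regression_model_def)

lemma m_bound: "x \<in> cube d \<Longrightarrow> \<bar>m x\<bar> \<le> 1 / 2"
  using model by (force simp: regression_model_def)

text \<open>Hoeffding's lemma on an interval of length 1. It is applied with a positive parameter,
  so for \<open>t < 0\<close> it is used for the variable \<open>- e\<close>.\<close>

lemma mgf_noise: "(\<integral>\<^sup>+e. ennreal (exp (t * e)) \<partial>E) \<le> ennreal (exp (t\<^sup>2 / 8))"
proof -
  have E: "AE e in E. e \<in> {-1/2..1/2}" "(\<integral>e. e \<partial>E) = 0"
    using model by (auto simp: regression_model_def)
  consider "t > 0" | "t = 0" | "t < 0" by linarith
  then show ?thesis
  proof cases
    case 1
    interpret interval_bounded_random_variable E "\<lambda>e. e" "-1/2" "1/2"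
      by unfold_locales (use E in auto)
    show ?thesis using Hoeffdings_lemma_nn_integral_0[OF 1] E by simp
  next
    case 2
    then show ?thesis by (simp add: E.emeasure_space_1)
  next
    case 3
    interpret interval_bounded_random_variable E "\<lambda>e. - e" "-1/2" "1/2"
    proof unfold_locales
      show "AE x in E. - x \<in> {-1/2..1/2}" using E(1) by eventually_elim auto
    qed simp
    show ?thesis using Hoeffdings_lemma_nn_integral_0[of "- t"] 3 E by simp
  qed
qed

lemma AE_Z: "AE z in Z. fst z \<in> cube d \<and> \<bar>snd z - m (fst z)\<bar> \<le> 1 / 2"
proof -
  have "AE e in E. e \<in> {-1/2..1/2}" using model by (simp add: regression_model_def)
  then have "AE e in E. \<bar>e\<bar> \<le> 1 / 2" by eventually_elim auto
  then have "emeasure E {e \<in> space E. \<not> \<bar>e\<bar> \<le> 1 / 2} = 0" by (subst (asm) AE_iff_measurable[OF _ refl]) auto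
  then have *: "(\<integral>\<^sup>+e. indicator {e. \<not> \<bar>e\<bar> \<le> 1 / 2} e \<partial>E) = 0"
    using sets_eq_imp_space_eq[OF sets_E] by simp
  let ?f = "\<lambda>z. indicator {z. \<not> (fst z \<in> cube d \<and> \<bar>snd z - m (fst z)\<bar> \<le> 1 / 2)} z :: ennreal"
  have [measurable]: "Measurable.pred (count_space UNIV \<Otimes>\<^sub>M borel) (\<lambda>z :: point \<times> real. fst z \<in> cube d \<and> \<bar>snd z - m (fst z)\<bar> \<le> 1 / 2)"
    by measurable
  have "(\<integral>\<^sup>+z. ?f z \<partial>Z) = (\<integral>\<^sup>+x. (\<integral>\<^sup>+e. ?f (x, m x + e) \<partial>E) \<partial>measure_pmf Dx)"
    by (intro nn_integral_Z) measurable
  also have "\<dots> = (\<integral>\<^sup>+x. 0 \<partial>measure_pmf Dx)"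
    using * set_pmf_Dx by (intro nn_integral_cong_AE) (auto simp: AE_measure_pmf_iff indicator_def)
  finally have "(\<integral>\<^sup>+z. ?f z \<partial>Z) = 0" by simp
  moreover have "?f \<in> borel_measurable Z" by measurable
  ultimately have "AE z in Z. ?f z = 0" by (simp only: nn_integral_0_iff_AE)
  then show ?thesis by eventually_elim (auto simp: indicator_def split: if_splits)
qed

end

lemma borel_measurable_prod_components:
  fixes f :: "'i \<Rightarrow> 'a \<Rightarrow> ennreal"
  assumes "H \<subseteq> I" "\<And>j. f j \<in> borel_measurable M"
  shows "(\<lambda>D. \<Prod>j\<in>H. f j (D j)) \<in> borel_measurable (PiM I (\<lambda>_. M))"
  using assms by (intro borel_measurable_prod_ennreal measurable_compose[OF measurable_component_singleton]) auto

text \<open>A bound on outer measure. Events about trees and cell means are covered by measurable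
  sets, so their own measurability does not have to be shown.\<close>

definition outer_le :: "'a measure \<Rightarrow> 'a set \<Rightarrow> real \<Rightarrow> bool" where
  "outer_le M A c \<longleftrightarrow> (\<exists>S\<in>sets M. A \<inter> space M \<subseteq> S \<and> emeasure M S \<le> ennreal c)"

lemma outer_leI_nn_integral:
  assumes "f \<in> borel_measurable M" "(\<integral>\<^sup>+x. f x \<partial>M) \<le> ennreal c"
    and "\<And>x. x \<in> A \<Longrightarrow> x \<in> space M \<Longrightarrow> 1 \<le> f x"
  shows "outer_le M A c"
proof -
  let ?S = "{x \<in> space M. 1 \<le> f x}"
  note assms(1)[measurable]
  have "?S \<in> sets M" by measurable
  moreover have "emeasure M ?S \<le> ennreal c"
  proof -
    have "emeasure M {x \<in> space M. 1 \<le> 1 * f x} \<le> 1 * (\<integral>\<^sup>+x. f x * indicator (space M) x \<partial>M)"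
      by (rule nn_integral_Markov_inequality) measurable
    also have "(\<integral>\<^sup>+x. f x * indicator (space M) x \<partial>M) = (\<integral>\<^sup>+x. f x \<partial>M)"
      by (intro nn_integral_cong) simp
    finally have "emeasure M ?S \<le> (\<integral>\<^sup>+x. f x \<partial>M)" by simp
    then show ?thesis using assms(2) by (rule order_trans)
  qed
  ultimately show ?thesis unfolding outer_le_def using assms(3) by (intro bexI[of _ ?S]) auto
qed

lemma outer_le_UN:
  assumes "finite I" "\<And>i. i \<in> I \<Longrightarrow> outer_le M (A i) (c i)" "\<And>i. i \<in> I \<Longrightarrow> 0 \<le> c i"
  shows "outer_le M (\<Union>i\<in>I. A i) (\<Sum>i\<in>I. c i)"
proof -
  have "\<forall>i\<in>I. \<exists>S. S \<in> sets M \<and> A i \<inter> space M \<subseteq> S \<and> emeasure M S \<le> ennreal (c i)"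
    using assms(2) by (auto simp: outer_le_def)
  from bchoice[OF this] obtain S where
    S: "\<And>i. i \<in> I \<Longrightarrow> S i \<in> sets M" "\<And>i. i \<in> I \<Longrightarrow> A i \<inter> space M \<subseteq> S i"
       "\<And>i. i \<in> I \<Longrightarrow> emeasure M (S i) \<le> ennreal (c i)" by blast
  have "emeasure M (\<Union>i\<in>I. S i) \<le> (\<Sum>i\<in>I. emeasure M (S i))"
    using assms(1) S by (intro emeasure_subadditive_finite) auto
  also have "\<dots> \<le> (\<Sum>i\<in>I. ennreal (c i))" using S by (intro sum_mono) auto
  also have "\<dots> = ennreal (\<Sum>i\<in>I. c i)" using assms(3) by (simp add: sum_ennreal)
  finally have "emeasure M (\<Union>i\<in>I. S i) \<le> ennreal (\<Sum>i\<in>I. c i)" .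
  moreover have "(\<Union>i\<in>I. S i) \<in> sets M" using S(1) assms(1) by (intro sets.finite_UN) auto
  moreover have "(\<Union>i\<in>I. A i) \<inter> space M \<subseteq> (\<Union>i\<in>I. S i)" using S(2) by fast
  ultimately show ?thesis unfolding outer_le_def by (intro bexI conjI)
qed

lemma outer_le_Un:
  assumes "outer_le M A a" "outer_le M B b" "0 \<le> a" "0 \<le> b"
  shows "outer_le M (A \<union> B) (a + b)"
proof -
  obtain S T where ST: "S \<in> sets M" "A \<inter> space M \<subseteq> S" "emeasure M S \<le> ennreal a"
    "T \<in> sets M" "B \<inter> space M \<subseteq> T" "emeasure M T \<le> ennreal b"
    using assms(1,2) unfolding outer_le_def by (elim bexE conjE)
  have "emeasure M (S \<union> T) \<le> ennreal a + ennreal b"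
    using emeasure_subadditive[OF ST(1,4)] add_mono[OF ST(3,6)] by (rule order_trans)
  then show ?thesis unfolding outer_le_def
    using ST assms(3,4) by (intro bexI[of _ "S \<union> T"] conjI) (auto simp del: ennreal_plus simp: ennreal_plus[symmetric])
qed

lemma outer_le_mono:
  assumes "outer_le M B b" "A \<inter> space M \<subseteq> B" "b \<le> b'"
  shows "outer_le M A b'"
proof -
  obtain S where S: "S \<in> sets M" "B \<inter> space M \<subseteq> S" "emeasure M S \<le> ennreal b"
    using assms(1) unfolding outer_le_def by (elim bexE conjE)
  have "A \<inter> space M \<subseteq> S" using S(2) assms(2) by fast
  moreover have "emeasure M S \<le> ennreal b'" using S(3) ennreal_leI[OF assms(3)] by (rule order_trans)
  ultimately show ?thesis unfolding outer_le_def using S(1) by (intro bexI conjI)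
qed

section \<open>Tail bounds for the noise form, for unhit cells and for undersampled cells\<close>

context regression
begin

definition noise :: "point \<times> real \<Rightarrow> real" where
  "noise z = snd z - m (fst z)"

definition regular :: "nat set \<Rightarrow> dataset \<Rightarrow> bool" where
  "regular I D \<longleftrightarrow> (\<forall>j\<in>I. fst (D j) \<in> cube d \<and> \<bar>noise (D j)\<bar> \<le> 1 / 2)"

text \<open>Conditioning on the covariates, written as a finite sum over all covariate vectors
  \<open>X\<close>: the factors \<open>w\<close> select \<open>X\<close>, the matrix is then
  constant, and only the noise remains random. The products of the \<open>pmf Dx (X i)\<close> add
  up to 1 at the end.\<close>

lemma outer_le_quadratic_form:
  assumes I: "finite I"
    and cong: "\<And>D D'. (\<And>j. j \<in> I \<Longrightarrow> fst (D j) = fst (D' j)) \<Longrightarrow> W D = W D'"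
    and sym: "\<And>D k l. W D k l = W D l k" and W0: "\<And>D k l. 0 \<le> W D k l"
    and row: "\<And>D k. k \<in> I \<Longrightarrow> (\<Sum>l\<in>I. W D k l) \<le> \<rho>" and b: "\<And>D k l. W D k l \<le> b"
    and const: "0 \<le> \<kappa>" "\<kappa> * \<rho> \<le> 2 / 3" "0 < \<rho>"
  shows "outer_le (PiM I (\<lambda>_. Z))
    {D. regular I D \<and> u < (\<Sum>k\<in>I. \<Sum>l\<in>I. W D k l * noise (D k) * noise (D l))}
    (exp (\<kappa> * b / 2 * real (card I) - \<kappa> * u))"
proof -
  let ?M = "PiM I (\<lambda>_. Z)"
  let ?X = "PiE I (\<lambda>_. cube d)"
  define w where "w x z = (of_bool (fst z = x \<and> \<bar>snd z - m x\<bar> \<le> 1 / 2) :: real)" for x :: point and z :: "point \<times> real"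
  define \<phi> where "\<phi> x z = snd z - m x" for x and z :: "point \<times> real"
  have [measurable]: "\<phi> x \<in> borel_measurable Z" "w x \<in> borel_measurable Z" for x
    unfolding \<phi>_def w_def by measurable
  have finX: "finite ?X" using I finite_cube by (intro finite_PiE) auto
  have b0: "0 \<le> b" using W0 b by (meson order_trans)
  have mgf: "(\<integral>\<^sup>+z. ennreal (w x z * exp (t * \<phi> x z)) \<partial>Z) \<le> ennreal (pmf Dx x * exp (t\<^sup>2 / 8))" for x t
  proof -
    have "(\<integral>\<^sup>+z. ennreal (w x z * exp (t * \<phi> x z)) \<partial>Z)
      = (\<integral>\<^sup>+x'. (\<integral>\<^sup>+e. ennreal (w x (x', m x' + e) * exp (t * \<phi> x (x', m x' + e))) \<partial>E) \<partial>measure_pmf Dx)"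
      unfolding w_def \<phi>_def by (intro nn_integral_Z) measurable
    also have "\<dots> \<le> (\<integral>\<^sup>+x'. ennreal (exp (t\<^sup>2 / 8)) * indicator {x} x' \<partial>measure_pmf Dx)"
    proof (intro nn_integral_mono)
      fix x'
      have "(\<integral>\<^sup>+e. ennreal (w x (x', m x' + e) * exp (t * \<phi> x (x', m x' + e))) \<partial>E)
          \<le> (\<integral>\<^sup>+e. ennreal (exp (t * e)) * indicator {x} x' \<partial>E)"
        by (intro nn_integral_mono) (auto simp: w_def \<phi>_def indicator_def)
      also have "\<dots> = (\<integral>\<^sup>+e. ennreal (exp (t * e)) \<partial>E) * indicator {x} x'"
        by (intro nn_integral_multc) (simp add: measurable_cong_sets[OF sets_E refl])
      also have "\<dots> \<le> ennreal (exp (t\<^sup>2 / 8)) * indicator {x} x'"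
        by (intro mult_right_mono mgf_noise) auto
      finally show "(\<integral>\<^sup>+e. ennreal (w x (x', m x' + e) * exp (t * \<phi> x (x', m x' + e))) \<partial>E) \<le> \<dots>" .
    qed
    also have "\<dots> = ennreal (exp (t\<^sup>2 / 8)) * ennreal (pmf Dx x)"
      by (subst nn_integral_cmult_indicator) (simp_all add: emeasure_pmf_single)
    finally show ?thesis by (simp add: ennreal_mult[symmetric] mult.commute)
  qed
  \<comment> \<open>The response 0 is a placeholder; by \<open>cong\<close> the matrix sees only the
    covariates.\<close>
  let ?W = "\<lambda>X. W (\<lambda>j. (X j, 0))"
  let ?g = "\<lambda>X D. ennreal ((\<Prod>i\<in>I. w (X i) (D i)) *
      exp (\<kappa> * (\<Sum>k\<in>I. \<Sum>l\<in>I. ?W X k l * \<phi> (X k) (D k) * \<phi> (X l) (D l))))"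
  have g: "(\<integral>\<^sup>+D. ?g X D \<partial>?M) \<le> ennreal ((\<Prod>i\<in>I. pmf Dx (X i)) * exp (\<kappa> * b / 2 * real (card I)))" for X
  proof (rule nn_integral_exp_quadratic_form[where \<rho> = \<rho>])
    show "?W X k l \<le> b * (2 - (\<Sum>l\<in>I. ?W X k l) / \<rho>)" if "k \<in> I" "l \<in> I" for k l
    proof -
      have "(\<Sum>l\<in>I. ?W X k l) / \<rho> \<le> 1" using row[OF that(1)] const by simp
      then have "b * 1 \<le> b * (2 - (\<Sum>l\<in>I. ?W X k l) / \<rho>)" using b0 by (intro mult_left_mono) linarith+
      then show ?thesis using b[of "\<lambda>j. (X j, 0)" k l] by linarith
    qed
    show "\<bar>\<phi> (X i) y\<bar> \<le> 1 / 2" if "w (X i) y \<noteq> 0" for i y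
      using that by (auto simp: w_def \<phi>_def)
    show "?W X k l = ?W X l k" for k l by (rule sym)
    show "(\<Sum>l\<in>I. ?W X k l) \<le> \<rho>" if "k \<in> I" for k using that by (rule row)
    show "0 \<le> w (X i) y" for i y by (simp add: w_def)
    show "\<kappa> * \<rho> \<le> 2 / 3" by (rule const(2))
  qed (simp_all add: I Z.prob_space_axioms mgf const(1,3) b0 W0)
  have [measurable]: "?g X \<in> borel_measurable ?M" for X using I by measurable
  show ?thesis
  proof (rule outer_leI_nn_integral[where f = "\<lambda>D. ennreal (exp (- (\<kappa> * u))) * (\<Sum>X\<in>?X. ?g X D)"])
    have "(\<integral>\<^sup>+D. ennreal (exp (- (\<kappa> * u))) * (\<Sum>X\<in>?X. ?g X D) \<partial>?M)
        = ennreal (exp (- (\<kappa> * u))) * (\<Sum>X\<in>?X. (\<integral>\<^sup>+D. ?g X D \<partial>?M))"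
      by (subst nn_integral_cmult, measurable) (simp add: nn_integral_sum)
    also have "\<dots> \<le> ennreal (exp (- (\<kappa> * u))) * (\<Sum>X\<in>?X. ennreal ((\<Prod>i\<in>I. pmf Dx (X i)) * exp (\<kappa> * b / 2 * real (card I))))"
      by (intro mult_left_mono sum_mono g) auto
    also have "\<dots> = ennreal (exp (- (\<kappa> * u)) * ((\<Sum>X\<in>?X. \<Prod>i\<in>I. pmf Dx (X i)) * exp (\<kappa> * b / 2 * real (card I))))"
      by (simp add: sum_ennreal prod_nonneg sum_distrib_right ennreal_mult[symmetric] sum_nonneg)
    also have "(\<Sum>X\<in>?X. \<Prod>i\<in>I. pmf Dx (X i)) = (\<Prod>i\<in>I. \<Sum>x\<in>cube d. pmf Dx x)"
      by (rule prod_sum_PiE[symmetric]) (use I finite_cube in auto)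
    also have "(\<Sum>x\<in>cube d. pmf Dx x) = 1"
      using finite_cube set_pmf_Dx by (intro sum_pmf_eq_1) auto
    also have "exp (- (\<kappa> * u)) * ((\<Prod>i\<in>I. 1) * exp (\<kappa> * b / 2 * real (card I)))
        = exp (\<kappa> * b / 2 * real (card I) - \<kappa> * u)"
      by (simp add: exp_add[symmetric])
    finally show "(\<integral>\<^sup>+D. ennreal (exp (- (\<kappa> * u))) * (\<Sum>X\<in>?X. ?g X D) \<partial>?M)
        \<le> ennreal (exp (\<kappa> * b / 2 * real (card I) - \<kappa> * u))" .
  next
    fix D assume D: "D \<in> {D. regular I D \<and> u < (\<Sum>k\<in>I. \<Sum>l\<in>I. W D k l * noise (D k) * noise (D l))}"
    define X where "X = restrict (\<lambda>j. fst (D j)) I"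
    have X: "X \<in> ?X" using D by (auto simp: X_def regular_def)
    have W: "?W X = W D" by (rule cong) (simp add: X_def)
    have w1: "(\<Prod>i\<in>I. w (X i) (D i)) = 1" using D by (intro prod.neutral) (auto simp: w_def X_def noise_def regular_def)
    have \<phi>: "\<phi> (X i) (D i) = noise (D i)" if "i \<in> I" for i using that by (simp add: \<phi>_def X_def noise_def)
    have q: "(\<Sum>k\<in>I. \<Sum>l\<in>I. ?W X k l * \<phi> (X k) (D k) * \<phi> (X l) (D l))
        = (\<Sum>k\<in>I. \<Sum>l\<in>I. W D k l * noise (D k) * noise (D l))"
      unfolding W by (intro sum.cong refl) (simp add: \<phi>)
    have "exp (\<kappa> * u) \<le> exp (\<kappa> * (\<Sum>k\<in>I. \<Sum>l\<in>I. W D k l * noise (D k) * noise (D l)))"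
      using D const by (auto intro!: mult_left_mono)
    then have "1 \<le> exp (- (\<kappa> * u)) * exp (\<kappa> * (\<Sum>k\<in>I. \<Sum>l\<in>I. W D k l * noise (D k) * noise (D l)))"
      by (simp add: exp_minus field_simps)
    then have "1 \<le> ennreal (exp (- (\<kappa> * u))) * ?g X D"
      unfolding q w1 by (simp add: ennreal_mult[symmetric])
    also have "\<dots> \<le> ennreal (exp (- (\<kappa> * u))) * (\<Sum>X\<in>?X. ?g X D)"
      using X finX by (intro mult_left_mono member_le_sum) auto
    finally show "1 \<le> ennreal (exp (- (\<kappa> * u))) * (\<Sum>X\<in>?X. ?g X D)" .
  qed measurable
qed

lemma outer_le_no_hit:
  assumes "finite I" "H \<subseteq> I"
  shows "outer_le (PiM I (\<lambda>_. Z)) {D. idx_in D H C = {}} (exp (- (real (card H) * \<mu> C)))"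
proof -
  define g :: "point \<times> real \<Rightarrow> ennreal" where "g z = indicator (- C) (fst z)" for z
  have [measurable]: "g \<in> borel_measurable Z" unfolding g_def by measurable
  have "(\<integral>\<^sup>+D. (\<Prod>b<(1::nat). \<Prod>j\<in>H. g (D j)) \<partial>PiM I (\<lambda>_. Z)) = (\<Prod>b<(1::nat). (\<integral>\<^sup>+z. g z \<partial>Z) ^ card H)"
    using assms Z.prob_space_axioms by (intro nn_integral_PiM_blocks) (auto simp: disjoint_family_on_def)
  then have "(\<integral>\<^sup>+D. (\<Prod>j\<in>H. g (D j)) \<partial>PiM I (\<lambda>_. Z)) = (\<integral>\<^sup>+z. g z \<partial>Z) ^ card H" by simp
  also have "(\<integral>\<^sup>+z. g z \<partial>Z) = ennreal (1 - \<mu> C)"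
  proof -
    have "(\<integral>\<^sup>+z. g z \<partial>Z) = emeasure (measure_pmf Dx) (- C)"
      unfolding g_def by (subst nn_integral_Z_fst) simp
    also have "\<dots> = ennreal (1 - \<mu> C)"
      using measure_pmf.prob_compl[of C Dx]
      by (simp add: measure_pmf.emeasure_eq_measure Compl_eq_Diff_UNIV)
    finally show ?thesis .
  qed
  also have "ennreal (1 - \<mu> C) ^ card H = ennreal ((1 - \<mu> C) ^ card H)" by (simp add: ennreal_power)
  also have "\<dots> \<le> ennreal (exp (- (real (card H) * \<mu> C)))"
  proof (intro ennreal_leI)
    have "(1 - \<mu> C) ^ card H \<le> exp (- \<mu> C) ^ card H"
      using exp_ge_add_one_self[of "- \<mu> C"] by (intro power_mono) auto
    then show "(1 - \<mu> C) ^ card H \<le> exp (- (real (card H) * \<mu> C))"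
      by (simp add: exp_of_nat_mult[symmetric])
  qed
  finally have int: "(\<integral>\<^sup>+D. (\<Prod>j\<in>H. g (D j)) \<partial>PiM I (\<lambda>_. Z)) \<le> ennreal (exp (- (real (card H) * \<mu> C)))" .
  show ?thesis
  proof (rule outer_leI_nn_integral[OF _ int])
    show "(\<lambda>D. \<Prod>j\<in>H. g (D j)) \<in> borel_measurable (PiM I (\<lambda>_. Z))"
      using assms(2) by (intro borel_measurable_prod_components) auto
    show "1 \<le> (\<Prod>j\<in>H. g (D j))" if "D \<in> {D. idx_in D H C = {}}" for D
    proof -
      have "(\<Prod>j\<in>H. g (D j)) = 1" using that by (intro prod.neutral) (auto simp: g_def idx_in_def)
      then show ?thesis by simp
    qed
  qed
qed

text \<open>Yields \<open>exp (- 1) \<le> 3 / 8\<close>, the source of the constant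
  \<open>5 / 8\<close> in the next Chernoff bound.\<close>

lemma exp_one_ge: "(8::real) / 3 \<le> exp 1"
proof -
  have "(1 + 1 / 4 + (1 / 4)\<^sup>2 / 2) ^ 4 \<le> exp (1 / 4 :: real) ^ 4"
    by (intro power_mono exp_lower_Taylor_quadratic) auto
  also have "exp (1 / 4 :: real) ^ 4 = exp 1" by (simp add: exp_of_nat_mult[symmetric])
  finally show ?thesis by (simp add: power2_eq_square power4_eq_xxxx)
qed

text \<open>Lower Chernoff bound for all cells of a disjoint family at once: the product over the cells
  is expanded into a sum over the sets \<open>Q\<close> of undersampled cells.\<close>

lemma outer_le_undersampled:
  fixes S :: "cell set" and h :: nat
  assumes I: "finite I" and H: "disjoint_family_on H {..<N}" "\<And>b. b < N \<Longrightarrow> H b \<subseteq> I" "\<And>b. b < N \<Longrightarrow> card (H b) = h"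
    and S: "finite S" "\<And>C C'. C \<in> S \<Longrightarrow> C' \<in> S \<Longrightarrow> C \<noteq> C' \<Longrightarrow> C \<inter> C' = {}"
  shows "outer_le (PiM I (\<lambda>_. Z))
    {D. 1 < (\<Sum>b<N. \<Sum>C\<in>S. 2 * \<mu> C * of_bool (real (card (idx_in D (H b) C)) < real h * \<mu> C / 2))}
    (exp (- (real h / 32)) * (\<Prod>C\<in>S. 1 + exp (- (real h * \<mu> C / 16))) ^ N)"
proof -
  let ?M = "PiM I (\<lambda>_. Z)"
  define G where "G Q z = (\<Prod>C\<in>Q. exp (- of_bool (fst z \<in> C)) :: real)" for Q :: "cell set" and z :: "point \<times> real"
  \<comment> \<open>For an undersampled cell, \<open>h * 9 / 16 * \<mu> C\<close> exceeds the count
    by more than \<open>h * \<mu> C / 16\<close>, which is \<open>h / 32\<close> times its term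
    \<open>2 * \<mu> C\<close>. Integrating the points gives \<open>5 / 8\<close> in place of the
    count, and \<open>9 / 16 - 5 / 8 = - 1 / 16\<close> leaves
    \<open>exp (- (h * \<mu> C / 16))\<close> per cell.\<close>
  define K where "K Q = (\<Prod>C\<in>Q. exp (real h * 9 / 16 * \<mu> C))" for Q
  have fH: "finite (H b)" if "b < N" for b using H(2)[OF that] I finite_subset by auto
  have G0: "0 \<le> G Q z" for Q z unfolding G_def by (intro prod_nonneg) auto
  have K0: "0 \<le> K Q" for Q unfolding K_def by (intro prod_nonneg) auto
  have [measurable]: "G Q \<in> borel_measurable Z" for Q unfolding G_def by measurable
  define F where "F D = (\<Prod>b<N. \<Sum>Q\<in>Pow S. ennreal (K Q) * (\<Prod>j\<in>H b. ennreal (G Q (D j))))" for D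
  have F_meas [measurable]: "F \<in> borel_measurable ?M" 
  proof -
    have "(\<lambda>D. \<Prod>j\<in>H b. ennreal (G Q (D j))) \<in> borel_measurable ?M" if "b < N" for b Q
      using H(2)[OF that] by (intro borel_measurable_prod_components) measurable
    then show ?thesis unfolding F_def
      by (intro borel_measurable_prod_ennreal borel_measurable_sum borel_measurable_times borel_measurable_const) auto
  qed
  have EG: "(\<integral>\<^sup>+z. ennreal (G Q z) \<partial>Z) \<le> ennreal (\<Prod>C\<in>Q. exp (- (5 / 8 * \<mu> C)))" if "Q \<subseteq> S" for Q
  proof -
    have fQ: "finite Q" using that S(1) finite_subset by auto
    have disj: "disjoint_family_on (\<lambda>C. C) Q" using that S(2) by (force simp: disjoint_family_on_def)
    have \<mu>Q: "\<mu> (\<Union>Q) = (\<Sum>C\<in>Q. \<mu> C)"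
      using measure_pmf.finite_measure_finite_Union[OF fQ _ disj, of Dx] by simp
    have G: "G Q z \<le> 1 - 5 / 8 * of_bool (fst z \<in> \<Union>Q)" for z
    proof (cases "fst z \<in> \<Union>Q")
      case True
      then obtain C where C: "C \<in> Q" "fst z \<in> C" by auto
      then have "G Q z = exp (- of_bool (fst z \<in> C)) * (\<Prod>C\<in>Q - {C}. exp (- of_bool (fst z \<in> C)))"
        unfolding G_def using fQ by (simp add: prod.remove)
      also have "\<dots> \<le> exp (- of_bool (fst z \<in> C)) * 1"
        by (intro mult_left_mono prod_le_1) auto
      also have "\<dots> \<le> 3 / 8" using C exp_one_ge by (simp add: exp_minus field_simps)
      finally show ?thesis using True by simp
    next
      case False
      then have "G Q z = 1" unfolding G_def by (intro prod.neutral) auto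
      then show ?thesis using False by simp
    qed
    have "(\<integral>\<^sup>+z. ennreal (G Q z) \<partial>Z) \<le> (\<integral>\<^sup>+z. ennreal (1 - 5 / 8 * of_bool (fst z \<in> \<Union>Q)) \<partial>Z)"
      by (intro nn_integral_mono ennreal_leI G)
    also have "\<dots> = (\<integral>\<^sup>+x. ennreal (1 - 5 / 8 * of_bool (x \<in> \<Union>Q)) \<partial>measure_pmf Dx)"
      by (rule nn_integral_Z_fst)
    also have "\<dots> = ennreal (\<integral>x. 1 - 5 / 8 * indicator (\<Union>Q) x \<partial>measure_pmf Dx)"
      by (subst nn_integral_eq_integral[symmetric])
         (auto intro!: measure_pmf.integrable_const_bound[where B=1] nn_integral_cong simp: indicator_def)
    also have "(\<integral>x. 1 - 5 / 8 * indicator (\<Union>Q) x \<partial>measure_pmf Dx) = 1 - 5 / 8 * \<mu> (\<Union>Q)"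
    proof -
      have "integrable (measure_pmf Dx) (indicator (\<Union>Q) :: point \<Rightarrow> real)"
        by (intro measure_pmf.integrable_const_bound[where B=1]) auto
      then show ?thesis by (subst Bochner_Integration.integral_diff) auto
    qed
    also have "1 - 5 / 8 * \<mu> (\<Union>Q) \<le> exp (- (5 / 8 * \<mu> (\<Union>Q)))"
      using exp_ge_add_one_self[of "- (5 / 8 * \<mu> (\<Union>Q))"] by simp
    also have "exp (- (5 / 8 * \<mu> (\<Union>Q))) = (\<Prod>C\<in>Q. exp (- (5 / 8 * \<mu> C)))"
      unfolding \<mu>Q using fQ by (simp add: exp_sum[symmetric] sum_negf sum_distrib_left)
    finally show ?thesis by (simp add: ennreal_leI)
  qed
  have int: "(\<integral>\<^sup>+D. F D \<partial>?M) \<le> ennreal ((\<Prod>C\<in>S. 1 + exp (- (real h * \<mu> C / 16))) ^ N)"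
  proof -
    \<comment> \<open>Choosing one set \<open>g b\<close> of cells for each block turns the product
      of sums into a sum of products, and each of these factorizes over the observations.\<close>
    let ?B = "PiE {..<N} (\<lambda>_. Pow S)"
    have "F D = (\<Sum>g\<in>?B. \<Prod>b<N. ennreal (K (g b)) * (\<Prod>j\<in>H b. ennreal (G (g b) (D j))))" for D
      unfolding F_def by (rule prod_sum_PiE) (use S(1) in auto)
    then have "(\<integral>\<^sup>+D. F D \<partial>?M) = (\<integral>\<^sup>+D. (\<Sum>g\<in>?B. (\<Prod>b<N. ennreal (K (g b))) * (\<Prod>b<N. \<Prod>j\<in>H b. ennreal (G (g b) (D j)))) \<partial>?M)"
      by (simp add: prod.distrib)
    also have "\<dots> = (\<Sum>g\<in>?B. (\<Prod>b<N. ennreal (K (g b))) * (\<integral>\<^sup>+D. (\<Prod>b<N. \<Prod>j\<in>H b. ennreal (G (g b) (D j))) \<partial>?M))"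
    proof -
      have [measurable]: "(\<lambda>D. (\<Prod>b<N. \<Prod>j\<in>H b. ennreal (G (g b) (D j)))) \<in> borel_measurable ?M" for g
      proof (rule borel_measurable_prod_ennreal)
        fix b assume "b \<in> {..<N}"
        then show "(\<lambda>D. \<Prod>j\<in>H b. ennreal (G (g b) (D j))) \<in> borel_measurable ?M"
          using H(2) by (intro borel_measurable_prod_components) auto
      qed
      show ?thesis by (subst nn_integral_sum) (auto simp: nn_integral_cmult)
    qed
    also have "\<dots> = (\<Sum>g\<in>?B. (\<Prod>b<N. ennreal (K (g b))) * (\<Prod>b<N. (\<integral>\<^sup>+z. ennreal (G (g b) z) \<partial>Z) ^ h))"
      using H(3) by (subst nn_integral_PiM_blocks[OF Z.prob_space_axioms I H(1,2)]) auto
    also have "\<dots> = (\<Sum>g\<in>?B. \<Prod>b<N. ennreal (K (g b)) * (\<integral>\<^sup>+z. ennreal (G (g b) z) \<partial>Z) ^ h)"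
      by (simp add: prod.distrib)
    also have "\<dots> = (\<Prod>b<N. \<Sum>Q\<in>Pow S. ennreal (K Q) * (\<integral>\<^sup>+z. ennreal (G Q z) \<partial>Z) ^ h)"
      by (rule prod_sum_PiE[symmetric]) (use S(1) in auto)
    also have "\<dots> \<le> (\<Prod>b<N. \<Sum>Q\<in>Pow S. ennreal (K Q) * ennreal (\<Prod>C\<in>Q. exp (- (5 / 8 * \<mu> C))) ^ h)"
      by (intro prod_mono_ennreal sum_mono mult_left_mono power_mono EG) auto
    also have "\<dots> = (\<Prod>b<N. \<Sum>Q\<in>Pow S. ennreal (\<Prod>C\<in>Q. exp (- (real h * \<mu> C / 16))))"
    proof (intro prod.cong sum.cong refl)
      fix Q assume "Q \<in> Pow S"
      have "K Q * (\<Prod>C\<in>Q. exp (- (5 / 8 * \<mu> C))) ^ h = (\<Prod>C\<in>Q. exp (- (real h * \<mu> C / 16)))"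
        unfolding K_def prod_power_distrib prod.distrib[symmetric]
        by (intro prod.cong refl) (simp add: exp_of_nat_mult[symmetric] exp_add[symmetric] algebra_simps)
      then show "ennreal (K Q) * ennreal (\<Prod>C\<in>Q. exp (- (5 / 8 * \<mu> C))) ^ h = ennreal (\<Prod>C\<in>Q. exp (- (real h * \<mu> C / 16)))"
        using K0 by (simp add: ennreal_mult[symmetric] ennreal_power prod_nonneg)
    qed
    also have "\<dots> = ennreal ((\<Sum>Q\<in>Pow S. \<Prod>C\<in>Q. exp (- (real h * \<mu> C / 16))) ^ N)"
      by (simp add: sum_ennreal prod_nonneg ennreal_power sum_nonneg)
    also have "(\<Sum>Q\<in>Pow S. \<Prod>C\<in>Q. exp (- (real h * \<mu> C / 16))) = (\<Prod>C\<in>S. exp (- (real h * \<mu> C / 16)) + 1)"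
      using prod_add[OF S(1), of "\<lambda>C. exp (- (real h * \<mu> C / 16))" "\<lambda>_. 1"] by simp
    finally show ?thesis by (simp add: add.commute)
  qed
  show ?thesis
  proof (rule outer_leI_nn_integral[where f = "\<lambda>D. ennreal (exp (- (real h / 32))) * F D"])
    have "(\<integral>\<^sup>+D. ennreal (exp (- (real h / 32))) * F D \<partial>?M) = ennreal (exp (- (real h / 32))) * (\<integral>\<^sup>+D. F D \<partial>?M)"
      by (rule nn_integral_cmult) measurable
    also have "\<dots> \<le> ennreal (exp (- (real h / 32))) * ennreal ((\<Prod>C\<in>S. 1 + exp (- (real h * \<mu> C / 16))) ^ N)"
      by (intro mult_left_mono int) auto
    also have "\<dots> = ennreal (exp (- (real h / 32)) * (\<Prod>C\<in>S. 1 + exp (- (real h * \<mu> C / 16))) ^ N)"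
      by (simp add: ennreal_mult[symmetric] prod_nonneg add_nonneg_nonneg)
    finally show "(\<integral>\<^sup>+D. ennreal (exp (- (real h / 32))) * F D \<partial>?M) \<le> \<dots>" .
  next
    fix D assume D: "D \<in> {D. 1 < (\<Sum>b<N. \<Sum>C\<in>S. 2 * \<mu> C * of_bool (real (card (idx_in D (H b) C)) < real h * \<mu> C / 2))}"
    let ?u = "\<lambda>b C. of_bool (real (card (idx_in D (H b) C)) < real h * \<mu> C / 2) :: real"
    let ?c = "\<lambda>b C. real (card (idx_in D (H b) C))"
    have one: "exp (real h / 32 * (2 * \<mu> C * ?u b C)) \<le> exp (real h * 9 / 16 * \<mu> C - ?c b C) + 1" for b C
    proof (cases "?c b C < real h * \<mu> C / 2")
      case True
      then have "exp (real h / 32 * (2 * \<mu> C * ?u b C)) \<le> exp (real h * 9 / 16 * \<mu> C - ?c b C)" by simp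
      then show ?thesis by linarith
    qed simp
    have cnt: "(\<Prod>C\<in>Q. exp (- ?c b C)) = (\<Prod>j\<in>H b. G Q (D j))" if "b < N" for b Q
    proof -
      have "?c b C = (\<Sum>j\<in>H b. of_bool (fst (D j) \<in> C))" for C
        using fH[OF that] by (simp add: idx_in_def sum.If_cases of_bool_def Int_def)
      then have "(\<Prod>C\<in>Q. exp (- ?c b C)) = (\<Prod>C\<in>Q. \<Prod>j\<in>H b. exp (- of_bool (fst (D j) \<in> C)))"
        using fH[OF that] by (simp add: exp_sum[symmetric] sum_negf)
      then show ?thesis unfolding G_def by (simp add: prod.swap[of _ "H b"])
    qed
    have blk: "(\<Prod>C\<in>S. exp (real h / 32 * (2 * \<mu> C * ?u b C))) \<le> (\<Sum>Q\<in>Pow S. K Q * (\<Prod>j\<in>H b. G Q (D j)))"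
      if "b < N" for b
    proof -
      have "(\<Prod>C\<in>S. exp (real h / 32 * (2 * \<mu> C * ?u b C))) \<le> (\<Prod>C\<in>S. exp (real h * 9 / 16 * \<mu> C - ?c b C) + 1)"
        by (intro prod_mono conjI one) auto
      also have "\<dots> = (\<Sum>Q\<in>Pow S. (\<Prod>C\<in>Q. exp (real h * 9 / 16 * \<mu> C - ?c b C)))"
        using prod_add[OF S(1), of "\<lambda>C. exp (real h * 9 / 16 * \<mu> C - ?c b C)" "\<lambda>_. 1"] by simp
      also have "\<dots> = (\<Sum>Q\<in>Pow S. K Q * (\<Prod>j\<in>H b. G Q (D j)))"
        unfolding K_def cnt[OF that, symmetric] prod.distrib[symmetric]
        by (intro sum.cong prod.cong refl) (simp add: exp_add[symmetric])
      finally show ?thesis .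
    qed
    have "exp (real h / 32) \<le> exp (real h / 32 * (\<Sum>b<N. \<Sum>C\<in>S. 2 * \<mu> C * ?u b C))"
      using D mult_left_mono[of 1 "\<Sum>b<N. \<Sum>C\<in>S. 2 * \<mu> C * ?u b C" "real h / 32"] by simp
    also have "\<dots> = (\<Prod>b<N. \<Prod>C\<in>S. exp (real h / 32 * (2 * \<mu> C * ?u b C)))"
      by (simp only: sum_distrib_left exp_sum[OF S(1)] exp_sum[OF finite_lessThan])
    also have "\<dots> \<le> (\<Prod>b<N. \<Sum>Q\<in>Pow S. K Q * (\<Prod>j\<in>H b. G Q (D j)))"
      using blk by (intro prod_mono conjI) (auto intro!: prod_nonneg)
    finally have le: "exp (real h / 32) \<le> (\<Prod>b<N. \<Sum>Q\<in>Pow S. K Q * (\<Prod>j\<in>H b. G Q (D j)))" .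
    have "F D = ennreal (\<Prod>b<N. \<Sum>Q\<in>Pow S. K Q * (\<Prod>j\<in>H b. G Q (D j)))"
      unfolding F_def using G0 K0
      by (simp add: prod_ennreal prod_nonneg ennreal_mult[symmetric] sum_ennreal sum_nonneg)
    then have "ennreal (exp (- (real h / 32))) * F D
        = ennreal (exp (- (real h / 32)) * (\<Prod>b<N. \<Sum>Q\<in>Pow S. K Q * (\<Prod>j\<in>H b. G Q (D j))))"
      by (simp add: ennreal_mult')
    moreover have "1 \<le> exp (- (real h / 32)) * (\<Prod>b<N. \<Sum>Q\<in>Pow S. K Q * (\<Prod>j\<in>H b. G Q (D j)))"
      using le by (simp add: exp_minus field_simps)
    ultimately show "1 \<le> ennreal (exp (- (real h / 32))) * F D" by simp
  qed measurable
qed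

end

section \<open>Error of one block average\<close>

lemma nths_eq_iff:
  "length x = length y \<Longrightarrow> nths x S = nths y S \<longleftrightarrow> (\<forall>i\<in>S. i < length x \<longrightarrow> x ! i = y ! i)"
proof (induction x arbitrary: y S)
  case (Cons a x)
  then obtain b y' where y: "y = b # y'" "length x = length y'" by (cases y) auto
  have *: "(\<forall>i\<in>S. i < Suc (length x) \<longrightarrow> (a # x) ! i = (b # y') ! i)
      \<longleftrightarrow> (0 \<in> S \<longrightarrow> a = b) \<and> (\<forall>i\<in>{j. Suc j \<in> S}. i < length x \<longrightarrow> x ! i = y' ! i)"
    by (auto simp: all_conj_distrib less_Suc_eq_0_disj)
  show ?case
    using Cons.IH[of y' "{j. Suc j \<in> S}"] y * by (simp add: nths_Cons)
qed simp

text \<open>A cell is named by one of its points and its fixed coordinates, so that the fixed values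
  need no separate assignment and the half containing \<open>x\<close> is again of this form for the
  same \<open>x\<close>.\<close>

definition agreeing :: "nat \<Rightarrow> nat set \<Rightarrow> point \<Rightarrow> cell" where
  "agreeing d F x = {z \<in> cube d. \<forall>i\<in>F. z ! i = x ! i}"

lemma agreeing_empty: "agreeing d {} x = cube d"
  by (simp add: agreeing_def)

lemma half_agreeing: "half (agreeing d F x) i (x ! i) = agreeing d (insert i F) x"
  by (auto simp: half_def agreeing_def)

lemma sparse_with_agreeing:
  assumes "sparse_with d m r R" "x \<in> cube d" "z \<in> agreeing d R x"
  shows "m z = m x"
proof -
  have "nths z R = nths x R"
    using assms(2,3) by (subst nths_eq_iff) (auto simp: agreeing_def cube_def)
  then show ?thesis using assms by (force simp: sparse_with_def agreeing_def)
qed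

text \<open>\<open>F\<close> collects the coordinates cut above the node. Once \<open>R\<close> is
  exhausted the tree is arbitrary, because a sparse \<open>m\<close> is constant on such
  cells.\<close>

primrec splits_first :: "nat set \<Rightarrow> split_tree \<Rightarrow> nat set \<Rightarrow> bool" where
  "splits_first R Leaf F \<longleftrightarrow> R \<subseteq> F"
| "splits_first R (Node i l r) F \<longleftrightarrow>
     R \<subseteq> F \<or> i \<in> R - F \<and> splits_first R l (insert i F) \<and> splits_first R r (insert i F)"

text \<open>While a relevant coordinate \<open>i\<close> is being cut, the current cell contains the
  \<open>R\<close>-cell of \<open>x\<close> and that of \<open>x\<close> with coordinate
  \<open>i\<close> flipped. Both are hit, so there are two distinct covariates and the half
  containing \<open>x\<close> is not empty: the descent cannot stop yet.\<close>

lemma resolved_cell_subset_agreeing: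
  assumes "R \<subseteq> {..<d}" "x \<in> cube d" "finite H"
    and hit: "\<And>z. z \<in> cube d \<Longrightarrow> idx_in D H (agreeing d R z) \<noteq> {}"
    and "F \<subseteq> R" "splits_first R \<tau> F"
  shows "resolved_cell D H \<tau> (agreeing d F x) x \<subseteq> agreeing d R x"
  using assms(5,6)
proof (induction \<tau> arbitrary: F)
  case (Node i l r)
  show ?case
  proof (cases "R \<subseteq> F")
    case True
    then have "F = R" using Node.prems by auto
    then show ?thesis using resolved_cell_subset by metis
  next
    case False
    then have i: "i \<in> R" "i \<notin> F" and sub: "splits_first R l (insert i F)" "splits_first R r (insert i F)"
      using Node.prems(2) by auto
    let ?A = "agreeing d F x"
    define x' where "x' = x[i := \<not> x ! i]"
    have x': "x' \<in> cube d" "x' ! i = (\<not> x ! i)" "\<And>k. k \<noteq> i \<Longrightarrow> x' ! k = x ! k"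
      using assms(1,2) i by (auto simp: x'_def cube_def)
    obtain j where j: "j \<in> H" "fst (D j) \<in> agreeing d R x"
      using hit[OF assms(2)] by (auto simp: idx_in_def)
    obtain j' where j': "j' \<in> H" "fst (D j') \<in> agreeing d R x'"
      using hit[OF x'(1)] by (auto simp: idx_in_def)
    have "fst (D j') ! k = x ! k" if "k \<in> F" for k
      using that j'(2) Node.prems(1) i(2) x'(3)[of k] by (auto simp: agreeing_def)
    then have A: "fst (D j) \<in> ?A" "fst (D j') \<in> ?A"
      using j(2) j'(2) Node.prems(1) by (auto simp: agreeing_def)
    have ne: "fst (D j) \<noteq> fst (D j')"
      using j j' i x' by (auto simp: agreeing_def)
    have "\<not> card (covariates D H \<inter> ?A) \<le> 1"
    proof
      assume "card (covariates D H \<inter> ?A) \<le> 1"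
      moreover have "finite (covariates D H \<inter> ?A)" using assms(3) by (simp add: covariates_def)
      ultimately have "\<forall>u\<in>covariates D H \<inter> ?A. \<forall>v\<in>covariates D H \<inter> ?A. u = v"
        by (simp add: card_le_Suc0_iff_eq)
      then show False using A ne j(1) j'(1) by (auto simp: covariates_def)
    qed
    moreover have "idx_in D H (half ?A i (x ! i)) \<noteq> {}"
      using j A i by (auto simp: idx_in_def half_def agreeing_def)
    ultimately have "resolved_cell D H (Node i l r) ?A x
        = resolved_cell D H (if x ! i then r else l) (half ?A i (x ! i)) x" by simp
    also have "\<dots> \<subseteq> agreeing d R x"
      unfolding half_agreeing using Node.IH[of "insert i F"] sub i Node.prems(1) by auto
    finally show ?thesis .
  qed
next
  case Leaf
  then show ?case by (auto simp: agreeing_def)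
qed

lemma square_mean_le:
  fixes f :: "nat \<Rightarrow> real"
  assumes "0 < N"
  shows "((\<Sum>b<N. f b) / N)\<^sup>2 \<le> (\<Sum>b<N. (f b)\<^sup>2) / N"
proof -
  have "(\<Sum>b<N. f b)\<^sup>2 \<le> (\<Sum>b<N. (1::real)\<^sup>2) * (\<Sum>b<N. (f b)\<^sup>2)"
    using Cauchy_Schwarz_ineq_sum[of "\<lambda>_. 1" f "{..<N}"] by simp
  then have "(\<Sum>b<N. f b)\<^sup>2 \<le> N * (\<Sum>b<N. (f b)\<^sup>2)" by simp
  then show ?thesis using assms by (simp add: power_divide divide_le_eq power2_eq_square field_simps)
qed

context regression
begin

definition cell_weight :: "dataset \<Rightarrow> nat set \<Rightarrow> split_tree \<Rightarrow> point \<Rightarrow> nat \<Rightarrow> real" where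
  "cell_weight D H \<tau> x j = of_bool (fst (D j) \<in> resolved_cell D H \<tau> (cube d) x) /
     real (card (idx_in D H (resolved_cell D H \<tau> (cube d) x)))"

definition undersampled :: "nat \<Rightarrow> real \<Rightarrow> dataset \<Rightarrow> nat set \<Rightarrow> cell \<Rightarrow> bool" where
  "undersampled h v D H C \<longleftrightarrow> v \<le> \<mu> C \<and> real (card (idx_in D H C)) < real h * \<mu> C / 4"

text \<open>Weight of observation \<open>j\<close> in the block mean at \<open>x\<close>, leaving
  out the blocks for which \<open>x\<close> lies in the exceptional set \<open>U b\<close>. The
  omitted blocks are accounted for through the masses of these sets.\<close>

definition block_weight ::
  "(nat \<Rightarrow> nat set) \<Rightarrow> nat \<Rightarrow> (nat \<Rightarrow> point set) \<Rightarrow> split_tree \<Rightarrow> dataset \<Rightarrow> point \<Rightarrow> nat \<Rightarrow> real" where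
  "block_weight H N U \<tau> D x j =
     (\<Sum>b<N. of_bool (j \<in> H b \<and> x \<notin> U b) * cell_weight D (H b) \<tau> x j) / real N"

definition block_mse :: "(nat \<Rightarrow> nat set) \<Rightarrow> nat \<Rightarrow> split_tree \<Rightarrow> dataset \<Rightarrow> real" where
  "block_mse H N \<tau> D = (\<Sum>x\<in>cube d. pmf Dx x *
     (m x - (\<Sum>b<N. cell_mean D (H b) (resolved_cell D (H b) \<tau> (cube d) x)) / N)\<^sup>2)"

lemma cell_weight_nonneg: "0 \<le> cell_weight D H \<tau> x j"
  by (simp add: cell_weight_def)

lemma cell_weight_le_1: "cell_weight D H \<tau> x j \<le> 1"
  unfolding cell_weight_def
  by (cases "card (idx_in D H (resolved_cell D H \<tau> (cube d) x)) = 0") (auto simp: divide_le_eq)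

lemma sum_cell_weight: "finite H \<Longrightarrow> (\<Sum>j\<in>H. cell_weight D H \<tau> x j) \<le> 1"
proof -
  assume H: "finite H"
  let ?C = "resolved_cell D H \<tau> (cube d) x"
  have "(\<Sum>j\<in>H. of_bool (fst (D j) \<in> ?C) :: real) = card (idx_in D H ?C)"
    using H by (simp add: idx_in_def sum.If_cases of_bool_def Int_def)
  then have "(\<Sum>j\<in>H. cell_weight D H \<tau> x j) = card (idx_in D H ?C) / card (idx_in D H ?C)"
    unfolding cell_weight_def sum_divide_distrib[symmetric] by simp
  then show ?thesis by (simp add: divide_le_eq)
qed

lemma cell_weight_cong:
  "(\<And>j. j \<in> H \<Longrightarrow> fst (D j) = fst (D' j)) \<Longrightarrow> j \<in> H \<Longrightarrow> cell_weight D H \<tau> x j = cell_weight D' H \<tau> x j"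
  by (simp add: cell_weight_def idx_in_cong[of H D D'] resolved_cell_cong[of H D D'])

text \<open>With \<open>m\<close> equal to \<open>m x\<close> at all sample points of the cell there
  is no bias, and the error is averaged noise.\<close>

lemma cell_mean_resolved:
  assumes "finite H" "\<And>j. j \<in> H \<Longrightarrow> fst (D j) \<in> resolved_cell D H \<tau> (cube d) x \<Longrightarrow> m (fst (D j)) = m x"
    and "idx_in D H (cube d) \<noteq> {}"
  shows "cell_mean D H (resolved_cell D H \<tau> (cube d) x) = m x + (\<Sum>j\<in>H. cell_weight D H \<tau> x j * noise (D j))"
proof -
  let ?C = "resolved_cell D H \<tau> (cube d) x"
  let ?n = "real (card (idx_in D H ?C))"
  have n: "?n \<noteq> 0" using resolved_cell_nonempty[OF assms(3), of \<tau> x] assms(1) by (auto simp: idx_in_def)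
  have "(\<Sum>j\<in>H. cell_weight D H \<tau> x j * noise (D j)) = (\<Sum>j\<in>H. of_bool (fst (D j) \<in> ?C) * noise (D j)) / ?n"
    unfolding cell_weight_def sum_divide_distrib by simp
  also have "(\<Sum>j\<in>H. of_bool (fst (D j) \<in> ?C) * noise (D j)) = (\<Sum>j\<in>idx_in D H ?C. noise (D j))"
    using assms(1) unfolding idx_in_def
    by (subst sum.inter_filter) (auto intro!: sum.cong simp: of_bool_def)
  also have "\<dots> = (\<Sum>j\<in>idx_in D H ?C. snd (D j) - m x)"
    using assms(2) by (intro sum.cong) (auto simp: noise_def idx_in_def)
  also have "\<dots> = (\<Sum>j\<in>idx_in D H ?C. snd (D j)) - ?n * m x" by (simp add: sum_subtractf)
  finally show ?thesis using n by (simp add: cell_mean_def diff_divide_distrib)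
qed

text \<open>The error at \<open>x\<close> is \<open>- (a x + c x)\<close>, with \<open>a\<close>
  from the blocks where \<open>x\<close> is not exceptional and \<open>c\<close> from the others. In
  \<open>2 * (a x)\<^sup>2 + 2 * (c x)\<^sup>2\<close> the first term integrates to the quadratic
  form; the noise mean of one block is at most \<open>1 / 2\<close>, so the second costs
  \<open>1 / (2 * N)\<close> per unit of exceptional mass.\<close>

lemma block_error_le:
  fixes U :: "nat \<Rightarrow> point set" and H :: "nat \<Rightarrow> nat set" and N :: nat and \<tau> and D
  assumes R: "sparse_with d m r R" "splits_first R \<tau> {}"
    and I: "finite I" and N: "0 < N" and H: "\<And>b. b < N \<Longrightarrow> H b \<subseteq> I"
    and regular: "regular I D"
    and hit: "\<And>b z. b < N \<Longrightarrow> z \<in> cube d \<Longrightarrow> idx_in D (H b) (agreeing d R z) \<noteq> {}"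
  defines "\<omega> \<equiv> block_weight H N U \<tau> D"
  shows "block_mse H N \<tau> D \<le> 2 * (\<Sum>k\<in>I. \<Sum>l\<in>I. (\<Sum>x\<in>cube d. pmf Dx x * \<omega> x k * \<omega> x l) * noise (D k) * noise (D l))
      + (\<Sum>b<N. \<mu> (U b)) / (2 * N)"
proof -
  have noise: "\<bar>noise (D j)\<bar> \<le> 1 / 2" if "j \<in> I" for j using regular that by (simp add: regular_def)
  have fH: "finite (H b)" if "b < N" for b using H[OF that] I finite_subset by auto
  define e where "e b x = (\<Sum>j\<in>H b. cell_weight D (H b) \<tau> x j * noise (D j))" for b x
  have mean: "cell_mean D (H b) (resolved_cell D (H b) \<tau> (cube d) x) = m x + e b x" if "b < N" "x \<in> cube d" for b x
    unfolding e_def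
  proof (rule cell_mean_resolved[OF fH[OF that(1)]])
    show "m (fst (D j)) = m x" if "fst (D j) \<in> resolved_cell D (H b) \<tau> (cube d) x" for j
    proof (rule sparse_with_agreeing[OF R(1) \<open>x \<in> cube d\<close>])
      have "resolved_cell D (H b) \<tau> (agreeing d {} x) x \<subseteq> agreeing d R x"
        using R \<open>x \<in> cube d\<close> fH[OF \<open>b < N\<close>] hit[OF \<open>b < N\<close>]
        by (intro resolved_cell_subset_agreeing) (auto simp: sparse_with_def)
      then show "fst (D j) \<in> agreeing d R x" using that by (auto simp: agreeing_empty)
    qed
    show "idx_in D (H b) (cube d) \<noteq> {}"
      using hit[OF that] idx_in_mono[of "agreeing d R x" "cube d" D "H b"] by (auto simp: agreeing_def)
  qed
  have e_bound: "\<bar>e b x\<bar> \<le> 1 / 2" if "b < N" for b x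
  proof -
    have "\<bar>e b x\<bar> \<le> (\<Sum>j\<in>H b. \<bar>cell_weight D (H b) \<tau> x j * noise (D j)\<bar>)"
      unfolding e_def by (rule sum_abs)
    also have "\<dots> \<le> (\<Sum>j\<in>H b. cell_weight D (H b) \<tau> x j * (1 / 2))"
      unfolding abs_mult abs_of_nonneg[OF cell_weight_nonneg]
      using noise H[OF that] cell_weight_nonneg by (intro sum_mono mult_left_mono) auto
    also have "\<dots> \<le> 1 * (1 / 2)"
      unfolding sum_distrib_right[symmetric] using sum_cell_weight[OF fH[OF that]] by (intro mult_right_mono) auto
    finally show ?thesis by simp
  qed
  define a where "a x = (\<Sum>j\<in>I. \<omega> x j * noise (D j))" for x
  define c where "c x = (\<Sum>b<N. of_bool (x \<in> U b) * e b x) / N" for x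
  have a: "a x = (\<Sum>b<N. of_bool (x \<notin> U b) * e b x) / N" for x
  proof -
    have "a x = (\<Sum>j\<in>I. \<Sum>b<N. of_bool (j \<in> H b \<and> x \<notin> U b) * cell_weight D (H b) \<tau> x j * noise (D j)) / N"
      unfolding a_def \<omega>_def block_weight_def sum_divide_distrib by (simp add: sum_distrib_right sum_divide_distrib)
    also have "(\<Sum>j\<in>I. \<Sum>b<N. of_bool (j \<in> H b \<and> x \<notin> U b) * cell_weight D (H b) \<tau> x j * noise (D j))
        = (\<Sum>b<N. \<Sum>j\<in>I. of_bool (j \<in> H b \<and> x \<notin> U b) * cell_weight D (H b) \<tau> x j * noise (D j))"
      by (rule sum.swap)
    also have "\<dots> = (\<Sum>b<N. of_bool (x \<notin> U b) * e b x)"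
    proof (intro sum.cong refl)
      fix b assume "b \<in> {..<N}"
      then have "(\<Sum>j\<in>I. of_bool (j \<in> H b \<and> x \<notin> U b) * cell_weight D (H b) \<tau> x j * noise (D j))
          = (\<Sum>j\<in>H b. of_bool (j \<in> H b \<and> x \<notin> U b) * cell_weight D (H b) \<tau> x j * noise (D j))"
        using H I by (intro sum.mono_neutral_right) auto
      then show "(\<Sum>j\<in>I. of_bool (j \<in> H b \<and> x \<notin> U b) * cell_weight D (H b) \<tau> x j * noise (D j))
          = of_bool (x \<notin> U b) * e b x"
        by (simp add: e_def sum_distrib_left)
    qed
    finally show ?thesis .
  qed
  have err: "(m x - (\<Sum>b<N. cell_mean D (H b) (resolved_cell D (H b) \<tau> (cube d) x)) / N)\<^sup>2
      \<le> 2 * (a x)\<^sup>2 + (\<Sum>b<N. of_bool (x \<in> U b)) / (2 * N)" if "x \<in> cube d" for x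
  proof -
    have "(\<Sum>b<N. cell_mean D (H b) (resolved_cell D (H b) \<tau> (cube d) x)) = (\<Sum>b<N. m x + e b x)"
      using mean that by (intro sum.cong) auto
    also have "\<dots> = N * m x + (\<Sum>b<N. of_bool (x \<notin> U b) * e b x + of_bool (x \<in> U b) * e b x)"
    proof -
      have "(\<Sum>b<N. e b x) = (\<Sum>b<N. of_bool (x \<notin> U b) * e b x + of_bool (x \<in> U b) * e b x)"
        by (intro sum.cong refl) simp
      then show ?thesis by (simp only: sum.distrib sum_constant card_lessThan)
    qed
    finally have "m x - (\<Sum>b<N. cell_mean D (H b) (resolved_cell D (H b) \<tau> (cube d) x)) / N = - (a x + c x)"
      using N unfolding a c_def by (simp add: sum.distrib add_divide_distrib)
    then have "(m x - (\<Sum>b<N. cell_mean D (H b) (resolved_cell D (H b) \<tau> (cube d) x)) / N)\<^sup>2 \<le> 2 * (a x)\<^sup>2 + 2 * (c x)\<^sup>2"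
      using sum_squares_bound[of "a x" "c x"] by (simp only: power2_minus power2_sum)
    also have "(c x)\<^sup>2 \<le> (\<Sum>b<N. (of_bool (x \<in> U b) * e b x)\<^sup>2) / N"
      unfolding c_def by (rule square_mean_le[OF N])
    also have "(\<Sum>b<N. (of_bool (x \<in> U b) * e b x)\<^sup>2) \<le> (\<Sum>b<N. of_bool (x \<in> U b) / 4)"
    proof (intro sum_mono)
      fix b assume "b \<in> {..<N}"
      then have "(e b x)\<^sup>2 \<le> (1 / 2)\<^sup>2" using e_bound[of b x] by (simp add: abs_le_square_iff[symmetric])
      then show "(of_bool (x \<in> U b) * e b x)\<^sup>2 \<le> of_bool (x \<in> U b) / (4::real)"
        by (simp add: power2_eq_square)
    qed
    finally show ?thesis using N by (simp add: sum_divide_distrib[symmetric] divide_right_mono)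
  qed
  have "(\<Sum>x\<in>cube d. pmf Dx x * (m x - (\<Sum>b<N. cell_mean D (H b) (resolved_cell D (H b) \<tau> (cube d) x)) / N)\<^sup>2)
      \<le> (\<Sum>x\<in>cube d. pmf Dx x * (2 * (a x)\<^sup>2 + (\<Sum>b<N. of_bool (x \<in> U b)) / (2 * N)))"
    by (intro sum_mono mult_left_mono err) auto
  also have "\<dots> = 2 * (\<Sum>x\<in>cube d. pmf Dx x * (a x)\<^sup>2) + (\<Sum>b<N. \<Sum>x\<in>cube d. pmf Dx x * of_bool (x \<in> U b)) / (2 * N)"
    by (subst sum.swap) (simp add: sum_distrib_left sum.distrib sum_divide_distrib algebra_simps)
  also have "(\<Sum>x\<in>cube d. pmf Dx x * (a x)\<^sup>2)
      = (\<Sum>k\<in>I. \<Sum>l\<in>I. (\<Sum>x\<in>cube d. pmf Dx x * \<omega> x k * \<omega> x l) * noise (D k) * noise (D l))"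
  proof -
    have "pmf Dx x * (a x)\<^sup>2 = (\<Sum>k\<in>I. \<Sum>l\<in>I. pmf Dx x * \<omega> x k * \<omega> x l * noise (D k) * noise (D l))" for x
      unfolding a_def power2_eq_square sum_product by (simp add: sum_distrib_left mult_ac)
    then have "(\<Sum>x\<in>cube d. pmf Dx x * (a x)\<^sup>2)
        = (\<Sum>x\<in>cube d. \<Sum>k\<in>I. \<Sum>l\<in>I. pmf Dx x * \<omega> x k * \<omega> x l * noise (D k) * noise (D l))" by simp
    also have "\<dots> = (\<Sum>k\<in>I. \<Sum>x\<in>cube d. \<Sum>l\<in>I. pmf Dx x * \<omega> x k * \<omega> x l * noise (D k) * noise (D l))"
      by (rule sum.swap)
    also have "\<dots> = (\<Sum>k\<in>I. \<Sum>l\<in>I. \<Sum>x\<in>cube d. pmf Dx x * \<omega> x k * \<omega> x l * noise (D k) * noise (D l))"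
      by (intro sum.cong refl sum.swap)
    finally show ?thesis by (simp add: sum_distrib_right)
  qed
  also have "(\<Sum>b<N. \<Sum>x\<in>cube d. pmf Dx x * of_bool (x \<in> U b)) \<le> (\<Sum>b<N. \<mu> (U b))"
  proof (intro sum_mono)
    fix b
    have "(\<Sum>x\<in>cube d. pmf Dx x * of_bool (x \<in> U b)) = (\<Sum>x\<in>cube d \<inter> U b. pmf Dx x)"
      using finite_cube by (simp add: of_bool_def sum.inter_restrict if_distrib cong: if_cong)
    also have "\<dots> = \<mu> (cube d \<inter> U b)" using finite_cube by (subst measure_measure_pmf_finite) auto
    also have "\<dots> \<le> \<mu> (U b)" by (intro measure_pmf.finite_measure_mono) auto
    finally show "(\<Sum>x\<in>cube d. pmf Dx x * of_bool (x \<in> U b)) \<le> \<mu> (U b)" .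
  qed
  finally show ?thesis unfolding block_mse_def by (simp add: divide_right_mono)
qed

end

lemma card_cube: "card (cube r) = 2 ^ r"
  using card_lists_length_eq[of "UNIV :: bool set" r] by (simp add: cube_def card_UNIV_bool)

lemma nths_in_cube: "z \<in> cube d \<Longrightarrow> R \<subseteq> {..<d} \<Longrightarrow> nths z R \<in> cube (card R)"
proof -
  assume "z \<in> cube d" "R \<subseteq> {..<d}"
  then have "{i. i < length z \<and> i \<in> R} = R" by (auto simp: cube_def)
  then show ?thesis by (simp add: cube_def length_nths)
qed

lemma agreeing_eq_nths:
  assumes "z \<in> cube d" "R \<subseteq> {..<d}"
  shows "agreeing d R z = {y \<in> cube d. nths y R = nths z R}"
proof -
  have "nths y R = nths z R \<longleftrightarrow> (\<forall>i\<in>R. y ! i = z ! i)" if "y \<in> cube d" for y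
    using that assms by (subst nths_eq_iff) (auto simp: cube_def)
  then show ?thesis by (auto simp: agreeing_def)
qed

lemma card_agreeing_image:
  assumes "R \<subseteq> {..<d}"
  shows "card (agreeing d R ` cube d) \<le> 2 ^ card R"
proof -
  have "agreeing d R ` cube d \<subseteq> (\<lambda>w. {y \<in> cube d. nths y R = w}) ` cube (card R)"
    using agreeing_eq_nths[OF _ assms] nths_in_cube[OF _ assms] by auto
  then have "card (agreeing d R ` cube d) \<le> card (cube (card R))"
    using finite_cube surj_card_le by blast
  then show ?thesis by (simp add: card_cube)
qed

section \<open>Block weights and the failure probability of one block average\<close>

context regression
begin

text \<open>Disjoint blocks let an observation carry weight in at most one of the \<open>N\<close>
  trees; this is the source of the factor \<open>1 / N\<close>. The last claim makes the weights
  functions of the covariates, which permits conditioning on them.\<close>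

lemma block_weight_bounds:
  fixes v :: real and H :: "nat \<Rightarrow> nat set" and N h :: nat and \<tau> :: split_tree
  assumes I: "finite I" and N: "0 < N" and h: "0 < h" and v: "0 < v"
    and H: "disjoint_family_on H {..<N}" "\<And>b. b < N \<Longrightarrow> H b \<subseteq> I"
  defines "U \<equiv> (\<lambda>D b. node_union (undersampled h v D (H b)) \<tau> (cube d))"
  defines "\<omega> \<equiv> (\<lambda>D. block_weight H N (U D) \<tau> D)"
  shows block_weight_nonneg: "0 \<le> \<omega> D x k"
    and block_weight_le: "\<omega> D x k \<le> 1 / N"
    and sum_block_weight: "(\<Sum>k\<in>I. \<omega> D x k) \<le> 1"
    and block_weight_influence:
      "(\<Sum>x\<in>cube d. pmf Dx x * \<omega> D x k) \<le> (v + 4 / h * (1 + max 0 (ln (1 / v)))) / N"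
    and block_weight_cong:
      "(\<And>j. j \<in> I \<Longrightarrow> fst (D j) = fst (D' j)) \<Longrightarrow> \<omega> D = \<omega> D'"
proof -
  let ?w = "v + 4 / h * (1 + max 0 (ln (1 / v)))"
  have fH: "finite (H b)" if "b < N" for b using H(2)[OF that] I finite_subset by auto
  show nonneg: "0 \<le> \<omega> D x k" for D x k
    unfolding \<omega>_def block_weight_def by (intro divide_nonneg_nonneg sum_nonneg mult_nonneg_nonneg cell_weight_nonneg) auto
  have one: "(\<Sum>b<N. of_bool (k \<in> H b) :: real) \<le> 1" for k
  proof (cases "\<exists>b<N. k \<in> H b")
    case True
    then obtain b where b: "b < N" "k \<in> H b" by auto
    have "(\<Sum>b<N. of_bool (k \<in> H b) :: real) = (\<Sum>b'\<in>{b}. of_bool (k \<in> H b'))"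
    proof (rule sum.mono_neutral_right)
      show "\<forall>b'\<in>{..<N} - {b}. of_bool (k \<in> H b') = (0::real)"
        using H(1) b unfolding disjoint_family_on_def by (auto simp: disjoint_iff)
    qed (use b in auto)
    then show ?thesis by (simp del: sum_of_bool_eq)
  next
    case False
    then have "(\<Sum>b<N. of_bool (k \<in> H b) :: real) = 0" by (intro sum.neutral) auto
    then show ?thesis by simp
  qed
  show "\<omega> D x k \<le> 1 / N"
  proof -
    have "(\<Sum>b<N. of_bool (k \<in> H b \<and> x \<notin> U D b) * cell_weight D (H b) \<tau> x k) \<le> (\<Sum>b<N. of_bool (k \<in> H b))"
      using cell_weight_le_1 by (intro sum_mono) auto
    also note one
    finally show ?thesis unfolding \<omega>_def block_weight_def by (intro divide_right_mono) auto
  qed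
  show "(\<Sum>k\<in>I. \<omega> D x k) \<le> 1"
  proof -
    have "(\<Sum>k\<in>I. \<omega> D x k) = (\<Sum>b<N. \<Sum>k\<in>I. of_bool (k \<in> H b \<and> x \<notin> U D b) * cell_weight D (H b) \<tau> x k) / N"
      unfolding \<omega>_def block_weight_def sum_divide_distrib[symmetric] by (subst sum.swap) simp
    also have "\<dots> \<le> (\<Sum>b<N. 1) / N"
    proof (intro divide_right_mono sum_mono)
      fix b assume b: "b \<in> {..<N}"
      have "(\<Sum>k\<in>I. of_bool (k \<in> H b \<and> x \<notin> U D b) * cell_weight D (H b) \<tau> x k)
          \<le> (\<Sum>k\<in>I. of_bool (k \<in> H b) * cell_weight D (H b) \<tau> x k)"
        using cell_weight_nonneg by (intro sum_mono mult_right_mono) auto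
      also have "\<dots> = (\<Sum>k\<in>H b. of_bool (k \<in> H b) * cell_weight D (H b) \<tau> x k)"
        using b H(2) I by (intro sum.mono_neutral_right) auto
      also have "\<dots> \<le> 1" using sum_cell_weight[OF fH] b by simp
      finally show "(\<Sum>k\<in>I. of_bool (k \<in> H b \<and> x \<notin> U D b) * cell_weight D (H b) \<tau> x k) \<le> 1" .
    qed simp
    finally show ?thesis using N by simp
  qed
  show "(\<Sum>x\<in>cube d. pmf Dx x * \<omega> D x k) \<le> ?w / N"
  proof -
    have w0: "0 \<le> ?w" using v h by (auto intro!: add_nonneg_nonneg mult_nonneg_nonneg)
    have cell: "(\<Sum>x\<in>cube d. pmf Dx x * (of_bool (x \<notin> U D b) * cell_weight D (H b) \<tau> x k)) \<le> ?w"
      if b: "b < N" "k \<in> H b" for b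
    proof (cases "idx_in D (H b) (cube d) = {}")
      \<comment> \<open>Without points in the block the weights are quotients by 0, hence 0.\<close>
      case True
      have "card (idx_in D (H b) (resolved_cell D (H b) \<tau> (cube d) x)) = 0" for x
        using True idx_in_mono[OF resolved_cell_subset, of D "H b" D "H b" \<tau> "cube d" x] by simp
      then have "cell_weight D (H b) \<tau> x k = 0" for x by (simp add: cell_weight_def)
      then show ?thesis using w0 by simp
    next
      case False
      have "(\<Sum>x\<in>cube d. pmf Dx x * (of_bool (x \<notin> U D b) * cell_weight D (H b) \<tau> x k))
          = (\<Sum>x\<in>cube d - U D b. pmf Dx x * cell_weight D (H b) \<tau> x k)"
        using finite_cube by (intro sum.mono_neutral_cong_right) auto
      also have "\<dots> = influence Dx D (H b) (U D b) \<tau> (cube d) k"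
        unfolding influence_def cell_weight_def ..
      also have "\<dots> \<le> v + 4 / h * (1 + max 0 (ln (\<mu> (cube d) / v)))"
        unfolding U_def undersampled_def
        by (rule influence_le) (use v h fH[OF b(1)] finite_cube b(2) False in auto)
      also have "\<mu> (cube d) = 1"
        using measure_pmf.prob_space[of Dx] set_pmf_Dx measure_Int_set_pmf[of Dx UNIV] by simp
      finally show ?thesis by simp
    qed
    have "(\<Sum>x\<in>cube d. pmf Dx x * \<omega> D x k)
        = (\<Sum>b<N. \<Sum>x\<in>cube d. pmf Dx x * (of_bool (k \<in> H b \<and> x \<notin> U D b) * cell_weight D (H b) \<tau> x k)) / N"
      unfolding \<omega>_def block_weight_def by (subst sum.swap) (simp only: sum_divide_distrib sum_distrib_left times_divide_eq_right)
    also have "\<dots> \<le> (\<Sum>b<N. of_bool (k \<in> H b) * ?w) / N"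
    proof (intro divide_right_mono sum_mono)
      fix b assume "b \<in> {..<N}"
      then show "(\<Sum>x\<in>cube d. pmf Dx x * (of_bool (k \<in> H b \<and> x \<notin> U D b) * cell_weight D (H b) \<tau> x k))
          \<le> of_bool (k \<in> H b) * ?w"
        using cell[of b] by (cases "k \<in> H b") auto
    qed simp
    also have "\<dots> \<le> 1 * ?w / N"
      unfolding sum_distrib_right[symmetric] using one w0 by (intro divide_right_mono mult_right_mono) auto
    finally show ?thesis by simp
  qed
  show "\<omega> D = \<omega> D'" if agree: "\<And>j. j \<in> I \<Longrightarrow> fst (D j) = fst (D' j)"
  proof (intro ext)
    fix x k
    have eq: "fst (D j) = fst (D' j)" if "b < N" "j \<in> H b" for b j using agree H(2) that by blast
    have U: "U D b = U D' b" if "b < N" for b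
      unfolding U_def undersampled_def using idx_in_cong[of "H b" D D'] eq[OF that] by simp
    have "of_bool (k \<in> H b \<and> x \<notin> U D b) * cell_weight D (H b) \<tau> x k
        = of_bool (k \<in> H b \<and> x \<notin> U D' b) * cell_weight D' (H b) \<tau> x k" if "b < N" for b
      using U[OF that] cell_weight_cong[of "H b" D D' k \<tau> x] eq[OF that] by (cases "k \<in> H b") auto
    then show "\<omega> D x k = \<omega> D' x k" unfolding \<omega>_def block_weight_def by simp
  qed
qed

lemma sum_pmf_cube: "(\<Sum>x\<in>cube d. pmf Dx x) = 1"
  using finite_cube set_pmf_Dx by (intro sum_pmf_eq_1) auto

text \<open>Three causes of failure: a block misses a cell of the relevant coordinates
  (\<open>B1\<close>), the undersampled mass of one level in \<open>L\<close>, summed over the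
  blocks, exceeds 1 (\<open>B2\<close>), or the quadratic form is too large (\<open>B3\<close>). The
  levels cover all masses from \<open>v\<close> to 1 up to a factor 2, so outside \<open>B2\<close>
  the exceptional mass is at most \<open>card L\<close>.\<close>

lemma outer_le_block_error:
  fixes v \<zeta>' :: real and L :: "real set"
  assumes R: "sparse_with d m r R" "splits_first R \<tau> {}"
    and I: "finite I" "card I \<le> 2 * N * h" and N: "0 < N" and h: "0 < h" and v: "0 < v"
    and H: "disjoint_family_on H {..<N}" "\<And>b. b < N \<Longrightarrow> H b \<subseteq> I" "\<And>b. b < N \<Longrightarrow> card (H b) = h"
    and lower: "\<And>z. z \<in> cube d \<Longrightarrow> \<zeta>' \<le> \<mu> (agreeing d R z)"
    and L: "finite L" "\<And>a. a \<in> L \<Longrightarrow> 0 < a" "\<And>u. v \<le> u \<Longrightarrow> u \<le> 1 \<Longrightarrow> \<exists>a\<in>L. a \<le> u \<and> u < 2 * a"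
      "\<And>a. a \<in> L \<Longrightarrow> N * exp (- (h * a / 16)) \<le> a"
  defines "w \<equiv> v + 4 / h * (1 + max 0 (ln (1 / v)))"
  shows "outer_le (PiM I (\<lambda>_. Z))
    {D. regular I D \<and> 4 * real h * w / real N + real (card L) / (2 * real N) < block_mse H N \<tau> D}
    (real N * 2 ^ r * exp (- (real h * \<zeta>')) + real (card L) * exp (1 - real h / 32) + exp (- (2 * real h / 3)))"
proof -
  let ?M = "PiM I (\<lambda>_. Z)"
  have Rd: "R \<subseteq> {..<d}" "card R = r" using R(1) by (auto simp: sparse_with_def)
  have fH: "finite (H b)" if "b < N" for b using H(2)[OF that] I finite_subset by auto
  define U where "U = (\<lambda>D b. node_union (undersampled h v D (H b)) \<tau> (cube d))"
  define \<omega> where "\<omega> = (\<lambda>D. block_weight H N (U D) \<tau> D)"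
  note bw = I(1) N h v H(1,2)
  have \<omega>: "0 \<le> \<omega> D x k" "\<omega> D x k \<le> 1 / N" "(\<Sum>k\<in>I. \<omega> D x k) \<le> 1"
    "(\<Sum>x\<in>cube d. pmf Dx x * \<omega> D x k) \<le> w / N" for D x k
    unfolding \<omega>_def U_def w_def
    using block_weight_nonneg[OF bw] block_weight_le[OF bw] sum_block_weight[OF bw] block_weight_influence[OF bw]
    by simp_all
  have \<omega>_cong: "\<omega> D = \<omega> D'" if "\<And>j. j \<in> I \<Longrightarrow> fst (D j) = fst (D' j)" for D D'
    unfolding \<omega>_def U_def by (rule block_weight_cong[OF bw]) (assumption, rule that)
  define W where "W D k l = (\<Sum>x\<in>cube d. pmf Dx x * \<omega> D x k * \<omega> D x l)" for D k l
  have w: "0 < w" using v h by (auto simp: w_def intro!: add_pos_nonneg mult_nonneg_nonneg)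
  define B1 where "B1 = (\<Union>(b, A)\<in>{..<N} \<times> agreeing d R ` cube d. {D. idx_in D (H b) A = {}})"
  define B2 where "B2 = (\<Union>a\<in>L. {D. 1 < (\<Sum>b<N. \<Sum>C\<in>skeleton Dx a \<tau> (cube d). 2 * \<mu> C *
      of_bool (real (card (idx_in D (H b) C)) < real h * \<mu> C / 2))})"
  define B3 where "B3 = {D. regular I D \<and>
      2 * h * w / N < (\<Sum>k\<in>I. \<Sum>l\<in>I. W D k l * noise (D k) * noise (D l))}"
  have B1: "outer_le ?M B1 (N * 2 ^ r * exp (- (h * \<zeta>')))"
  proof (rule outer_le_mono)
    show "outer_le ?M B1 (\<Sum>(b, A)\<in>{..<N} \<times> agreeing d R ` cube d. exp (- (h * \<zeta>')))"
      unfolding B1_def split_beta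
    proof (intro outer_le_UN)
      fix bA assume "bA \<in> {..<N} \<times> agreeing d R ` cube d"
      then obtain b z where bA: "bA = (b, agreeing d R z)" "b < N" "z \<in> cube d" by auto
      show "outer_le ?M {D. idx_in D (H (fst bA)) (snd bA) = {}} (exp (- (h * \<zeta>')))"
      proof (rule outer_le_mono[OF outer_le_no_hit[OF I(1), of "H b" "agreeing d R z"]])
        show "exp (- (real (card (H b)) * \<mu> (agreeing d R z))) \<le> exp (- (h * \<zeta>'))"
          using H(3)[OF bA(2)] lower[OF bA(3)] by (simp add: mult_left_mono)
      qed (use bA H(2) in auto)
    qed (use finite_cube in auto)
    have "(\<Sum>(b, A)\<in>{..<N} \<times> agreeing d R ` cube d. exp (- (h * \<zeta>')))
        = N * card (agreeing d R ` cube d) * exp (- (h * \<zeta>'))"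
      by (simp add: split_beta card_cartesian_product)
    also have "\<dots> \<le> N * 2 ^ r * exp (- (h * \<zeta>'))"
      using card_agreeing_image[OF Rd(1)] Rd(2) by (intro mult_right_mono of_nat_mono mult_left_mono) auto
    finally show "(\<Sum>(b, A)\<in>{..<N} \<times> agreeing d R ` cube d. exp (- (h * \<zeta>'))) \<le> N * 2 ^ r * exp (- (h * \<zeta>'))" .
  qed simp
  have B2: "outer_le ?M B2 (card L * exp (1 - h / 32))"
  proof -
    have "outer_le ?M B2 (\<Sum>a\<in>L. exp (1 - h / 32))"
      unfolding B2_def
    proof (intro outer_le_UN L(1))
      fix a assume a: "a \<in> L"
      let ?S = "skeleton Dx a \<tau> (cube d)"
      have "(\<Prod>C\<in>?S. 1 + exp (- (real h * \<mu> C / 16))) \<le> exp (1 / N)"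
      proof -
        have "(\<Prod>C\<in>?S. 1 + exp (- (real h * \<mu> C / 16))) \<le> (\<Prod>C\<in>?S. exp (exp (- (h * a / 16))))"
        proof (intro prod_mono conjI)
          fix C assume "C \<in> ?S"
          then have "a \<le> \<mu> C" using skeleton_members by blast
          then have "1 + exp (- (real h * \<mu> C / 16)) \<le> 1 + exp (- (h * a / 16))"
            using h by (simp add: divide_right_mono mult_left_mono)
          also have "\<dots> \<le> exp (exp (- (h * a / 16)))" by (rule exp_ge_add_one_self)
          finally show "1 + exp (- (real h * \<mu> C / 16)) \<le> exp (exp (- (h * a / 16)))" .
        qed (simp add: add_nonneg_nonneg)
        also have "\<dots> = exp (card ?S * exp (- (h * a / 16)))" by (simp add: exp_of_nat_mult)
        \<comment> \<open>There are at most \<open>1 / a\<close> skeleton cells and each contributes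
          at most \<open>a / N\<close> to the exponent. The \<open>N\<close> blocks together then
          cost only a factor \<open>exp 1\<close>.\<close>
        also have "\<dots> \<le> exp (1 / N)"
        proof -
          have "a * card ?S \<le> 1" using card_skeleton[OF L(2)[OF a], of Dx \<tau> "cube d"]
            measure_pmf.prob_le_1[of Dx "cube d"] by (rule order_trans)
          then have "card ?S * (N * exp (- (h * a / 16))) \<le> 1"
            using mult_left_mono[OF L(4)[OF a], of "card ?S"] by (simp add: mult.commute)
          then show ?thesis using N by (simp add: field_simps)
        qed
        finally show ?thesis .
      qed
      then have "(\<Prod>C\<in>?S. 1 + exp (- (real h * \<mu> C / 16))) ^ N \<le> exp (1 / N) ^ N"
        by (intro power_mono prod_nonneg) (auto simp: add_nonneg_nonneg)
      also have "\<dots> = exp 1" using N by (simp add: exp_of_nat_mult[symmetric])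
      finally have "exp (- (real h / 32)) * (\<Prod>C\<in>?S. 1 + exp (- (real h * \<mu> C / 16))) ^ N \<le> exp (- (real h / 32)) * exp 1"
        by (intro mult_left_mono) auto
      also have "\<dots> = exp (1 - h / 32)" by (simp add: exp_add[symmetric])
      finally have le: "exp (- (real h / 32)) * (\<Prod>C\<in>?S. 1 + exp (- (real h * \<mu> C / 16))) ^ N \<le> exp (1 - h / 32)" .
      show "outer_le ?M {D. 1 < (\<Sum>b<N. \<Sum>C\<in>?S. 2 * \<mu> C *
          of_bool (real (card (idx_in D (H b) C)) < real h * \<mu> C / 2))} (exp (1 - h / 32))"
        by (rule outer_le_mono[OF outer_le_undersampled[OF I(1) H finite_skeleton skeleton_disjoint] Int_lower1 le])
    qed simp
    then show ?thesis by simp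
  qed
  have B3: "outer_le ?M B3 (exp (- (2 * h / 3)))"
  proof -
    \<comment> \<open>The largest value allowed for row sums \<open>\<rho> = w / N\<close>. With
      entries at most \<open>w / N\<^sup>2\<close> and at most \<open>2 * N * h\<close> variables,
      the exponent is at most \<open>2 * h / 3 - 4 * h / 3\<close>.\<close>
    define \<kappa> where "\<kappa> = 2 * N / (3 * w)"
    have q: "outer_le ?M B3 (exp (\<kappa> * (w / N\<^sup>2) / 2 * real (card I) - \<kappa> * (2 * h * w / N)))"
      unfolding B3_def
    proof (rule outer_le_quadratic_form[OF I(1), where \<rho> = "w / N"])
      show "W D = W D'" if "\<And>j. j \<in> I \<Longrightarrow> fst (D j) = fst (D' j)" for D D'
        using \<omega>_cong[OF that] by (simp add: W_def fun_eq_iff)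
      show "W D k l = W D l k" for D k l unfolding W_def by (simp add: mult_ac)
      show "0 \<le> W D k l" for D k l unfolding W_def using \<omega>(1) by (intro sum_nonneg mult_nonneg_nonneg) auto
      show "(\<Sum>l\<in>I. W D k l) \<le> w / N" if "k \<in> I" for D k
      proof -
        \<comment> \<open>The weights at each \<open>x\<close> sum to at most 1, so a row sum is
          bounded by the integrated weight of \<open>k\<close> alone.\<close>
        have "(\<Sum>l\<in>I. W D k l) = (\<Sum>x\<in>cube d. pmf Dx x * \<omega> D x k * (\<Sum>l\<in>I. \<omega> D x l))"
          unfolding W_def by (subst sum.swap) (simp add: sum_distrib_left)
        also have "\<dots> \<le> (\<Sum>x\<in>cube d. pmf Dx x * \<omega> D x k * 1)"
          using \<omega>(1,3) by (intro sum_mono mult_left_mono mult_nonneg_nonneg) auto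
        finally show ?thesis using \<omega>(4)[of D k] by simp
      qed
      show "W D k l \<le> w / N\<^sup>2" for D k l
      proof -
        have "W D k l \<le> (\<Sum>x\<in>cube d. pmf Dx x * \<omega> D x k * (1 / N))"
          unfolding W_def using \<omega>(1,2) by (intro sum_mono mult_left_mono mult_nonneg_nonneg) auto
        also have "\<dots> = (\<Sum>x\<in>cube d. pmf Dx x * \<omega> D x k) * (1 / N)" by (rule sum_distrib_right[symmetric])
        also have "\<dots> \<le> w / N * (1 / N)" using \<omega>(4) by (intro mult_right_mono) auto
        finally show ?thesis by (simp add: power2_eq_square)
      qed
    qed (use w N in \<open>auto simp: \<kappa>_def\<close>)
    have "\<kappa> * (w / N\<^sup>2) / 2 * real (card I) - \<kappa> * (2 * h * w / N) \<le> - (2 * h / 3)"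
    proof -
      have "\<kappa> * (w / N\<^sup>2) / 2 = 1 / (3 * N)" "\<kappa> * (2 * h * w / N) = 4 * h / 3"
        using w N by (simp_all add: \<kappa>_def power2_eq_square)
      moreover have "1 / (3 * N) * real (card I) \<le> 1 / (3 * N) * real (2 * N * h)"
        using I(2) by (intro mult_left_mono of_nat_mono) auto
      moreover have "1 / (3 * N) * real (2 * N * h) = 2 * h / 3" using N by simp
      ultimately show ?thesis by simp
    qed
    then have "exp (\<kappa> * (w / N\<^sup>2) / 2 * real (card I) - \<kappa> * (2 * h * w / N)) \<le> exp (- (2 * h / 3))"
      by simp
    then show ?thesis by (rule outer_le_mono[OF q Int_lower1])
  qed
  have incl: "D \<in> B1 \<union> B2 \<union> B3"
    if D: "regular I D" and err: "4 * h * w / N + card L / (2 * N) < block_mse H N \<tau> D" for D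
  proof (rule ccontr)
    assume not: "D \<notin> B1 \<union> B2 \<union> B3"
    have hit: "idx_in D (H b) (agreeing d R z) \<noteq> {}" if "b < N" "z \<in> cube d" for b z
      using not that by (auto simp: B1_def)
    have "(\<Sum>b<N. \<mu> (U D b)) \<le> card L"
    proof -
      let ?P = "\<lambda>b a C. a \<le> \<mu> C \<and> \<mu> C < 2 * a \<and> real (card (idx_in D (H b) C)) < real h * \<mu> C / 4"
      let ?f = "\<lambda>b a. \<Sum>C\<in>skeleton Dx a \<tau> (cube d). 2 * \<mu> C *
          of_bool (real (card (idx_in D (H b) C)) < real h * \<mu> C / 2)"
      have "\<mu> (U D b) \<le> (\<Sum>a\<in>L. ?f b a)" if "b < N" for b
      proof -
        have "U D b \<subseteq> (\<Union>a\<in>L. node_union (?P b a) \<tau> (cube d))"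
          unfolding U_def
        proof (rule node_union_cover)
          show "\<exists>a\<in>L. ?P b a C" if "undersampled h v D (H b) C" for C
            using that L(3)[of "\<mu> C"] by (auto simp: undersampled_def)
        qed
        then have "\<mu> (U D b) \<le> \<mu> (\<Union>a\<in>L. node_union (?P b a) \<tau> (cube d))"
          by (intro measure_pmf.finite_measure_mono) auto
        also have "\<dots> \<le> (\<Sum>a\<in>L. \<mu> (node_union (?P b a) \<tau> (cube d)))"
          using L(1) by (intro measure_UNION_le) auto
        also have "\<dots> \<le> (\<Sum>a\<in>L. ?f b a)"
          using L(2) fH[OF that] by (intro sum_mono prob_undersampled_le_skeleton) auto
        finally show ?thesis .
      qed
      then have "(\<Sum>b<N. \<mu> (U D b)) \<le> (\<Sum>b<N. \<Sum>a\<in>L. ?f b a)" by (intro sum_mono) auto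
      also have "\<dots> = (\<Sum>a\<in>L. \<Sum>b<N. ?f b a)" by (rule sum.swap)
      also have "\<dots> \<le> (\<Sum>a\<in>L. 1)"
        using not by (intro sum_mono) (auto simp: B2_def not_less)
      finally show ?thesis by simp
    qed
    then have "(\<Sum>b<N. \<mu> (U D b)) / (2 * N) \<le> card L / (2 * N)" by (intro divide_right_mono) auto
    moreover have "(\<Sum>k\<in>I. \<Sum>l\<in>I. W D k l * noise (D k) * noise (D l)) \<le> 2 * h * w / N"
      using not D by (auto simp: B3_def not_less)
    moreover have "block_mse H N \<tau> D \<le> 2 * (\<Sum>k\<in>I. \<Sum>l\<in>I. W D k l * noise (D k) * noise (D l)) + (\<Sum>b<N. \<mu> (U D b)) / (2 * N)"
      unfolding W_def \<omega>_def by (rule block_error_le[OF R I(1) N H(2) D hit])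
    ultimately show False using err by simp
  qed
  show ?thesis
    by (rule outer_le_mono[OF outer_le_Un[OF outer_le_Un[OF B1 B2] B3]])
       (use incl in auto)
qed

end

section \<open>Concentration of the split criterion\<close>

text \<open>For \<open>y = - t < 0\<close> the claim amounts to
  \<open>1 \<le> (1 - t + t\<^sup>2) * exp t\<close>. Replacing \<open>exp t\<close> by its
  quadratic Taylor polynomial leaves 1 plus nonnegative terms.\<close>

lemma exp_le_quadratic:
  fixes y :: real
  assumes "\<bar>y\<bar> \<le> 1"
  shows "exp y \<le> 1 + y + y\<^sup>2"
proof (cases "0 \<le> y")
  case True
  then show ?thesis using exp_bound[of y] assms by simp
next
  case False
  define t where "t = - y"
  have t: "0 \<le> t" using False by (simp add: t_def)
  have "1 \<le> (1 - t + t\<^sup>2) * (1 + t + t\<^sup>2 / 2)"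
  proof -
    have "(1 - t + t\<^sup>2) * (1 + t + t\<^sup>2 / 2) = 1 + t\<^sup>2 / 2 + t ^ 3 / 2 + t ^ 4 / 2"
      by (simp add: field_simps power2_eq_square power3_eq_cube power4_eq_xxxx)
    then show ?thesis using t by simp
  qed
  also have "\<dots> \<le> (1 - t + t\<^sup>2) * exp t"
  proof (intro mult_left_mono exp_lower_Taylor_quadratic t)
    have "0 \<le> (1 - t / 2)\<^sup>2 + 3 / 4 * t\<^sup>2" by simp
    then show "0 \<le> 1 - t + t\<^sup>2" by (simp add: power2_eq_square algebra_simps)
  qed
  finally show ?thesis by (simp add: t_def exp_minus field_simps)
qed

text \<open>The map \<open>(S, N) \<mapsto> S\<^sup>2 / N\<close> is Lipschitz where \<open>\<bar>S\<bar> \<le> N\<close>, since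
  \<open>S\<^sup>2 / N = sup {2 * a * S - a\<^sup>2 * N | a. \<bar>a\<bar> \<le> 1}\<close>; hence no lower bound on \<open>N\<close> is needed.\<close>

lemma square_quotient_diff_le:
  fixes S N M P :: real
  assumes "\<bar>S\<bar> \<le> N" "\<bar>M\<bar> \<le> P"
  shows "S\<^sup>2 / N - M\<^sup>2 / P \<le> 2 * \<bar>S - M\<bar> + \<bar>N - P\<bar>"
proof -
  \<comment> \<open>The maximizer for \<open>(S, N)\<close>; inserted into the supremum for
    \<open>(M, P)\<close> it gives a lower bound.\<close>
  define a where "a = S / N"
  have a: "\<bar>a\<bar> \<le> 1" using assms(1) unfolding a_def by (cases "N = 0") (auto simp: abs_divide divide_le_eq)
  have "S\<^sup>2 / N = 2 * a * S - a\<^sup>2 * N" unfolding a_def using assms(1) by (cases "N = 0") (auto simp: power2_eq_square field_simps)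
  moreover have "2 * a * M - a\<^sup>2 * P \<le> M\<^sup>2 / P"
  proof (cases "P = 0")
    case False
    then have P: "0 < P" using assms(2) by linarith
    have "0 \<le> (M - a * P)\<^sup>2 / P" using P by simp
    also have "(M - a * P)\<^sup>2 / P = M\<^sup>2 / P - 2 * a * M + a\<^sup>2 * P"
      using P by (simp add: power2_eq_square field_simps)
    finally show ?thesis by simp
  qed (use assms(2) in auto)
  ultimately have "S\<^sup>2 / N - M\<^sup>2 / P \<le> 2 * a * (S - M) - a\<^sup>2 * (N - P)" by (simp add: algebra_simps)
  also have "\<dots> \<le> 2 * \<bar>S - M\<bar> + \<bar>N - P\<bar>"
  proof -
    have "a * (S - M) \<le> \<bar>S - M\<bar>" using a mult_right_mono[of "\<bar>a\<bar>" 1 "\<bar>S - M\<bar>"] abs_ge_self[of "a * (S - M)"] by (simp add: abs_mult)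
    moreover have "- (a\<^sup>2 * (N - P)) \<le> \<bar>N - P\<bar>"
    proof -
      have "a\<^sup>2 \<le> 1" using a by (simp add: abs_square_le_1)
      then show ?thesis using mult_right_mono[of "a\<^sup>2" 1 "\<bar>N - P\<bar>"] abs_ge_minus_self[of "a\<^sup>2 * (N - P)"] by (simp add: abs_mult)
    qed
    ultimately have "2 * (a * (S - M)) + - (a\<^sup>2 * (N - P)) \<le> 2 * \<bar>S - M\<bar> + \<bar>N - P\<bar>"
      by (intro add_mono mult_left_mono) auto
    then show ?thesis by (simp add: mult.assoc)
  qed
  finally show ?thesis .
qed

lemma half_agreeing_update:
  assumes "i < d" "i \<notin> F" "z \<in> cube d"
  shows "half (agreeing d F z) i b = agreeing d (insert i F) (z[i := b])"
  using assms unfolding half_def agreeing_def cube_def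
  by (auto simp: nth_list_update)

lemma update_in_cube: "z \<in> cube d \<Longrightarrow> z[i := b] \<in> cube d"
  by (simp add: cube_def)

lemma mem_agreeing: "z \<in> cube d \<Longrightarrow> z \<in> agreeing d F z"
  by (simp add: agreeing_def)

lemma agreeing_subset_cube: "agreeing d F z \<subseteq> cube d"
  by (auto simp: agreeing_def)

lemma agreeing_antimono: "F \<subseteq> F' \<Longrightarrow> agreeing d F' z \<subseteq> agreeing d F z"
  by (auto simp: agreeing_def)

lemma agreeing_in_cells: "F \<subseteq> {..<d} \<Longrightarrow> agreeing d F z \<in> cells d"
  unfolding cells_def agreeing_def by (intro CollectI exI[of _ F] exI[of _ "\<lambda>i. z ! i"]) auto

lemma fixed_in_agreeing:
  assumes "i < d" "z \<in> cube d"
  shows "fixed_in (agreeing d F z) i \<longleftrightarrow> i \<in> F"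
proof
  assume "fixed_in (agreeing d F z) i"
  then obtain k where k: "\<And>x. x \<in> agreeing d F z \<Longrightarrow> x ! i = k" by (auto simp: fixed_in_def)
  show "i \<in> F"
  proof (rule ccontr)
    assume "i \<notin> F"
    then have "z[i := b] \<in> agreeing d F z" for b
      using assms by (auto simp: agreeing_def cube_def nth_list_update)
    from k[OF this[of "\<not> k"]] show False using assms by (simp add: cube_def)
  qed
qed (auto simp: fixed_in_def agreeing_def)

section \<open>From the gap in the population criterion to the splits chosen on the sample\<close>

context regression
begin

text \<open>Left unnormalized so that it is the expectation behind a plain sum of responses; no
  quotient has to be estimated before the criterion itself.\<close>

definition mass_mean :: "cell \<Rightarrow> real" where
  "mass_mean C = (\<Sum>x\<in>C. pmf Dx x * m x)"

lemma prob_eq_sum: "C \<subseteq> cube d \<Longrightarrow> \<mu> C = (\<Sum>x\<in>C. pmf Dx x)"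
  using finite_cube finite_subset by (subst measure_measure_pmf_finite) auto

lemma prob_pos: "x \<in> C \<Longrightarrow> C \<subseteq> cube d \<Longrightarrow> 0 < \<mu> C"
  using set_pmf_Dx by (auto simp: measure_pmf_posI)

lemma abs_mass_mean_le: 
  assumes "C \<subseteq> cube d"
  shows "\<bar>mass_mean C\<bar> \<le> \<mu> C"
proof -
  have "\<bar>mass_mean C\<bar> \<le> (\<Sum>x\<in>C. \<bar>pmf Dx x * m x\<bar>)" unfolding mass_mean_def by (rule sum_abs)
  also have "\<dots> \<le> (\<Sum>x\<in>C. pmf Dx x * 1)"
    using m_bound assms by (intro sum_mono) (force simp: abs_mult intro!: mult_left_le)
  finally show ?thesis using prob_eq_sum[OF assms] by simp
qed

lemma expectation_cond:
  assumes "x \<in> C" "C \<subseteq> cube d"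
  shows "measure_pmf.expectation (cond_pmf Dx C) f = (\<Sum>x\<in>C. pmf Dx x * f x) / \<mu> C"
proof -
  have ne: "set_pmf Dx \<inter> C \<noteq> {}" using assms set_pmf_Dx by auto
  have "measure_pmf.expectation (cond_pmf Dx C) f = (\<Sum>x\<in>C. f x * pmf (cond_pmf Dx C) x)"
    using finite_subset[OF assms(2) finite_cube] set_cond_pmf[OF ne]
    by (intro integral_measure_pmf_real) auto
  also have "\<dots> = (\<Sum>x\<in>C. pmf Dx x * f x / \<mu> C)"
    by (intro sum.cong refl) (simp add: pmf_cond[OF ne])
  finally show ?thesis by (simp add: sum_divide_distrib)
qed

text \<open>Multiplication by the mass of \<open>A\<close> brings the population criterion into the
  form of squared sums over masses, which \<open>Vsplit_scaled\<close> gives for the sample.\<close>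

lemma Vbar_single:
  assumes "F \<subseteq> {..<d}" "i < d" "i \<notin> F" "z \<in> cube d"
  defines "A \<equiv> agreeing d F z"
  shows "Vbar Dx m A {i} * \<mu> A = (\<Sum>b\<in>{False, True}. (mass_mean (half A i b))\<^sup>2 / \<mu> (half A i b))"
proof -
  have A: "A \<subseteq> cube d" "z \<in> A" using assms(4) by (auto simp: A_def agreeing_subset_cube mem_agreeing)
  have half: "half A i b \<subseteq> cube d" "z[i := b] \<in> half A i b" for b
    using half_subset[of A i b] A(1) mem_agreeing[OF update_in_cube[OF assms(4)]]
    by (auto simp: A_def half_agreeing_update[OF assms(2,3,4)])
  have fin: "finite (half A i b)" for b using finite_subset[OF half(1) finite_cube] .
  have cond: "{y \<in> A. nths y {i} = nths x {i}} = half A i (x ! i)" if "x \<in> A" for x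
  proof -
    have "nths y {i} = nths x {i} \<longleftrightarrow> y ! i = x ! i" if "y \<in> A" for y
      using \<open>x \<in> A\<close> that A(1) assms(2) by (subst nths_eq_iff) (auto simp: cube_def subset_iff)
    then show ?thesis by (auto simp: half_def)
  qed
  let ?f = "\<lambda>b. (mass_mean (half A i b) / \<mu> (half A i b))\<^sup>2"
  have "Vbar Dx m A {i} = (\<Sum>x\<in>A. pmf Dx x * (measure_pmf.expectation (cond_pmf Dx {y \<in> A. nths y {i} = nths x {i}}) m)\<^sup>2) / \<mu> A"
    unfolding Vbar_def by (rule expectation_cond[OF A(2,1)])
  also have "(\<Sum>x\<in>A. pmf Dx x * (measure_pmf.expectation (cond_pmf Dx {y \<in> A. nths y {i} = nths x {i}}) m)\<^sup>2)
      = (\<Sum>x\<in>A. pmf Dx x * ?f (x ! i))"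
    by (intro sum.cong refl) (simp add: cond expectation_cond[OF half(2,1)] mass_mean_def)
  also have "\<dots> = (\<Sum>x\<in>half A i False. pmf Dx x * ?f (x ! i)) + (\<Sum>x\<in>half A i True. pmf Dx x * ?f (x ! i))"
    using sum.union_disjoint[OF fin fin half_disjoint, of "\<lambda>x. pmf Dx x * ?f (x ! i)"] by (simp add: half_Un)
  also have "\<dots> = (\<Sum>b\<in>{False, True}. (mass_mean (half A i b))\<^sup>2 / \<mu> (half A i b))"
  proof -
    have "(\<Sum>x\<in>half A i b. pmf Dx x * ?f (x ! i)) = (mass_mean (half A i b))\<^sup>2 / \<mu> (half A i b)" for b
    proof -
    have "(\<Sum>x\<in>half A i b. pmf Dx x * ?f (x ! i)) = (\<Sum>x\<in>half A i b. pmf Dx x * ?f b)"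
      by (intro sum.cong refl) (simp add: half_def)
    also have "\<dots> = \<mu> (half A i b) * ?f b" unfolding prob_eq_sum[OF half(1)] by (rule sum_distrib_right[symmetric])
      finally show ?thesis using prob_pos[OF half(2,1), of b] by (simp add: power2_eq_square field_simps)
    qed
    then show ?thesis by simp
  qed
  finally show ?thesis using prob_pos[OF A(2,1)] by simp
qed

definition close_sample :: "dataset \<Rightarrow> nat set \<Rightarrow> real \<Rightarrow> cell \<Rightarrow> bool" where
  "close_sample D J \<delta> C \<longleftrightarrow>
     \<bar>(\<Sum>j\<in>idx_in D J C. snd (D j)) - card J * mass_mean C\<bar> \<le> \<delta> \<and>
     \<bar>card (idx_in D J C) - card J * \<mu> C\<bar> \<le> \<delta>"

lemma Vsplit_scaled:
  assumes "finite J"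
  shows "card (idx_in D J A) * Vsplit D J A i
    = (\<Sum>b\<in>{False, True}. (\<Sum>j\<in>idx_in D J (half A i b). snd (D j))\<^sup>2 / card (idx_in D J (half A i b)))"
proof (cases "card (idx_in D J A) = 0")
  case True
  have "finite (idx_in D J A)" using assms by (simp add: idx_in_def)
  with True have "idx_in D J A = {}" by simp
  then have "idx_in D J (half A i b) = {}" for b using idx_in_mono[OF half_subset[of A i b], of D J] by auto
  then show ?thesis using True by simp
next
  case False
  then show ?thesis
    unfolding Vsplit_def cell_mean_def sum_distrib_left
    by (intro sum.cong refl) (simp add: power2_eq_square)
qed

text \<open>With tolerance \<open>card J * \<mu> A * (\<beta> / 13)\<close>, each scaled criterion
  moves by at most 3 tolerances per half, hence 6 in all. The two criteria together move by at most
  12, while the gap is worth 13: this is the origin of the constant.\<close>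

lemma Vsplit_less:
  assumes J: "finite J" "\<And>j. j \<in> J \<Longrightarrow> \<bar>snd (D j)\<bar> \<le> 1" "0 < card J"
    and F: "F \<subseteq> {..<d}" "z \<in> cube d"
  defines "A \<equiv> agreeing d F z"
  assumes ij: "i < d" "i \<notin> F" "j < d" "j \<notin> F"
    and gap: "Vbar Dx m A {j} + \<beta> \<le> Vbar Dx m A {i}" and \<beta>: "0 < \<beta>"
    and close: "\<And>k b. k \<in> {i, j} \<Longrightarrow> close_sample D J (card J * \<mu> A * (\<beta> / 13)) (half A k b)"
  shows "Vsplit D J A j < Vsplit D J A i"
proof -
  let ?n = "real (card J)"
  let ?\<delta> = "?n * \<mu> A * (\<beta> / 13)"
  let ?S = "\<lambda>C. \<Sum>j\<in>idx_in D J C. snd (D j)"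
  let ?N = "\<lambda>C. real (card (idx_in D J C))"
  have A: "A \<subseteq> cube d" "z \<in> A" using F by (auto simp: A_def agreeing_subset_cube mem_agreeing)
  have pos: "0 < \<mu> A" by (rule prob_pos[OF A(2,1)])
  have SN: "\<bar>?S C\<bar> \<le> ?N C" for C
  proof -
    have "\<bar>?S C\<bar> \<le> (\<Sum>j\<in>idx_in D J C. \<bar>snd (D j)\<bar>)" by (rule sum_abs)
    also have "\<dots> \<le> (\<Sum>j\<in>idx_in D J C. 1)" using J(2) by (intro sum_mono) (auto simp: idx_in_def)
    finally show ?thesis by simp
  qed
  have MP: "\<bar>?n * mass_mean C\<bar> \<le> ?n * \<mu> C" if "C \<subseteq> cube d" for C
    using abs_mass_mean_le[OF that] by (simp add: abs_mult mult_left_mono)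
  have half: "half A k b \<subseteq> cube d" for k b using half_subset A(1) by blast
  have scale: "(?n * mass_mean C)\<^sup>2 / (?n * \<mu> C) = ?n * ((mass_mean C)\<^sup>2 / \<mu> C)" for C
    using J(3) by (simp add: power2_eq_square)
  have V: "?n * (Vbar Dx m A {k} * \<mu> A) = (\<Sum>b\<in>{False, True}. (?n * mass_mean (half A k b))\<^sup>2 / (?n * \<mu> (half A k b)))"
    if "k < d" "k \<notin> F" for k
    using Vbar_single[OF F(1) that F(2)] unfolding scale A_def by (simp add: distrib_left)
  have near: "2 * \<bar>?S (half A k b) - ?n * mass_mean (half A k b)\<bar> + \<bar>?N (half A k b) - ?n * \<mu> (half A k b)\<bar> \<le> 3 * ?\<delta>"
    if "k \<in> {i, j}" for k b
  proof -
    from close[OF that, of b] have "2 * \<bar>?S (half A k b) - ?n * mass_mean (half A k b)\<bar> + \<bar>?N (half A k b) - ?n * \<mu> (half A k b)\<bar>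
        \<le> 2 * ?\<delta> + ?\<delta>"
      unfolding close_sample_def by (intro add_mono mult_left_mono) auto
    also have "2 * ?\<delta> + ?\<delta> = 3 * ?\<delta>" by simp
    finally show ?thesis .
  qed
  have up: "?N A * Vsplit D J A j \<le> ?n * (Vbar Dx m A {j} * \<mu> A) + 6 * ?\<delta>"
    using square_quotient_diff_le[OF SN MP[OF half], of "half A j False" j False] near[of j False]
      square_quotient_diff_le[OF SN MP[OF half], of "half A j True" j True] near[of j True]
    unfolding Vsplit_scaled[OF J(1)] V[OF ij(3,4)] by simp
  have low: "?n * (Vbar Dx m A {i} * \<mu> A) \<le> ?N A * Vsplit D J A i + 6 * ?\<delta>"
    using square_quotient_diff_le[OF MP[OF half] SN, of i False "half A i False"] near[of i False]
      square_quotient_diff_le[OF MP[OF half] SN, of i True "half A i True"] near[of i True]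
    unfolding Vsplit_scaled[OF J(1)] V[OF ij(1,2)] by (simp add: abs_minus_commute)
  have "?n * \<mu> A * (Vbar Dx m A {j} + \<beta>) \<le> ?n * \<mu> A * Vbar Dx m A {i}"
    using gap J(3) pos by (intro mult_left_mono) auto
  then have "?n * (Vbar Dx m A {j} * \<mu> A) + 13 * ?\<delta> \<le> ?n * (Vbar Dx m A {i} * \<mu> A)"
    by (simp add: algebra_simps)
  moreover have "0 < ?\<delta>" using J(3) pos \<beta> by simp
  ultimately have "?N A * Vsplit D J A j < ?N A * Vsplit D J A i" using up low by linarith
  then show ?thesis by (rule mult_left_less_imp_less) simp
qed

text \<open>An irrelevant best split while a relevant coordinate is still free would contradict
  maximality by \<open>Vsplit_less\<close>. The condition \<open>d \<le> n + card F\<close> reserves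
  enough depth for all of \<open>R\<close> to be cut before the tree ends.\<close>

lemma full_tree_splits_first:
  assumes R: "R \<subseteq> {..<d}" and J: "finite J" "\<And>j. j \<in> J \<Longrightarrow> \<bar>snd (D j)\<bar> \<le> 1" "0 < card J"
    and gap: "\<And>F z i j. F \<subseteq> R \<Longrightarrow> z \<in> cube d \<Longrightarrow> i \<in> R - F \<Longrightarrow> j \<in> {..<d} - R \<Longrightarrow>
      Vbar Dx m (agreeing d F z) {j} + \<beta> \<le> Vbar Dx m (agreeing d F z) {i}" and \<beta>: "0 < \<beta>"
    and close: "\<And>F z k b. F \<subseteq> R \<Longrightarrow> z \<in> cube d \<Longrightarrow> k < d \<Longrightarrow>
      close_sample D J (card J * \<mu> (agreeing d F z) * (\<beta> / 13)) (half (agreeing d F z) k b)"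
  shows "F \<subseteq> R \<Longrightarrow> z \<in> cube d \<Longrightarrow> d \<le> n + card F \<Longrightarrow>
    \<tau> \<in> set_pmf (full_tree (best_splits d D J) n (agreeing d F z)) \<Longrightarrow> splits_first R \<tau> F"
proof (induction n arbitrary: F z \<tau>)
  case 0
  have "card F \<le> card R" "card R \<le> d"
    using 0(1) R by (auto intro!: card_mono finite_subset[OF R] dest: card_mono[rotated])
  then have "F = R" using 0 R by (intro card_subset_eq finite_subset[OF R]) auto
  then show ?case using 0 by simp
next
  case (Suc n)
  let ?A = "agreeing d F z"
  show ?case
  proof (cases "R \<subseteq> F")
    case True
    then show ?thesis by (cases \<tau>) auto
  next
    case False
    then obtain i0 where i0: "i0 \<in> R" "i0 \<notin> F" by auto
    have "best_splits d D J ?A \<noteq> {}"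
      using i0 R Suc.prems(2) by (intro best_splits_nonempty[of i0]) (auto simp: fixed_in_agreeing)
    then obtain i l r where i: "i \<in> best_splits d D J ?A" and \<tau>: "\<tau> = Node i l r"
      and l: "l \<in> set_pmf (full_tree (best_splits d D J) n (half ?A i False))"
      and r: "r \<in> set_pmf (full_tree (best_splits d D J) n (half ?A i True))"
      using Suc.prems(4) by auto
    have id: "i < d" "i \<notin> F"
      using i best_splits_subset[of d D J ?A] fixed_in_agreeing[OF _ Suc.prems(2), of i F] by auto
    have "i \<in> R"
    proof (rule ccontr)
      assume "i \<notin> R"
      have "Vsplit D J ?A i < Vsplit D J ?A i0"
      proof (rule Vsplit_less[OF J _ Suc.prems(2)])
        show "close_sample D J (card J * \<mu> ?A * (\<beta> / 13)) (half ?A k b)" if "k \<in> {i0, i}" for k b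
          using that id(1) i0 R Suc.prems by (intro close) auto
        show "Vbar Dx m ?A {i} + \<beta> \<le> Vbar Dx m ?A {i0}"
          using Suc.prems i0 id \<open>i \<notin> R\<close> by (intro gap) auto
      qed (use id i0 R Suc.prems \<beta> in auto)
      then show False using i i0 R fixed_in_agreeing[OF _ Suc.prems(2), of i0 F]
        by (auto simp: best_splits_def is_arg_max_def)
    qed
    have fin: "finite F" using Suc.prems(1) R by (meson finite_lessThan finite_subset)
    have "splits_first R l (insert i F)"
      using l Suc.prems fin id \<open>i \<in> R\<close> unfolding half_agreeing_update[OF id Suc.prems(2)]
      by (intro Suc.IH[of _ "z[i := False]"]) (auto simp: update_in_cube)
    moreover have "splits_first R r (insert i F)"
      using r Suc.prems fin id \<open>i \<in> R\<close> unfolding half_agreeing_update[OF id Suc.prems(2)]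
      by (intro Suc.IH[of _ "z[i := True]"]) (auto simp: update_in_cube)
    ultimately show ?thesis using \<tau> \<open>i \<in> R\<close> id by simp
  qed
qed

text \<open>Bernstein's form of the Chernoff bound, with variance proxy \<open>p\<close> in place of
  a range. The parameter \<open>u / 2\<close>, with either sign, gives the exponent
  \<open>u\<^sup>2 / 2 - u\<^sup>2 / 4\<close> times \<open>card J * p\<close>.\<close>

lemma outer_le_deviation:
  fixes g :: "point \<times> real \<Rightarrow> real" and p u c :: real
  assumes J: "finite J" and meas: "g \<in> borel_measurable Z"
    and mgf: "\<And>t. \<bar>t\<bar> \<le> 1 \<Longrightarrow> (\<integral>\<^sup>+z. ennreal (exp (t * g z)) \<partial>Z) \<le> ennreal (exp (t * c + t\<^sup>2 * p))"
    and u: "0 \<le> u" "u \<le> 1"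
  shows "outer_le (PiM J (\<lambda>_. Z)) {D. card J * p * u < \<bar>(\<Sum>j\<in>J. g (D j)) - card J * c\<bar>} (2 * exp (- (card J * p * u\<^sup>2 / 4)))"
proof -
  let ?M = "PiM J (\<lambda>_. Z)"
  note meas[measurable]
  have one: "outer_le ?M {D. card J * p * u < s * ((\<Sum>j\<in>J. g (D j)) - card J * c)} (exp (- (card J * p * u\<^sup>2 / 4)))"
    if s: "\<bar>s\<bar> = 1" for s :: real
  proof -
    define t where "t = s * u / 2"
    have t: "\<bar>t\<bar> \<le> 1" "t\<^sup>2 = u\<^sup>2 / 4"
      using u s abs_square_eq_1[of s] by (auto simp: t_def abs_mult power_mult_distrib power_divide)
    define K where "K = exp (- (card J * p * u\<^sup>2 / 2) - t * (card J * c))"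
    have "(\<integral>\<^sup>+D. (\<Prod>b<(1::nat). \<Prod>j\<in>J. ennreal (exp (t * g (D j)))) \<partial>?M)
        = (\<Prod>b<(1::nat). (\<integral>\<^sup>+z. ennreal (exp (t * g z)) \<partial>Z) ^ card J)"
      using J Z.prob_space_axioms by (intro nn_integral_PiM_blocks) (auto simp: disjoint_family_on_def)
    then have "(\<integral>\<^sup>+D. (\<Prod>j\<in>J. ennreal (exp (t * g (D j)))) \<partial>?M) = (\<integral>\<^sup>+z. ennreal (exp (t * g z)) \<partial>Z) ^ card J" by simp
    also have "\<dots> \<le> ennreal (exp (t * c + t\<^sup>2 * p)) ^ card J" by (intro power_mono mgf t) auto
    also have "\<dots> = ennreal (exp (card J * (t * c + t\<^sup>2 * p)))" by (simp add: ennreal_power exp_of_nat_mult)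
    finally have int: "(\<integral>\<^sup>+D. (\<Prod>j\<in>J. ennreal (exp (t * g (D j)))) \<partial>?M) \<le> ennreal (exp (card J * (t * c + t\<^sup>2 * p)))" .
    have [measurable]: "(\<lambda>D. \<Prod>j\<in>J. ennreal (exp (t * g (D j)))) \<in> borel_measurable ?M"
      by (intro borel_measurable_prod_components) auto
    show ?thesis
    proof (rule outer_leI_nn_integral[where f = "\<lambda>D. ennreal K * (\<Prod>j\<in>J. ennreal (exp (t * g (D j))))"])
      have "(\<integral>\<^sup>+D. ennreal K * (\<Prod>j\<in>J. ennreal (exp (t * g (D j)))) \<partial>?M)
          = ennreal K * (\<integral>\<^sup>+D. (\<Prod>j\<in>J. ennreal (exp (t * g (D j)))) \<partial>?M)"
        by (rule nn_integral_cmult) measurable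
      also have "\<dots> \<le> ennreal K * ennreal (exp (card J * (t * c + t\<^sup>2 * p)))"
        by (intro mult_left_mono int) auto
      also have "\<dots> = ennreal (exp (- (card J * p * u\<^sup>2 / 4)))"
        unfolding K_def ennreal_mult[symmetric, OF exp_ge_zero exp_ge_zero] exp_add[symmetric] t(2)
        by (simp add: algebra_simps)
      finally show "(\<integral>\<^sup>+D. ennreal K * (\<Prod>j\<in>J. ennreal (exp (t * g (D j)))) \<partial>?M) \<le> \<dots>" .
    next
      fix D assume "D \<in> {D. card J * p * u < s * ((\<Sum>j\<in>J. g (D j)) - card J * c)}"
      then have "u / 2 * (card J * p * u) \<le> u / 2 * (s * ((\<Sum>j\<in>J. g (D j)) - card J * c))"
        using u by (intro mult_left_mono) auto
      then have "0 \<le> - (card J * p * u\<^sup>2 / 2) - t * (card J * c) + t * (\<Sum>j\<in>J. g (D j))"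
        unfolding t_def by (simp add: power2_eq_square algebra_simps)
      then have "1 \<le> K * exp (t * (\<Sum>j\<in>J. g (D j)))"
        unfolding K_def exp_add[symmetric] by simp
      moreover have "(\<Prod>j\<in>J. ennreal (exp (t * g (D j)))) = ennreal (exp (t * (\<Sum>j\<in>J. g (D j))))"
        by (simp add: prod_ennreal exp_sum[OF J] sum_distrib_left)
      ultimately show "1 \<le> ennreal K * (\<Prod>j\<in>J. ennreal (exp (t * g (D j))))"
        unfolding K_def by (simp add: ennreal_mult[symmetric])
    qed measurable
  qed
  show ?thesis
  proof (rule outer_le_mono[OF outer_le_Un[OF one[of 1] one[of "-1"]]])
    show "{D. card J * p * u < \<bar>(\<Sum>j\<in>J. g (D j)) - card J * c\<bar>} \<inter> space ?M
      \<subseteq> {D. card J * p * u < 1 * ((\<Sum>j\<in>J. g (D j)) - card J * c)} \<union> {D. card J * p * u < - 1 * ((\<Sum>j\<in>J. g (D j)) - card J * c)}"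
      by auto
  qed auto
qed

text \<open>Off \<open>C\<close> the variable is 0 and contributes exactly 1, so the terms of first
  and second order are collected over \<open>C\<close> only. This makes the mass of the cell the
  variance proxy.\<close>

lemma nn_integral_Z_in_cell:
  fixes f :: "point \<Rightarrow> ennreal"
  assumes C: "C \<subseteq> cube d" and g: "g \<in> borel_measurable Z" "\<And>x e. x \<notin> C \<Longrightarrow> g (x, e) = 0"
    and cell: "\<And>x. x \<in> C \<Longrightarrow> (\<integral>\<^sup>+e. ennreal (exp (t * g (x, m x + e))) \<partial>E) \<le> ennreal (1 + (t * h x + t\<^sup>2))"
    and nonneg: "\<And>x. x \<in> C \<Longrightarrow> - 1 \<le> t * h x + t\<^sup>2"
  shows "(\<integral>\<^sup>+z. ennreal (exp (t * g z)) \<partial>Z) \<le> ennreal (exp (t * (\<Sum>x\<in>C. pmf Dx x * h x) + t\<^sup>2 * \<mu> C))"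
proof -
  let ?k = "\<lambda>x. 1 + of_bool (x \<in> C) * (t * h x + t\<^sup>2)"
  have k0: "0 \<le> ?k x" for x
  proof (cases "x \<in> C")
    case True
    have "of_bool (x \<in> C) = (1::real)" using True by simp
    then show ?thesis using nonneg[OF True] by (simp only: mult_1)
  qed simp
  have "(\<integral>\<^sup>+z. ennreal (exp (t * g z)) \<partial>Z) = (\<integral>\<^sup>+x. (\<integral>\<^sup>+e. ennreal (exp (t * g (x, m x + e))) \<partial>E) \<partial>measure_pmf Dx)"
    using g(1) by (intro nn_integral_Z) (simp add: measurable_cong_sets[OF sets_Z refl])
  also have "\<dots> \<le> (\<integral>\<^sup>+x. ennreal (?k x) \<partial>measure_pmf Dx)"
    using cell g(2) by (intro nn_integral_mono) (auto simp: E.emeasure_space_1)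
  also have "\<dots> = (\<Sum>x\<in>cube d. ennreal (?k x) * ennreal (pmf Dx x))"
    using finite_cube set_pmf_Dx by (intro nn_integral_measure_pmf_support) auto
  also have "\<dots> = ennreal (\<Sum>x\<in>cube d. pmf Dx x * ?k x)"
    using k0 by (subst sum_ennreal[symmetric]) (auto simp: ennreal_mult[symmetric] mult.commute)
  also have "(\<Sum>x\<in>cube d. pmf Dx x * ?k x) = 1 + (\<Sum>x\<in>cube d. of_bool (x \<in> C) * (pmf Dx x * (t * h x + t\<^sup>2)))"
    unfolding distrib_left sum.distrib by (simp add: sum_pmf_cube mult.left_commute)
  also have "(\<Sum>x\<in>cube d. of_bool (x \<in> C) * (pmf Dx x * (t * h x + t\<^sup>2))) = (\<Sum>x\<in>C. pmf Dx x * (t * h x + t\<^sup>2))"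
    using C finite_cube by (intro sum.mono_neutral_cong_right) auto
  also have "\<dots> = t * (\<Sum>x\<in>C. pmf Dx x * h x) + t\<^sup>2 * \<mu> C"
    unfolding prob_eq_sum[OF C] by (simp add: distrib_left sum.distrib sum_distrib_left sum_distrib_right mult_ac)
  also have "1 + (t * (\<Sum>x\<in>C. pmf Dx x * h x) + t\<^sup>2 * \<mu> C) \<le> exp (t * (\<Sum>x\<in>C. pmf Dx x * h x) + t\<^sup>2 * \<mu> C)"
    by (rule exp_ge_add_one_self)
  finally show ?thesis by (simp add: ennreal_leI)
qed

lemma outer_le_not_close:
  fixes p u :: real
  assumes J: "finite J" and C: "C \<subseteq> cube d" "\<mu> C \<le> p" and u: "0 \<le> u" "u \<le> 1"
  shows "outer_le (PiM J (\<lambda>_. Z)) {D. \<not> close_sample D J (card J * p * u) C} (4 * exp (- (card J * p * u\<^sup>2 / 4)))"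
proof -
  let ?M = "PiM J (\<lambda>_. Z)"
  let ?g1 = "\<lambda>z :: point \<times> real. of_bool (fst z \<in> C) * snd z" and ?g2 = "\<lambda>z :: point \<times> real. of_bool (fst z \<in> C) :: real"
  have [measurable]: "?g1 \<in> borel_measurable Z" "?g2 \<in> borel_measurable Z" by measurable
  have up: "ennreal (exp (t * c + t\<^sup>2 * \<mu> C)) \<le> ennreal (exp (t * c + t\<^sup>2 * p))" for t c
    using C(2) by (intro ennreal_leI) (simp add: mult_left_mono)
  have 1: "(\<integral>\<^sup>+z. ennreal (exp (t * ?g1 z)) \<partial>Z) \<le> ennreal (exp (t * mass_mean C + t\<^sup>2 * p))" if t: "\<bar>t\<bar> \<le> 1" for t
  proof -
    have tt: "t\<^sup>2 \<le> \<bar>t\<bar>" using t mult_left_mono[of "\<bar>t\<bar>" 1 "\<bar>t\<bar>"] by (simp add: power2_eq_square abs_mult[symmetric])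
    have tm: "\<bar>t * m x\<bar> \<le> \<bar>t\<bar> / 2" if "x \<in> C" for x
      using m_bound[of x] C that mult_left_mono[of "\<bar>m x\<bar>" "1/2" "\<bar>t\<bar>"] by (auto simp: abs_mult)
    have "(\<integral>\<^sup>+z. ennreal (exp (t * ?g1 z)) \<partial>Z) \<le> ennreal (exp (t * (\<Sum>x\<in>C. pmf Dx x * m x) + t\<^sup>2 * \<mu> C))"
    proof (rule nn_integral_Z_in_cell[OF C(1)])
      fix x assume x: "x \<in> C"
      have "(\<integral>\<^sup>+e. ennreal (exp (t * ?g1 (x, m x + e))) \<partial>E) = (\<integral>\<^sup>+e. ennreal (exp (t * m x)) * ennreal (exp (t * e)) \<partial>E)"
        using x by (intro nn_integral_cong) (simp add: ennreal_mult[symmetric] exp_add[symmetric] distrib_left)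
      also have "\<dots> = ennreal (exp (t * m x)) * (\<integral>\<^sup>+e. ennreal (exp (t * e)) \<partial>E)"
        by (intro nn_integral_cmult) (simp add: measurable_cong_sets[OF sets_E refl])
      also have "\<dots> \<le> ennreal (exp (t * m x)) * ennreal (exp (t\<^sup>2 / 8))"
        by (intro mult_left_mono mgf_noise) auto
      also have "\<dots> = ennreal (exp (t * m x + t\<^sup>2 / 8))" by (simp add: ennreal_mult[symmetric] exp_add)
      \<comment> \<open>For \<open>\<bar>t\<bar> \<le> 1\<close> the exponent is at most
        \<open>5 / 8 * \<bar>t\<bar>\<close> in modulus, and
        \<open>1 / 8 + 25 / 64 < 1\<close>.\<close>
      also have "exp (t * m x + t\<^sup>2 / 8) \<le> 1 + (t * m x + t\<^sup>2)"
      proof -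
        let ?y = "t * m x + t\<^sup>2 / 8"
        have y: "\<bar>?y\<bar> \<le> 5 / 8 * \<bar>t\<bar>" using tm[OF x] tt zero_le_power2[of t] by linarith
        then have "\<bar>?y\<bar>\<^sup>2 \<le> (5 / 8 * \<bar>t\<bar>)\<^sup>2" by (intro power_mono) auto
        then have "?y\<^sup>2 \<le> 25 / 64 * t\<^sup>2" by (simp add: power_mult_distrib power_divide)
        moreover have "exp ?y \<le> 1 + ?y + ?y\<^sup>2" using y t by (intro exp_le_quadratic) linarith
        ultimately show ?thesis using zero_le_power2[of t] by linarith
      qed
      finally show "(\<integral>\<^sup>+e. ennreal (exp (t * ?g1 (x, m x + e))) \<partial>E) \<le> ennreal (1 + (t * m x + t\<^sup>2))"
        by (simp add: ennreal_leI)
      show "- 1 \<le> t * m x + t\<^sup>2" using tm[OF x] t zero_le_power2[of t] by linarith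
    qed auto
    then show ?thesis using up unfolding mass_mean_def by (rule order_trans)
  qed
  have 2: "(\<integral>\<^sup>+z. ennreal (exp (t * ?g2 z)) \<partial>Z) \<le> ennreal (exp (t * \<mu> C + t\<^sup>2 * p))" if t: "\<bar>t\<bar> \<le> 1" for t
  proof -
    have "(\<integral>\<^sup>+z. ennreal (exp (t * ?g2 z)) \<partial>Z) \<le> ennreal (exp (t * (\<Sum>x\<in>C. pmf Dx x * 1) + t\<^sup>2 * \<mu> C))"
    proof (rule nn_integral_Z_in_cell[OF C(1)])
      fix x assume x: "x \<in> C"
      then show "(\<integral>\<^sup>+e. ennreal (exp (t * ?g2 (x, m x + e))) \<partial>E) \<le> ennreal (1 + (t * 1 + t\<^sup>2))"
        using exp_le_quadratic[OF t] by (simp add: E.emeasure_space_1 add.assoc ennreal_leI)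
      show "- 1 \<le> t * 1 + t\<^sup>2" using t zero_le_power2[of t] by linarith
    qed auto
    also have "(\<Sum>x\<in>C. pmf Dx x * 1) = \<mu> C" by (simp add: prob_eq_sum[OF C(1)])
    also note up[of t "\<mu> C"]
    finally show ?thesis .
  qed
  have eq: "(\<Sum>j\<in>J. ?g1 (D j)) = (\<Sum>j\<in>idx_in D J C. snd (D j))" "(\<Sum>j\<in>J. ?g2 (D j)) = card (idx_in D J C)" for D :: dataset
  proof -
    show "(\<Sum>j\<in>J. ?g1 (D j)) = (\<Sum>j\<in>idx_in D J C. snd (D j))"
      using J by (intro sum.mono_neutral_cong_right) (auto simp: idx_in_def)
    have "(\<Sum>j\<in>J. ?g2 (D j)) = (\<Sum>j\<in>idx_in D J C. 1)"
      using J by (intro sum.mono_neutral_cong_right) (auto simp: idx_in_def)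
    then show "(\<Sum>j\<in>J. ?g2 (D j)) = card (idx_in D J C)" by simp
  qed
  show ?thesis
    by (rule outer_le_mono[OF outer_le_Un[OF outer_le_deviation[OF J _ 1 u] outer_le_deviation[OF J _ 2 u]]])
       (auto simp: close_sample_def eq not_le)
qed

text \<open>Until \<open>R\<close> is exhausted the tree meets only cells fixing a subset of
  \<open>R\<close>, at most \<open>4 ^ r\<close> of them. With \<open>d\<close> coordinates, two
  halves and the factor 4 of the tail this gives \<open>8 * d * 4 ^ r\<close>. Fluctuations in a
  half are measured against the mass of the parent, which is at least \<open>\<zeta>'\<close>; and
  676 is 4 times the square of 13.\<close>

lemma outer_le_not_splits_first:
  fixes \<beta> \<zeta>' :: real
  assumes R: "R \<subseteq> {..<d}" "card R = r" and J: "finite J" "0 < card J"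
    and gap: "\<And>F z i j. F \<subseteq> R \<Longrightarrow> z \<in> cube d \<Longrightarrow> i \<in> R - F \<Longrightarrow> j \<in> {..<d} - R \<Longrightarrow>
      Vbar Dx m (agreeing d F z) {j} + \<beta> \<le> Vbar Dx m (agreeing d F z) {i}" and \<beta>: "0 < \<beta>" "\<beta> \<le> 1"
    and lower: "\<And>z. z \<in> cube d \<Longrightarrow> \<zeta>' \<le> \<mu> (agreeing d R z)"
  shows "outer_le (PiM J (\<lambda>_. Z))
    {D. (\<forall>j\<in>J. \<bar>snd (D j)\<bar> \<le> 1) \<and> (\<exists>\<tau>\<in>set_pmf (full_tree (best_splits d D J) d (cube d)). \<not> splits_first R \<tau> {})}
    (8 * d * 4 ^ r * exp (- (card J * \<zeta>' * \<beta>\<^sup>2 / 676)))"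
proof -
  let ?M = "PiM J (\<lambda>_. Z)"
  define \<A> where "\<A> = (\<Union>F\<in>Pow R. agreeing d F ` cube d)"
  have finR: "finite R" using R(1) finite_subset by auto
  have fin: "finite \<A>" unfolding \<A>_def using finR finite_cube by auto
  have "card \<A> \<le> (\<Sum>F\<in>Pow R. card (agreeing d F ` cube d))"
    unfolding \<A>_def using finR by (intro card_UN_le) auto
  also have "\<dots> \<le> (\<Sum>F\<in>Pow R. 2 ^ r)"
  proof (intro sum_mono)
    fix F assume "F \<in> Pow R"
    then have "F \<subseteq> {..<d}" "card F \<le> r" using R finR card_mono by auto
    then show "card (agreeing d F ` cube d) \<le> 2 ^ r"
      using card_agreeing_image[of F d] by (meson order_trans power_increasing one_le_numeral)
  qed
  also have "\<dots> = 4 ^ r" using finR R(2) by (simp add: card_Pow power_mult_distrib[symmetric])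
  finally have card: "card \<A> \<le> 4 ^ r" .
  define B where "B = (\<Union>(A, k, b)\<in>\<A> \<times> {..<d} \<times> UNIV. {D. \<not> close_sample D J (card J * \<mu> A * (\<beta> / 13)) (half A k b)})"
  have "outer_le ?M B (\<Sum>(A, k, b)\<in>\<A> \<times> {..<d} \<times> (UNIV :: bool set). 4 * exp (- (card J * \<zeta>' * \<beta>\<^sup>2 / 676)))"
    unfolding B_def split_beta
  proof (intro outer_le_UN)
    fix Akb :: "cell \<times> nat \<times> bool" assume Akb: "Akb \<in> \<A> \<times> {..<d} \<times> UNIV"
    obtain A k b where eq: "Akb = (A, k, b)" by (cases Akb) auto
    obtain F z where A: "A = agreeing d F z" "F \<subseteq> R" "z \<in> cube d" using Akb eq by (auto simp: \<A>_def)
    have "half A k b \<subseteq> cube d" using half_subset[of A k b] agreeing_subset_cube[of d F z] A(1) by simp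
    moreover have "\<mu> (half A k b) \<le> \<mu> A" by (intro measure_pmf.finite_measure_mono half_subset) auto
    ultimately have *: "outer_le ?M {D. \<not> close_sample D J (card J * \<mu> A * (\<beta> / 13)) (half A k b)}
        (4 * exp (- (card J * \<mu> A * (\<beta> / 13)\<^sup>2 / 4)))"
      using \<beta> by (intro outer_le_not_close[OF J(1)]) auto
    have "\<zeta>' \<le> \<mu> A"
      using lower[OF A(3)] measure_pmf.finite_measure_mono[OF agreeing_antimono[OF A(2), of d z], of Dx]
      unfolding A(1) by simp
    then have "card J * \<zeta>' * (\<beta>\<^sup>2 / 676) \<le> card J * \<mu> A * (\<beta>\<^sup>2 / 676)"
      by (intro mult_right_mono mult_left_mono) auto
    then have "4 * exp (- (card J * \<mu> A * (\<beta> / 13)\<^sup>2 / 4)) \<le> 4 * exp (- (card J * \<zeta>' * \<beta>\<^sup>2 / 676))"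
      by (simp add: power_divide)
    then show "outer_le ?M {D. \<not> close_sample D J (card J * \<mu> (fst Akb) * (\<beta> / 13)) (half (fst Akb) (fst (snd Akb)) (snd (snd Akb)))}
        (4 * exp (- (card J * \<zeta>' * \<beta>\<^sup>2 / 676)))"
      unfolding eq fst_conv snd_conv by (rule outer_le_mono[OF * Int_lower1])
  qed (use fin in auto)
  then show ?thesis
  proof (rule outer_le_mono)
    show "{D. (\<forall>j\<in>J. \<bar>snd (D j)\<bar> \<le> 1) \<and> (\<exists>\<tau>\<in>set_pmf (full_tree (best_splits d D J) d (cube d)). \<not> splits_first R \<tau> {})} \<inter> space ?M \<subseteq> B"
    proof (rule ccontr)
      assume "\<not> ?thesis"
      then obtain D \<tau> where D: "\<forall>j\<in>J. \<bar>snd (D j)\<bar> \<le> 1" "\<tau> \<in> set_pmf (full_tree (best_splits d D J) d (cube d))"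
        "\<not> splits_first R \<tau> {}" "D \<notin> B" by blast
      have "splits_first R \<tau> {}"
      proof (rule full_tree_splits_first[OF R(1) J(1) _ J(2) gap \<beta>(1), where z = "replicate d False" and n = d])
        show "close_sample D J (card J * \<mu> (agreeing d F z) * (\<beta> / 13)) (half (agreeing d F z) k b)"
          if "F \<subseteq> R" "z \<in> cube d" "k < d" for F z k b
          using D(4) that by (auto simp: B_def \<A>_def)
      qed (use D in \<open>auto simp: agreeing_empty cube_def[of d]\<close>)
      then show False using D(3) by simp
    qed
    have "(\<Sum>(A, k, b)\<in>\<A> \<times> {..<d} \<times> (UNIV :: bool set). 4 * exp (- (card J * \<zeta>' * \<beta>\<^sup>2 / 676)))
        = real (card \<A>) * (8 * d * exp (- (card J * \<zeta>' * \<beta>\<^sup>2 / 676)))"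
      by (simp add: split_beta card_cartesian_product card_UNIV_bool)
    also have "\<dots> \<le> real (4 ^ r) * (8 * d * exp (- (card J * \<zeta>' * \<beta>\<^sup>2 / 676)))"
      using card by (intro mult_right_mono of_nat_mono) auto
    finally show "(\<Sum>(A, k, b)\<in>\<A> \<times> {..<d} \<times> (UNIV :: bool set). 4 * exp (- (card J * \<zeta>' * \<beta>\<^sup>2 / 676)))
        \<le> 8 * d * 4 ^ r * exp (- (card J * \<zeta>' * \<beta>\<^sup>2 / 676))" by (simp add: mult_ac)
  qed
qed

end

section \<open>The forest as an average over permutations\<close>

lemma permutation_extending_disjoint_pair:
  fixes V :: "'a set"
  assumes "finite V" "J \<subseteq> V" "H \<subseteq> V" "J \<inter> H = {}" "J' \<subseteq> V" "H' \<subseteq> V" "J' \<inter> H' = {}"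
    and "card J = card J'" "card H = card H'"
  obtains \<pi> where "\<pi> permutes V" "\<pi> ` J = J'" "\<pi> ` H = H'"
proof -
  let ?K = "V - J - H" and ?K' = "V - J' - H'"
  have fin: "finite J" "finite H" "finite J'" "finite H'"
    using assms(2,3,5,6) by (simp_all add: finite_subset[OF _ assms(1)])
  have K_card: "card (V - A - B) = card V - (card A + card B)" if "A \<subseteq> V" "B \<subseteq> V" "A \<inter> B = {}" for A B
  proof -
    have "finite A" "finite B" using that by (simp_all add: finite_subset[OF _ assms(1)])
    moreover have "V - A - B = V - (A \<union> B)" by auto
    ultimately show ?thesis using that by (simp add: card_Diff_subset card_Un_disjoint)
  qed
  have K: "card ?K = card ?K'" using K_card[OF assms(2-4)] K_card[OF assms(5-7)] assms(8,9) by simp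
  obtain f where f: "bij_betw f J J'" using finite_same_card_bij[OF fin(1,3) assms(8)] by auto
  obtain g where g: "bij_betw g H H'" using finite_same_card_bij[OF fin(2,4) assms(9)] by auto
  obtain k where k: "bij_betw k ?K ?K'" using finite_same_card_bij[OF _ _ K] assms(1) by auto
  define \<pi> where "\<pi> x = (if x \<in> J then f x else if x \<in> H then g x else if x \<in> V then k x else x)" for x
  have J: "bij_betw \<pi> J J'" using f by (rule bij_betw_cong[THEN iffD1, rotated]) (simp add: \<pi>_def)
  have H: "bij_betw \<pi> H H'"
    using g by (rule bij_betw_cong[THEN iffD1, rotated]) (use assms(4) in \<open>auto simp: \<pi>_def\<close>)
  have K: "bij_betw \<pi> ?K ?K'" using k by (rule bij_betw_cong[THEN iffD1, rotated]) (simp add: \<pi>_def)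
  have "bij_betw \<pi> (J \<union> H \<union> ?K) (J' \<union> H' \<union> ?K')"
    by (intro bij_betw_combine J H K) (use assms(7) in auto)
  moreover have "J \<union> H \<union> ?K = V" "J' \<union> H' \<union> ?K' = V" using assms by auto
  ultimately have "\<pi> permutes V" using assms by (intro bij_imp_permutes) (auto simp: \<pi>_def)
  then show ?thesis using that J H by (auto simp: bij_betw_def)
qed

text \<open>Both sides average over all pairs of disjoint sets of sizes \<open>k\<close> and \<open>h\<close>.\<close>

lemma sum_permutations_eq_sum_subsets:
  fixes G :: "nat set \<Rightarrow> nat set \<Rightarrow> real"
  assumes J0: "J0 \<subseteq> {..<n}" "card J0 = k" and H0: "H0 \<subseteq> {..<n}" "card H0 = h" and "J0 \<inter> H0 = {}"
  shows "(\<Sum>\<sigma> | \<sigma> permutes {..<n}. G (\<sigma> ` J0) (\<sigma> ` H0)) / fact n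
    = (\<Sum>I | I \<subseteq> {..<n} \<and> card I = k + h. (\<Sum>J | J \<subseteq> I \<and> card J = k. G J (I - J)) / ((k + h) choose k))
      / (n choose (k + h))"
proof -
  define S where "S = {\<sigma>. \<sigma> permutes {..<n}}"
  define P where "P = {(J, H). J \<subseteq> {..<n} \<and> H \<subseteq> {..<n} \<and> J \<inter> H = {} \<and> card J = k \<and> card H = h}"
  define act where "act \<sigma> = (\<sigma> ` J0, \<sigma> ` H0)" for \<sigma> :: "nat \<Rightarrow> nat"
  have finS: "finite S" unfolding S_def by (intro finite_permutations) simp
  have "P \<subseteq> Pow {..<n} \<times> Pow {..<n}" by (auto simp: P_def)
  then have finP: "finite P" by (rule finite_subset) simp
  have actP: "act \<sigma> \<in> P" if "\<sigma> \<in> S" for \<sigma>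
  proof -
    have p: "\<sigma> permutes {..<n}" using that by (simp add: S_def)
    note inj = permutes_inj[OF p] and sub = permutes_image[OF p]
    have "\<sigma> ` J0 \<subseteq> {..<n}" "\<sigma> ` H0 \<subseteq> {..<n}" using J0(1) H0(1) sub by blast+
    moreover have "\<sigma> ` J0 \<inter> \<sigma> ` H0 = {}" using assms(5) image_Int[OF inj, of J0 H0] by simp
    ultimately show ?thesis
      using J0(2) H0(2) card_image[OF inj_on_subset[OF inj]] by (simp add: P_def act_def)
  qed
  define c where "c = card {\<sigma> \<in> S. act \<sigma> = (J0, H0)}"
  have fibre: "card {\<sigma> \<in> S. act \<sigma> = p} = c" if pP: "p \<in> P" for p
  proof -
    obtain J H where p: "p = (J, H)" "J \<subseteq> {..<n}" "H \<subseteq> {..<n}" "J \<inter> H = {}" "card J = k" "card H = h"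
      using pP by (auto simp: P_def)
    obtain \<pi> where \<pi>: "\<pi> permutes {..<n}" "\<pi> ` J0 = J" "\<pi> ` H0 = H"
      by (rule permutation_extending_disjoint_pair[of "{..<n}" J0 H0 J H]) (use assms p in auto)
    have inj: "inj \<pi>" using \<pi>(1) permutes_inj by auto
    \<comment> \<open>Composition with \<open>\<pi>\<close> carries the permutations that preserve
      \<open>J0\<close> and \<open>H0\<close> onto those that map them to the pair \<open>p\<close>.
      So all fibres of \<open>act\<close> have the same size.\<close>
    have "bij_betw ((\<circ>) \<pi>) {\<sigma> \<in> S. act \<sigma> = (J0, H0)} {\<sigma> \<in> S. act \<sigma> = p}"
    proof (rule bij_betwI[where g = "(\<circ>) (inv \<pi>)"])
      show "(\<circ>) \<pi> \<in> {\<sigma> \<in> S. act \<sigma> = (J0, H0)} \<rightarrow> {\<sigma> \<in> S. act \<sigma> = p}"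
      proof
        fix \<sigma> assume "\<sigma> \<in> {\<sigma> \<in> S. act \<sigma> = (J0, H0)}"
        then have \<sigma>: "\<sigma> permutes {..<n}" "\<sigma> ` J0 = J0" "\<sigma> ` H0 = H0" by (auto simp: S_def act_def)
        have "(\<pi> \<circ> \<sigma>) ` J0 = J" "(\<pi> \<circ> \<sigma>) ` H0 = H"
          unfolding image_comp[symmetric] \<sigma>(2,3) \<pi>(2,3) by (rule refl)+
        then show "\<pi> \<circ> \<sigma> \<in> {\<sigma> \<in> S. act \<sigma> = p}"
          using permutes_compose[OF \<sigma>(1) \<pi>(1)] p(1) by (simp add: S_def act_def)
      qed
      show "(\<circ>) (inv \<pi>) \<in> {\<sigma> \<in> S. act \<sigma> = p} \<rightarrow> {\<sigma> \<in> S. act \<sigma> = (J0, H0)}"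
      proof
        fix \<sigma> assume "\<sigma> \<in> {\<sigma> \<in> S. act \<sigma> = p}"
        then have \<sigma>: "\<sigma> permutes {..<n}" "\<sigma> ` J0 = J" "\<sigma> ` H0 = H" using p(1) by (auto simp: S_def act_def)
        have "(inv \<pi> \<circ> \<sigma>) ` J0 = J0" "(inv \<pi> \<circ> \<sigma>) ` H0 = H0"
          unfolding image_comp[symmetric] \<sigma>(2,3) \<pi>(2,3)[symmetric] by (rule image_inv_f_f[OF inj])+
        then show "inv \<pi> \<circ> \<sigma> \<in> {\<sigma> \<in> S. act \<sigma> = (J0, H0)}"
          using permutes_compose[OF \<sigma>(1) permutes_inv[OF \<pi>(1)]] by (simp add: S_def act_def)
      qed
      show "inv \<pi> \<circ> (\<pi> \<circ> \<sigma>) = \<sigma>" for \<sigma> using inj by (simp add: o_assoc[symmetric] comp_assoc[symmetric])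
      show "\<pi> \<circ> (inv \<pi> \<circ> \<sigma>) = \<sigma>" for \<sigma>
        using permutes_surj[OF \<pi>(1)] by (simp add: fun_eq_iff surj_f_inv_f)
    qed
    then show ?thesis unfolding c_def by (simp add: bij_betw_same_card)
  qed
  have perm: "(\<Sum>\<sigma>\<in>S. g (act \<sigma>)) = c * (\<Sum>p\<in>P. g p)" for g :: "nat set \<times> nat set \<Rightarrow> real"
  proof -
    have "(\<Sum>\<sigma>\<in>S. g (act \<sigma>)) = (\<Sum>p\<in>P. \<Sum>\<sigma> | \<sigma> \<in> S \<and> act \<sigma> = p. g (act \<sigma>))"
      by (rule sum.group[symmetric, OF finS finP]) (use actP in auto)
    also have "\<dots> = (\<Sum>p\<in>P. c * g p)" by (intro sum.cong refl) (simp add: fibre)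
    finally show ?thesis by (simp add: sum_distrib_left)
  qed
  have card: "fact n = real c * real (card P)"
    using perm[of "\<lambda>_. 1"] card_permutations[of "{..<n}" n] by (simp add: S_def)
  have sub: "(\<Sum>I | I \<subseteq> {..<n} \<and> card I = k + h. \<Sum>J | J \<subseteq> I \<and> card J = k. g (J, I - J)) = (\<Sum>p\<in>P. g p)"
    for g :: "nat set \<times> nat set \<Rightarrow> real"
  proof -
    have fin: "finite I" if "I \<subseteq> {..<n}" for I :: "nat set" using that by (rule finite_subset) simp
    have "(\<Sum>I | I \<subseteq> {..<n} \<and> card I = k + h. \<Sum>J | J \<subseteq> I \<and> card J = k. g (J, I - J))
        = (\<Sum>(I, J)\<in>(SIGMA I:{I. I \<subseteq> {..<n} \<and> card I = k + h}. {J. J \<subseteq> I \<and> card J = k}). g (J, I - J))"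
    proof (rule sum.Sigma)
      show "finite {I. I \<subseteq> {..<n} \<and> card I = k + h}" by (rule finite_subset[of _ "Pow {..<n}"]) auto
      show "\<forall>I\<in>{I. I \<subseteq> {..<n} \<and> card I = k + h}. finite {J. J \<subseteq> I \<and> card J = k}"
      proof
        fix I assume "I \<in> {I. I \<subseteq> {..<n} \<and> card I = k + h}"
        then show "finite {J. J \<subseteq> I \<and> card J = k}"
          using fin by (rule_tac finite_subset[of _ "Pow I"]) auto
      qed
    qed
    also have "\<dots> = (\<Sum>p\<in>P. g p)"
    proof (rule sum.reindex_bij_witness[where i = "\<lambda>(J, H). (J \<union> H, J)" and j = "\<lambda>(I, J). (J, I - J)"])
      fix a assume "a \<in> (SIGMA I:{I. I \<subseteq> {..<n} \<and> card I = k + h}. {J. J \<subseteq> I \<and> card J = k})"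
      then obtain I J where a: "a = (I, J)" "I \<subseteq> {..<n}" "card I = k + h" "J \<subseteq> I" "card J = k" by auto
      have "card (I - J) = h" using a fin[OF a(2)] card_Diff_subset[OF finite_subset[OF a(4) fin[OF a(2)]] a(4)] by simp
      then show "(case a of (I, J) \<Rightarrow> (J, I - J)) \<in> P" using a by (auto simp: P_def)
      show "(case (case a of (I, J) \<Rightarrow> (J, I - J)) of (J, H) \<Rightarrow> (J \<union> H, J)) = a" using a by auto
    next
      fix p assume "p \<in> P"
      then obtain J H where p: "p = (J, H)" "J \<subseteq> {..<n}" "H \<subseteq> {..<n}" "J \<inter> H = {}" "card J = k" "card H = h"
        by (auto simp: P_def)
      have "card (J \<union> H) = k + h" using p card_Un_disjoint[OF fin[OF p(2)] fin[OF p(3)] p(4)] by simp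
      then show "(case p of (J, H) \<Rightarrow> (J \<union> H, J)) \<in> (SIGMA I:{I. I \<subseteq> {..<n} \<and> card I = k + h}. {J. J \<subseteq> I \<and> card J = k})"
        using p by auto
      show "(case (case p of (J, H) \<Rightarrow> (J \<union> H, J)) of (I, J) \<Rightarrow> (J, I - J)) = p" using p by auto
    qed auto
    finally show ?thesis .
  qed
  have "card {J. J \<subseteq> I \<and> card J = k} = (k + h) choose k" if "I \<subseteq> {..<n}" "card I = k + h" for I
    using n_subsets[of I k] finite_subset[OF that(1)] that(2) by simp
  then have "real (n choose (k + h)) * real ((k + h) choose k) = real (card P)"
    using sub[of "\<lambda>_. 1"] n_subsets[of "{..<n}" "k + h"] by simp
  moreover have "(\<Sum>I | I \<subseteq> {..<n} \<and> card I = k + h. (\<Sum>J | J \<subseteq> I \<and> card J = k. G J (I - J)) / ((k + h) choose k))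
      / (n choose (k + h)) = (\<Sum>p\<in>P. G (fst p) (snd p)) / (real (n choose (k + h)) * real ((k + h) choose k))"
    using sub[of "\<lambda>p. G (fst p) (snd p)"] by (simp add: sum_divide_distrib[symmetric])
  moreover have "(\<Sum>\<sigma> | \<sigma> permutes {..<n}. G (\<sigma> ` J0) (\<sigma> ` H0)) / fact n = (\<Sum>p\<in>P. G (fst p) (snd p)) / real (card P)"
  proof -
    have "(\<Sum>\<sigma> | \<sigma> permutes {..<n}. G (\<sigma> ` J0) (\<sigma> ` H0)) = c * (\<Sum>p\<in>P. G (fst p) (snd p))"
      using perm[of "\<lambda>p. G (fst p) (snd p)"] by (simp add: S_def act_def)
    moreover have "c \<noteq> 0" using card by (metis fact_nonzero mult_zero_left of_nat_0)
    ultimately show ?thesis unfolding card by simp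
  qed
  ultimately show ?thesis by simp
qed

text \<open>A finite set that contains every tree the construction can produce, whatever the data.
  Expectations over trees become finite sums with one index set for all data sets.\<close>

primrec bounded_trees :: "nat \<Rightarrow> nat \<Rightarrow> split_tree set" where
  "bounded_trees d 0 = {Leaf}"
| "bounded_trees d (Suc k) =
     insert Leaf ((\<lambda>(i, l, r). Node i l r) ` ({..<d} \<times> bounded_trees d k \<times> bounded_trees d k))"

lemma finite_bounded_trees: "finite (bounded_trees d k)"
  by (induction k) auto

lemma set_full_tree_subset:
  assumes "\<And>A. B A \<subseteq> {..<d}"
  shows "set_pmf (full_tree B k A) \<subseteq> bounded_trees d k"
proof (induction k arbitrary: A)
  case (Suc k)
  have fin: "finite (B A)" by (rule finite_subset[OF assms]) simp
  show ?case
  proof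
    fix \<tau> assume \<tau>: "\<tau> \<in> set_pmf (full_tree B (Suc k) A)"
    show "\<tau> \<in> bounded_trees d (Suc k)"
    proof (cases "B A = {}")
      case False
      then obtain i l r where *: "i \<in> B A" "l \<in> set_pmf (full_tree B k (half A i False))"
        "r \<in> set_pmf (full_tree B k (half A i True))" "\<tau> = Node i l r"
        using \<tau> fin by auto
      then have "(i, l, r) \<in> {..<d} \<times> bounded_trees d k \<times> bounded_trees d k"
        using Suc.IH[of "half A i False"] Suc.IH[of "half A i True"] assms[of A] by (simp only: mem_Times_iff) force
      then have "(case (i, l, r) of (i, l, r) \<Rightarrow> Node i l r) \<in> bounded_trees d (Suc k)"
        unfolding bounded_trees.simps by (intro insertI2 imageI)
      then show ?thesis using *(4) by simp
    qed (use \<tau> in simp)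
  qed
qed simp

lemma finite_full_tree: "finite (set_pmf (full_tree (best_splits d D J) k A))"
  by (rule finite_subset[OF set_full_tree_subset finite_bounded_trees[of d k]])
     (rule order_trans[OF best_splits_subset], auto)

text \<open>The pointwise condition whose almost sure validity is
  \<open>fully_grown\<close>.\<close>

definition grown :: "nat \<Rightarrow> nat \<Rightarrow> nat \<Rightarrow> nat \<Rightarrow> dataset \<Rightarrow> bool" where
  "grown d n s t D \<longleftrightarrow> (\<forall>I. I \<subseteq> {..<n} \<longrightarrow> card I = s \<longrightarrow>
     (\<forall>(T, H)\<in>set_pmf (honest_tree d t D I). \<forall>A\<in>leaf_cells T (cube d). card (covariates D H \<inter> A) \<le> 1))"

text \<open>Growth that is not cut short is pruning of a full tree, and a pruned tree predicts by a
  mean over \<open>resolved_cell\<close>. The weights of the trees then depend on the structure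
  sample \<open>J\<close> only.\<close>

lemma expectation_honest_tree:
  assumes D: "grown d n s t D" and I: "I \<subseteq> {..<n}" "card I = s"
    and cube: "\<And>j. j < n \<Longrightarrow> fst (D j) \<in> cube d" and "0 < s"
  shows "measure_pmf.expectation (honest_tree d t D I) (\<lambda>(T, H). tree_predict d D H T x)
    = (\<Sum>J | J \<subseteq> I \<and> card J = s div 2. \<Sum>\<tau>\<in>bounded_trees d d. pmf (full_tree (best_splits d D J) d (cube d)) \<tau> *
        cell_mean D (I - J) (resolved_cell D (I - J) \<tau> (cube d) x)) / (s choose (s div 2))"
proof -
  let ?\<J> = "{J. J \<subseteq> I \<and> card J = s div 2}"
  let ?F = "\<lambda>J. full_tree (best_splits d D J) d (cube d)"
  have finI: "finite I" using I(1) by (rule finite_subset) simp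
  then have fin: "finite ?\<J>" by (rule_tac finite_subset[of _ "Pow I"]) auto
  have card: "card ?\<J> = s choose (s div 2)" using n_subsets[OF finI] I(2) by simp
  have "0 < s choose (s div 2)" by simp
  then have ne: "?\<J> \<noteq> {}" unfolding card[symmetric] by (rule_tac notI) (simp only: card.empty less_irrefl)
  have set: "set_pmf (pmf_of_set ?\<J>) = ?\<J>" by (rule set_pmf_of_set[OF ne fin])
  have tree: "map_pmf fst (grow_levels d t D J (I - J) d) = map_pmf (\<lambda>\<tau>. prune (covariates D (I - J)) \<tau> (cube d)) (?F J)"
    if "J \<in> ?\<J>" for J
  proof (rule grow_levels_eq_prune_full_tree)
    fix T c C assume T: "(T, c) \<in> set_pmf (grow_levels d t D J (I - J) d)" "C \<in> leaf_cells T (cube d)"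
    have mem: "(T, I - J) \<in> set_pmf (honest_tree d t D I)"
      unfolding honest_tree_def I(2) set_bind_pmf set
      by (intro UN_I[OF that] UN_I[OF T(1)]) simp
    have "\<forall>(T, H)\<in>set_pmf (honest_tree d t D I). \<forall>A\<in>leaf_cells T (cube d). card (covariates D H \<inter> A) \<le> 1"
      using D I unfolding grown_def by (elim allE[of _ I] impE)
    from bspec[OF this mem] T(2) show "card (covariates D (I - J) \<inter> C) \<le> 1" by simp
  qed
  have honest: "honest_tree d t D I
      = bind_pmf (pmf_of_set ?\<J>) (\<lambda>J. map_pmf (\<lambda>\<tau>. (prune (covariates D (I - J)) \<tau> (cube d), I - J)) (?F J))"
    unfolding honest_tree_def I(2)
  proof (intro bind_pmf_cong refl)
    fix J assume "J \<in> set_pmf (pmf_of_set ?\<J>)"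
    then have J: "J \<in> ?\<J>" by (simp only: set)
    have "(grow_levels d t D J (I - J) d \<bind> (\<lambda>(T, c). return_pmf (T, I - J)))
        = map_pmf (\<lambda>T. (T, I - J)) (map_pmf fst (grow_levels d t D J (I - J) d))"
      unfolding map_pmf_def bind_assoc_pmf bind_return_pmf
      by (intro bind_pmf_cong refl) (simp add: split_beta)
    then show "(grow_levels d t D J (I - J) d \<bind> (\<lambda>(T, c). return_pmf (T, I - J)))
        = map_pmf (\<lambda>\<tau>. (prune (covariates D (I - J)) \<tau> (cube d), I - J)) (?F J)"
      unfolding tree[OF J] by (simp add: pmf.map_comp o_def)
  qed
  have "measure_pmf.expectation (honest_tree d t D I) (\<lambda>(T, H). tree_predict d D H T x)
      = (\<Sum>J\<in>?\<J>. measure_pmf.expectation (map_pmf (\<lambda>\<tau>. (prune (covariates D (I - J)) \<tau> (cube d), I - J)) (?F J))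
          (\<lambda>(T, H). tree_predict d D H T x) /\<^sub>R real (card ?\<J>))"
    unfolding honest by (rule pmf_expectation_bind_pmf_of_set[OF ne fin]) (simp add: finite_full_tree)
  also have "\<dots> = (\<Sum>J\<in>?\<J>. \<Sum>\<tau>\<in>bounded_trees d d. pmf (?F J) \<tau> *
        cell_mean D (I - J) (resolved_cell D (I - J) \<tau> (cube d) x)) / card ?\<J>"
  proof (subst sum_divide_distrib, intro sum.cong refl)
    fix J assume J: "J \<in> ?\<J>"
    have "card (I - J) = s - s div 2"
      using J I(2) finI by (subst card_Diff_subset) (auto intro: finite_subset)
    then have "0 < card (I - J)" using \<open>0 < s\<close> by simp
    then have "I - J \<noteq> {}" by (metis card.empty less_irrefl)
    then have "idx_in D (I - J) (cube d) \<noteq> {}" using I(1) cube by (auto simp: idx_in_def)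
    note pred = tree_predict_prune[OF this]
    have "measure_pmf.expectation (map_pmf (\<lambda>\<tau>. (prune (covariates D (I - J)) \<tau> (cube d), I - J)) (?F J))
          (\<lambda>(T, H). tree_predict d D H T x)
        = measure_pmf.expectation (?F J) (\<lambda>\<tau>. cell_mean D (I - J) (resolved_cell D (I - J) \<tau> (cube d) x))"
      by (simp add: pred)
    also have "\<dots> = (\<Sum>\<tau>\<in>bounded_trees d d. cell_mean D (I - J) (resolved_cell D (I - J) \<tau> (cube d) x) * pmf (?F J) \<tau>)"
      using set_full_tree_subset[of "best_splits d D J" d d "cube d"] best_splits_subset[of d D J]
      by (intro integral_measure_pmf_real finite_bounded_trees) auto
    finally show "measure_pmf.expectation (map_pmf (\<lambda>\<tau>. (prune (covariates D (I - J)) \<tau> (cube d), I - J)) (?F J))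
          (\<lambda>(T, H). tree_predict d D H T x) /\<^sub>R real (card ?\<J>)
        = (\<Sum>\<tau>\<in>bounded_trees d d. pmf (?F J) \<tau> * cell_mean D (I - J) (resolved_cell D (I - J) \<tau> (cube d) x)) / card ?\<J>"
      by (simp add: divide_inverse mult.commute)
  qed
  finally show ?thesis unfolding card .
qed

text \<open>For each single \<open>b\<close> the permuted pair of \<open>J0\<close> and
  \<open>H0 b\<close> runs evenly over all divisions of all sub-samples, so one block already
  averages to the forest. Taking the mean over \<open>b\<close> changes nothing, but it provides
  \<open>N\<close> disjoint estimation samples for one tree.\<close>

lemma forest_eq_block_average:
  fixes H0 :: "nat \<Rightarrow> nat set"
  assumes D: "grown d n s t D" and cube: "\<And>j. j < n \<Longrightarrow> fst (D j) \<in> cube d" and s: "0 < s"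
    and J0: "J0 \<subseteq> {..<n}" "card J0 = s div 2"
    and H0: "\<And>b. b < N \<Longrightarrow> H0 b \<subseteq> {..<n} - J0" "\<And>b. b < N \<Longrightarrow> card (H0 b) = s - s div 2" and N: "0 < N"
  shows "forest d n s t D x = (\<Sum>\<sigma> | \<sigma> permutes {..<n}. \<Sum>\<tau>\<in>bounded_trees d d.
    pmf (full_tree (best_splits d D (\<sigma> ` J0)) d (cube d)) \<tau> / fact n *
      ((\<Sum>b<N. cell_mean D (\<sigma> ` H0 b) (resolved_cell D (\<sigma> ` H0 b) \<tau> (cube d) x)) / N))"
proof -
  define G where "G J H = (\<Sum>\<tau>\<in>bounded_trees d d. pmf (full_tree (best_splits d D J) d (cube d)) \<tau> *
      cell_mean D H (resolved_cell D H \<tau> (cube d) x))" for J H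
  have sk: "s div 2 + (s - s div 2) = s" by simp
  have *: "forest d n s t D x = (\<Sum>I | I \<subseteq> {..<n} \<and> card I = s. (\<Sum>J | J \<subseteq> I \<and> card J = s div 2. G J (I - J)) / (s choose (s div 2))) / (n choose s)"
    unfolding forest_def G_def using expectation_honest_tree[OF D _ _ cube s] by (simp add: divide_inverse mult.commute)
  have forest: "(\<Sum>\<sigma> | \<sigma> permutes {..<n}. G (\<sigma> ` J0) (\<sigma> ` H0 b)) / fact n = forest d n s t D x" if "b < N" for b
  proof -
    have "H0 b \<subseteq> {..<n}" "J0 \<inter> H0 b = {}" using H0(1)[OF that] by auto
    from sum_permutations_eq_sum_subsets[OF J0 this(1) H0(2)[OF that] this(2), where G = G]
    show ?thesis unfolding sk using * by simp
  qed
  have "(\<Sum>\<sigma> | \<sigma> permutes {..<n}. \<Sum>\<tau>\<in>bounded_trees d d.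
      pmf (full_tree (best_splits d D (\<sigma> ` J0)) d (cube d)) \<tau> / fact n *
        ((\<Sum>b<N. cell_mean D (\<sigma> ` H0 b) (resolved_cell D (\<sigma> ` H0 b) \<tau> (cube d) x)) / N))
      = (\<Sum>\<sigma> | \<sigma> permutes {..<n}. \<Sum>b<N. G (\<sigma> ` J0) (\<sigma> ` H0 b) / fact n / N)"
  proof (intro sum.cong refl)
    fix \<sigma>
    have "(\<Sum>b<N. G (\<sigma> ` J0) (\<sigma> ` H0 b) / fact n / N) = (\<Sum>b<N. \<Sum>\<tau>\<in>bounded_trees d d.
        pmf (full_tree (best_splits d D (\<sigma> ` J0)) d (cube d)) \<tau> / fact n *
          (cell_mean D (\<sigma> ` H0 b) (resolved_cell D (\<sigma> ` H0 b) \<tau> (cube d) x) / N))"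
      unfolding G_def by (simp add: sum_divide_distrib)
    also have "\<dots> = (\<Sum>\<tau>\<in>bounded_trees d d. \<Sum>b<N.
        pmf (full_tree (best_splits d D (\<sigma> ` J0)) d (cube d)) \<tau> / fact n *
          (cell_mean D (\<sigma> ` H0 b) (resolved_cell D (\<sigma> ` H0 b) \<tau> (cube d) x) / N))"
      by (rule sum.swap)
    finally show "(\<Sum>\<tau>\<in>bounded_trees d d.
      pmf (full_tree (best_splits d D (\<sigma> ` J0)) d (cube d)) \<tau> / fact n *
        ((\<Sum>b<N. cell_mean D (\<sigma> ` H0 b) (resolved_cell D (\<sigma> ` H0 b) \<tau> (cube d) x)) / N))
      = (\<Sum>b<N. G (\<sigma> ` J0) (\<sigma> ` H0 b) / fact n / N)"
      by (simp add: sum_distrib_left sum_divide_distrib)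
  qed
  also have "\<dots> = (\<Sum>b<N. (\<Sum>\<sigma> | \<sigma> permutes {..<n}. G (\<sigma> ` J0) (\<sigma> ` H0 b)) / fact n / N)"
    by (subst sum.swap) (simp add: sum_divide_distrib)
  also have "\<dots> = (\<Sum>b<N. forest d n s t D x / N)" using forest by (intro sum.cong) auto
  finally show ?thesis using N by simp
qed

text \<open>Jensen's inequality for the square, from the nonnegativity of the weighted
  variance.\<close>

lemma weighted_square_le:
  fixes p a :: "'a \<Rightarrow> real"
  assumes "finite K" "\<And>i. i \<in> K \<Longrightarrow> 0 \<le> p i" "(\<Sum>i\<in>K. p i) = 1"
  shows "(c - (\<Sum>i\<in>K. p i * a i))\<^sup>2 \<le> (\<Sum>i\<in>K. p i * (c - a i)\<^sup>2)"
proof -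
  define e where "e = (\<Sum>i\<in>K. p i * a i)"
  have "0 \<le> (\<Sum>i\<in>K. p i * (a i - e)\<^sup>2)" using assms(2) by (intro sum_nonneg) auto
  also have "(\<Sum>i\<in>K. p i * (a i - e)\<^sup>2) = (\<Sum>i\<in>K. p i * (c - a i)\<^sup>2 + (2 * (c - e)) * (p i * a i) + (e\<^sup>2 - c\<^sup>2) * p i)"
    by (intro sum.cong refl) (simp add: power2_eq_square algebra_simps)
  also have "\<dots> = (\<Sum>i\<in>K. p i * (c - a i)\<^sup>2) + (2 * (c - e)) * e + (e\<^sup>2 - c\<^sup>2)"
    unfolding sum.distrib sum_distrib_left[symmetric] assms(3) e_def[symmetric] by simp
  also have "\<dots> = (\<Sum>i\<in>K. p i * (c - a i)\<^sup>2) - (c - e)\<^sup>2"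
    by (simp add: power2_eq_square algebra_simps)
  finally show ?thesis by (simp add: e_def)
qed

lemma Vsplit_cong:
  assumes "\<And>j. j \<in> J \<Longrightarrow> D j = D' j"
  shows "Vsplit D J = Vsplit D' J"
proof -
  have idx: "idx_in D J A = idx_in D' J A" for A using assms by (auto simp: idx_in_def)
  have "cell_mean D J A = cell_mean D' J A" for A
  proof -
    have "(\<Sum>j\<in>idx_in D' J A. snd (D j)) = (\<Sum>j\<in>idx_in D' J A. snd (D' j))"
      using assms by (intro sum.cong refl) (simp add: idx_in_def)
    then show ?thesis by (simp add: cell_mean_def idx)
  qed
  then show ?thesis by (simp add: Vsplit_def idx fun_eq_iff)
qed

lemma best_splits_cong:
  "(\<And>j. j \<in> J \<Longrightarrow> D j = D' j) \<Longrightarrow> best_splits d D J = best_splits d D' J"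
  by (simp add: best_splits_def fun_eq_iff Vsplit_cong[of J D D'])

lemma cell_mean_cong:
  assumes "\<And>j. j \<in> H \<Longrightarrow> D j = D' j"
  shows "cell_mean D H A = cell_mean D' H A"
proof -
  have "idx_in D H A = idx_in D' H A" using assms by (auto simp: idx_in_def)
  moreover have "(\<Sum>j\<in>idx_in D' H A. snd (D j)) = (\<Sum>j\<in>idx_in D' H A. snd (D' j))"
    using assms by (intro sum.cong refl) (simp add: idx_in_def)
  ultimately show ?thesis by (simp add: cell_mean_def)
qed

text \<open>The explicit product makes the probability of a given tree accessible to an induction on
  the depth, for its measurability in the data.\<close>

lemma pmf_full_tree_Node:
  assumes "B A \<noteq> {}"
  shows "pmf (full_tree B (Suc k) A) (Node i l r)
    = pmf (pmf_of_set (B A)) i * (pmf (full_tree B k (half A i False)) l * pmf (full_tree B k (half A i True)) r)"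
proof -
  define sub where "sub j = map_pmf (\<lambda>(l, r). Node j l r)
      (pair_pmf (full_tree B k (half A j False)) (full_tree B k (half A j True)))" for j
  have "full_tree B (Suc k) A = bind_pmf (pmf_of_set (B A)) sub"
    using assms by (simp add: sub_def[abs_def] pair_pmf_def map_bind_pmf)
  then have "pmf (full_tree B (Suc k) A) (Node i l r)
      = measure_pmf.expectation (pmf_of_set (B A)) (\<lambda>j. pmf (sub j) (Node i l r))"
    by (simp add: pmf_bind)
  also have "\<dots> = (\<Sum>j\<in>{i}. pmf (sub j) (Node i l r) * pmf (pmf_of_set (B A)) j)"
  proof (rule integral_measure_pmf_real)
    show "j \<in> {i}" if "pmf (sub j) (Node i l r) \<noteq> 0" for j
      using that by (auto simp: sub_def pmf_eq_0_set_pmf)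
  qed simp
  moreover have "pmf (sub i) (Node i l r) = pmf (full_tree B k (half A i False)) l * pmf (full_tree B k (half A i True)) r"
  proof -
    have "pmf (sub i) ((\<lambda>(l, r). Node i l r) (l, r))
        = pmf (pair_pmf (full_tree B k (half A i False)) (full_tree B k (half A i True))) (l, r)"
      unfolding sub_def by (rule pmf_map_inj') (auto simp: inj_def)
    then show ?thesis by (simp add: pmf_pair)
  qed
  ultimately show ?thesis by simp
qed

lemma pmf_full_tree_Leaf:
  "pmf (full_tree B (Suc k) A) Leaf = of_bool (B A = {})"
proof (cases "B A = {}")
  case False
  then have "Leaf \<notin> set_pmf (full_tree B (Suc k) A)" by auto
  then show ?thesis using False by (simp add: pmf_eq_0_set_pmf)
qed simp

lemma restrict_merge_left:
  "x \<in> space (PiM J M) \<Longrightarrow> restrict (merge J K (x, y)) J = x"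
  by (auto simp: space_PiM PiE_def extensional_def merge_def restrict_def fun_eq_iff)

lemma restrict_merge_right:
  "y \<in> space (PiM K M) \<Longrightarrow> J \<inter> K = {} \<Longrightarrow> restrict (merge J K (x, y)) K = y"
  by (auto simp: space_PiM PiE_def extensional_def merge_def restrict_def fun_eq_iff)

section \<open>Independence of structure and estimation data; averaging the failures\<close>

context regression
begin

text \<open>Honesty in the form of integrals: tree probabilities depend on the data in
  \<open>J\<close>, block errors on those in \<open>K\<close>.\<close>

lemma nn_integral_PiM_product:
  assumes "finite J" "finite K" "J \<inter> K = {}"
    and f: "f \<in> borel_measurable (PiM J (\<lambda>_. Z))" and g: "g \<in> borel_measurable (PiM K (\<lambda>_. Z))"
  shows "(\<integral>\<^sup>+D. f (restrict D J) * g (restrict D K) \<partial>PiM (J \<union> K) (\<lambda>_. Z))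
    = (\<integral>\<^sup>+x. f x \<partial>PiM J (\<lambda>_. Z)) * (\<integral>\<^sup>+y. g y \<partial>PiM K (\<lambda>_. Z))"
proof -
  interpret product_sigma_finite "\<lambda>_. Z" by standard
  note f[measurable] g[measurable]
  have [measurable]: "(\<lambda>D. restrict D J) \<in> PiM (J \<union> K) (\<lambda>_. Z) \<rightarrow>\<^sub>M PiM J (\<lambda>_. Z)"
    "(\<lambda>D. restrict D K) \<in> PiM (J \<union> K) (\<lambda>_. Z) \<rightarrow>\<^sub>M PiM K (\<lambda>_. Z)"
    by (rule measurable_restrict_subset; simp)+
  have "(\<integral>\<^sup>+D. f (restrict D J) * g (restrict D K) \<partial>PiM (J \<union> K) (\<lambda>_. Z))
      = (\<integral>\<^sup>+x. (\<integral>\<^sup>+y. f (restrict (merge J K (x, y)) J) * g (restrict (merge J K (x, y)) K) \<partial>PiM K (\<lambda>_. Z)) \<partial>PiM J (\<lambda>_. Z))"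
    by (rule product_nn_integral_fold[OF assms(3,1,2)]) measurable
  also have "\<dots> = (\<integral>\<^sup>+x. (\<integral>\<^sup>+y. f x * g y \<partial>PiM K (\<lambda>_. Z)) \<partial>PiM J (\<lambda>_. Z))"
    by (intro nn_integral_cong) (simp add: restrict_merge_left restrict_merge_right[OF _ assms(3)])
  also have "\<dots> = (\<integral>\<^sup>+x. f x * (\<integral>\<^sup>+y. g y \<partial>PiM K (\<lambda>_. Z)) \<partial>PiM J (\<lambda>_. Z))"
    by (intro nn_integral_cong nn_integral_cmult) measurable
  also have "\<dots> = (\<integral>\<^sup>+x. f x \<partial>PiM J (\<lambda>_. Z)) * (\<integral>\<^sup>+y. g y \<partial>PiM K (\<lambda>_. Z))"
    by (rule nn_integral_multc) measurable
  finally show ?thesis .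
qed

lemma measurable_Vsplit:
  assumes "finite J"
  shows "(\<lambda>D. Vsplit D J A i) \<in> borel_measurable (PiM J (\<lambda>_. Z))"
proof -
  have sum: "(\<Sum>j\<in>idx_in D J C. snd (D j)) = (\<Sum>j\<in>J. of_bool (fst (D j) \<in> C) * snd (D j))"
    and card: "real (card (idx_in D J C)) = (\<Sum>j\<in>J. of_bool (fst (D j) \<in> C))" for D C
  proof -
    show "(\<Sum>j\<in>idx_in D J C. snd (D j)) = (\<Sum>j\<in>J. of_bool (fst (D j) \<in> C) * snd (D j))"
      using assms by (intro sum.mono_neutral_cong_left) (auto simp: idx_in_def)
    have "(\<Sum>j\<in>idx_in D J C. 1) = (\<Sum>j\<in>J. of_bool (fst (D j) \<in> C) :: real)"
      using assms by (intro sum.mono_neutral_cong_left) (auto simp: idx_in_def)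
    then show "real (card (idx_in D J C)) = (\<Sum>j\<in>J. of_bool (fst (D j) \<in> C))" by simp
  qed
  have [measurable]: "(\<lambda>D. snd (D j)) \<in> borel_measurable (PiM J (\<lambda>_. Z))" 
    "(\<lambda>D. of_bool (fst (D j) \<in> C) :: real) \<in> borel_measurable (PiM J (\<lambda>_. Z))" if "j \<in> J" for j C
  proof -
    have "snd \<in> borel_measurable Z" "(\<lambda>z. of_bool (fst z \<in> C) :: real) \<in> borel_measurable Z"
      by measurable
    from this[THEN measurable_compose[OF measurable_component_singleton[OF that]]]
    show "(\<lambda>D. snd (D j)) \<in> borel_measurable (PiM J (\<lambda>_. Z))"
      "(\<lambda>D. of_bool (fst (D j) \<in> C) :: real) \<in> borel_measurable (PiM J (\<lambda>_. Z))" .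
  qed
  show ?thesis unfolding Vsplit_def cell_mean_def sum card by measurable
qed

lemma measurable_best_splits:
  assumes "finite J"
  shows "Measurable.pred (PiM J (\<lambda>_. Z)) (\<lambda>D. i \<in> best_splits d D J A)"
proof -
  note measurable_Vsplit[OF assms, measurable]
  have "i \<in> best_splits d D J A \<longleftrightarrow> (i < d \<and> \<not> fixed_in A i) \<and>
      (\<forall>k\<in>{k. k < d \<and> \<not> fixed_in A k}. \<not> Vsplit D J A i < Vsplit D J A k)" for D
    by (auto simp: best_splits_def is_arg_max_def)
  then show ?thesis by simp
qed

lemma measurable_pmf_full_tree:
  assumes "finite J"
  shows "(\<lambda>D. pmf (full_tree (best_splits d D J) k A) \<tau>) \<in> borel_measurable (PiM J (\<lambda>_. Z))"
proof (induction k arbitrary: A \<tau>)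
  case (Suc k)
  note measurable_best_splits[OF assms, measurable] Suc.IH[measurable]
  have empty: "best_splits d D J A = {} \<longleftrightarrow> (\<forall>i\<in>{..<d}. i \<notin> best_splits d D J A)" for D
    using best_splits_subset[of d D J A] by auto
  have card: "real (card (best_splits d D J A)) = (\<Sum>i<d. of_bool (i \<in> best_splits d D J A))" for D
  proof -
    have "(\<Sum>i\<in>best_splits d D J A. 1) = (\<Sum>i<d. of_bool (i \<in> best_splits d D J A) :: real)"
      using best_splits_subset[of d D J A] by (intro sum.mono_neutral_cong_left) auto
    then show ?thesis by simp
  qed
  show ?case
  proof (cases \<tau>)
    case Leaf
    show ?thesis unfolding Leaf pmf_full_tree_Leaf empty by measurable
  next
    case (Node i l r)
    have "pmf (full_tree (best_splits d D J) (Suc k) A) \<tau>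
        = (if i \<in> best_splits d D J A then 1 / real (card (best_splits d D J A)) else 0) *
          (pmf (full_tree (best_splits d D J) k (half A i False)) l * pmf (full_tree (best_splits d D J) k (half A i True)) r)" for D
    proof (cases "best_splits d D J A = {}")
      case True
      then show ?thesis by (simp add: Node)
    next
      case False
      then show ?thesis unfolding Node pmf_full_tree_Node[where B = "best_splits d D J" and A = A, OF False]
        by (simp add: pmf_of_set indicator_def)
    qed
    then show ?thesis unfolding card by simp
  qed
qed simp

lemma regular_response: "regular I D \<Longrightarrow> j \<in> I \<Longrightarrow> \<bar>snd (D j)\<bar> \<le> 1"
proof -
  assume "regular I D" "j \<in> I"
  then have "fst (D j) \<in> cube d" "\<bar>snd (D j) - m (fst (D j))\<bar> \<le> 1 / 2" by (auto simp: regular_def noise_def)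
  then show ?thesis using m_bound[of "fst (D j)"] by linarith
qed

lemma abs_cell_mean_le:
  assumes "\<And>j. j \<in> H \<Longrightarrow> \<bar>snd (D j)\<bar> \<le> 1"
  shows "\<bar>cell_mean D H A\<bar> \<le> 1"
proof -
  have "\<bar>\<Sum>j\<in>idx_in D H A. snd (D j)\<bar> \<le> (\<Sum>j\<in>idx_in D H A. \<bar>snd (D j)\<bar>)" by (rule sum_abs)
  also have "\<dots> \<le> (\<Sum>j\<in>idx_in D H A. 1)" using assms by (intro sum_mono) (auto simp: idx_in_def)
  finally have "\<bar>\<Sum>j\<in>idx_in D H A. snd (D j)\<bar> \<le> card (idx_in D H A)" by simp
  then show ?thesis
    by (cases "card (idx_in D H A) = 0") (auto simp: cell_mean_def abs_divide divide_le_eq)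
qed

lemma block_mse_le:
  assumes "0 < N" "\<And>b j. b < N \<Longrightarrow> j \<in> H b \<Longrightarrow> \<bar>snd (D j)\<bar> \<le> 1"
  shows "block_mse H N \<tau> D \<le> 3"
proof -
  have "(m x - (\<Sum>b<N. cell_mean D (H b) (resolved_cell D (H b) \<tau> (cube d) x)) / N)\<^sup>2 \<le> 3" if "x \<in> cube d" for x
  proof -
    let ?c = "\<lambda>b. cell_mean D (H b) (resolved_cell D (H b) \<tau> (cube d) x)"
    have "\<bar>\<Sum>b<N. ?c b\<bar> \<le> (\<Sum>b<N. \<bar>?c b\<bar>)" by (rule sum_abs)
    also have "\<dots> \<le> (\<Sum>b<N. 1)" using assms(2) by (intro sum_mono abs_cell_mean_le) auto
    finally have "\<bar>(\<Sum>b<N. ?c b) / N\<bar> \<le> 1" using assms(1) by (simp add: abs_divide divide_le_eq)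
    then have "\<bar>m x - (\<Sum>b<N. ?c b) / N\<bar> \<le> 3 / 2" using m_bound[OF that] by linarith
    then have "\<bar>m x - (\<Sum>b<N. ?c b) / N\<bar>\<^sup>2 \<le> (3 / 2)\<^sup>2" by (intro power_mono) auto
    also have "(3 / 2 :: real)\<^sup>2 \<le> 3" by (simp add: power2_eq_square)
    finally show ?thesis unfolding power2_abs .
  qed
  then have "block_mse H N \<tau> D \<le> (\<Sum>x\<in>cube d. pmf Dx x * 3)"
    unfolding block_mse_def by (intro sum_mono mult_left_mono) auto
  then show ?thesis using sum_pmf_cube by (simp add: sum_distrib_right[symmetric])
qed

lemma block_mse_cong:
  assumes "\<And>b j. b < N \<Longrightarrow> j \<in> H b \<Longrightarrow> D j = D' j"
  shows "block_mse H N \<tau> D = block_mse H N \<tau> D'"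
proof -
  have "cell_mean D (H b) (resolved_cell D (H b) \<tau> (cube d) x)
      = cell_mean D' (H b) (resolved_cell D' (H b) \<tau> (cube d) x)" if "b < N" for b x
    using resolved_cell_cong[of "H b" D D' \<tau> "cube d" x] cell_mean_cong[of "H b" D D'] assms[OF that] by simp
  then show ?thesis unfolding block_mse_def by simp
qed

lemma sum_pmf_full_tree: "(\<Sum>\<tau>\<in>bounded_trees d d. pmf (full_tree (best_splits d D J) d (cube d)) \<tau>) = 1"
proof (rule sum_pmf_eq_1[OF finite_bounded_trees set_full_tree_subset])
  show "best_splits d D J A \<subseteq> {..<d}" for A by (rule order_trans[OF best_splits_subset]) auto
qed

text \<open>\<open>f\<close> adds the indicator of a bad structure sample to the total probability,
  given that sample, of the good trees for which the other data fail. By independence each good tree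
  contributes its mean probability times \<open>\<delta>2\<close>, and these probabilities sum to at
  most 1. No union over trees is taken; where there is failure the error is still at most 3.\<close>

lemma structure_average_block_mse:
  fixes H :: "nat \<Rightarrow> nat set" and thr \<delta>1 \<delta>2 :: real
  assumes V: "finite V" "J \<subseteq> V" and H: "\<And>b. b < N \<Longrightarrow> H b \<subseteq> V - J" and N: "0 < N"
    and good: "\<And>\<tau>. splits_first R \<tau> {} \<Longrightarrow>
      outer_le (PiM (V - J) (\<lambda>_. Z)) {D. regular (V - J) D \<and> thr < block_mse H N \<tau> D} \<delta>2"
    and bad: "outer_le (PiM J (\<lambda>_. Z)) {D. (\<forall>j\<in>J. \<bar>snd (D j)\<bar> \<le> 1) \<and>
      (\<exists>\<tau>\<in>set_pmf (full_tree (best_splits d D J) d (cube d)). \<not> splits_first R \<tau> {})} \<delta>1"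
    and pos: "0 \<le> thr" "0 \<le> \<delta>1" "0 \<le> \<delta>2"
  obtains f where "f \<in> borel_measurable (PiM V (\<lambda>_. Z))" "\<And>D. 0 \<le> f D"
    "(\<integral>\<^sup>+D. ennreal (f D) \<partial>PiM V (\<lambda>_. Z)) \<le> ennreal (\<delta>1 + \<delta>2)"
    "\<And>D. D \<in> space (PiM V (\<lambda>_. Z)) \<Longrightarrow> regular V D \<Longrightarrow>
      (\<Sum>\<tau>\<in>bounded_trees d d. pmf (full_tree (best_splits d D J) d (cube d)) \<tau> * block_mse H N \<tau> D) \<le> thr + 3 * f D"
proof -
  let ?K = "V - J"
  let ?MJ = "PiM J (\<lambda>_. Z)" and ?MK = "PiM ?K (\<lambda>_. Z)" and ?M = "PiM V (\<lambda>_. Z)"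
  have VJ: "J \<union> ?K = V" using V by auto
  have finJ: "finite J" by (rule finite_subset[OF V(2,1)])
  interpret MJ: prob_space ?MJ by (rule prob_space_PiM) (rule Z.prob_space_axioms)
  interpret MK: prob_space ?MK by (rule prob_space_PiM) (rule Z.prob_space_axioms)
  define good_trees where "good_trees = {\<tau> \<in> bounded_trees d d. splits_first R \<tau> {}}"
  define bad_trees where "bad_trees = {\<tau> \<in> bounded_trees d d. \<not> splits_first R \<tau> {}}"
  have fin: "finite good_trees" "finite bad_trees"
    using finite_bounded_trees[of d d] by (simp_all add: good_trees_def bad_trees_def)
  have "\<forall>\<tau>\<in>good_trees. \<exists>S. S \<in> sets ?MK \<and> {D. regular ?K D \<and> thr < block_mse H N \<tau> D} \<inter> space ?MK \<subseteq> S \<and>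
      emeasure ?MK S \<le> ennreal \<delta>2"
    using good unfolding good_trees_def outer_le_def by auto
  from bchoice[OF this] obtain S where S: "\<And>\<tau>. \<tau> \<in> good_trees \<Longrightarrow> S \<tau> \<in> sets ?MK"
      "\<And>\<tau>. \<tau> \<in> good_trees \<Longrightarrow> {D. regular ?K D \<and> thr < block_mse H N \<tau> D} \<inter> space ?MK \<subseteq> S \<tau>"
      "\<And>\<tau>. \<tau> \<in> good_trees \<Longrightarrow> emeasure ?MK (S \<tau>) \<le> ennreal \<delta>2" by auto
  obtain T where T: "T \<in> sets ?MJ" "{D. (\<forall>j\<in>J. \<bar>snd (D j)\<bar> \<le> 1) \<and>
      (\<exists>\<tau>\<in>set_pmf (full_tree (best_splits d D J) d (cube d)). \<not> splits_first R \<tau> {})} \<inter> space ?MJ \<subseteq> T"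
      "emeasure ?MJ T \<le> ennreal \<delta>1"
    using bad unfolding outer_le_def by (elim bexE conjE)
  define q where "q D \<tau> = pmf (full_tree (best_splits d D J) d (cube d)) \<tau>" for D \<tau>
  have q_meas [measurable]: "(\<lambda>D. q D \<tau>) \<in> borel_measurable ?MJ" for \<tau>
    unfolding q_def by (rule measurable_pmf_full_tree[OF finJ])
  have q_restrict: "q (restrict D J) \<tau> = q D \<tau>" for D \<tau>
    using best_splits_cong[of J "restrict D J" D d] by (simp add: q_def)
  have q0: "0 \<le> q D \<tau>" for D \<tau> by (simp add: q_def)
  have q1: "(\<Sum>\<tau>\<in>bounded_trees d d. q D \<tau>) = 1" for D unfolding q_def by (rule sum_pmf_full_tree)
  have q_good: "(\<Sum>\<tau>\<in>good_trees. q D \<tau>) \<le> 1" for D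
    unfolding q1[of D, symmetric] using q0 finite_bounded_trees by (intro sum_mono2) (auto simp: good_trees_def)
  define f :: "dataset \<Rightarrow> real" where "f D = indicator T (restrict D J) + (\<Sum>\<tau>\<in>good_trees. q (restrict D J) \<tau> * indicator (S \<tau>) (restrict D ?K))" for D
  have rJ [measurable]: "(\<lambda>D. restrict D J) \<in> ?M \<rightarrow>\<^sub>M ?MJ" by (rule measurable_restrict_subset[OF V(2)])
  have rK [measurable]: "(\<lambda>D. restrict D ?K) \<in> ?M \<rightarrow>\<^sub>M ?MK" by (rule measurable_restrict_subset) auto
  have mT [measurable]: "(\<lambda>D. indicator T (restrict D J) :: real) \<in> borel_measurable ?M"
    using T(1) by measurable
  have mS [measurable]: "(\<lambda>D. indicator (S \<tau>) (restrict D ?K) :: real) \<in> borel_measurable ?M" if "\<tau> \<in> good_trees" for \<tau>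
    using S(1)[OF that] by measurable
  have mq [measurable]: "(\<lambda>D. q (restrict D J) \<tau>) \<in> borel_measurable ?M" for \<tau>
    by (rule measurable_compose[OF rJ q_meas])
  have f_meas: "f \<in> borel_measurable ?M" unfolding f_def by measurable
  have f0: "0 \<le> f D" for D unfolding f_def using q0 by (auto intro!: add_nonneg_nonneg sum_nonneg)
  have int: "(\<integral>\<^sup>+D. ennreal (f D) \<partial>?M) \<le> ennreal (\<delta>1 + \<delta>2)"
  proof -
    have "(\<integral>\<^sup>+D. ennreal (f D) \<partial>?M) = (\<integral>\<^sup>+D. indicator T (restrict D J) +
        (\<Sum>\<tau>\<in>good_trees. ennreal (q (restrict D J) \<tau>) * indicator (S \<tau>) (restrict D ?K)) \<partial>?M)"
    proof (intro nn_integral_cong)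
      fix D
      have "ennreal (f D) = ennreal (indicator T (restrict D J)) + (\<Sum>\<tau>\<in>good_trees. ennreal (q (restrict D J) \<tau> * indicator (S \<tau>) (restrict D ?K)))"
        unfolding f_def using q0 by (subst ennreal_plus) (auto intro!: sum_nonneg simp: sum_ennreal)
      then show "ennreal (f D) = indicator T (restrict D J) +
        (\<Sum>\<tau>\<in>good_trees. ennreal (q (restrict D J) \<tau>) * indicator (S \<tau>) (restrict D ?K))"
        using q0 by (simp add: ennreal_mult ennreal_indicator)
    qed
    also have "\<dots> = (\<integral>\<^sup>+D. indicator T (restrict D J) \<partial>?M) +
        (\<Sum>\<tau>\<in>good_trees. \<integral>\<^sup>+D. ennreal (q (restrict D J) \<tau>) * indicator (S \<tau>) (restrict D ?K) \<partial>?M)"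
    proof -
      have [measurable]: "(\<lambda>D. indicator T (restrict D J) :: ennreal) \<in> borel_measurable ?M"
        using T(1) by measurable
      have [measurable]: "(\<lambda>D. ennreal (q (restrict D J) \<tau>) * indicator (S \<tau>) (restrict D ?K)) \<in> borel_measurable ?M"
        if "\<tau> \<in> good_trees" for \<tau>
        using S(1)[OF that] by measurable
      show ?thesis by (subst nn_integral_add) (auto simp: nn_integral_sum)
    qed
    also have "(\<integral>\<^sup>+D. indicator T (restrict D J) \<partial>?M) \<le> ennreal \<delta>1"
    proof -
      have "(\<integral>\<^sup>+D. indicator T (restrict D J) * 1 \<partial>PiM (J \<union> ?K) (\<lambda>_. Z))
          = (\<integral>\<^sup>+x. indicator T x \<partial>?MJ) * (\<integral>\<^sup>+y. 1 \<partial>?MK)"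
        using T(1) V(1) finJ by (intro nn_integral_PiM_product[where g = "\<lambda>_. 1"]) auto
      then show ?thesis using T(1,3) unfolding VJ by (simp add: MK.emeasure_space_1)
    qed
    also have "(\<Sum>\<tau>\<in>good_trees. \<integral>\<^sup>+D. ennreal (q (restrict D J) \<tau>) * indicator (S \<tau>) (restrict D ?K) \<partial>?M) \<le> ennreal \<delta>2"
    proof -
      have "(\<Sum>\<tau>\<in>good_trees. \<integral>\<^sup>+D. ennreal (q (restrict D J) \<tau>) * indicator (S \<tau>) (restrict D ?K) \<partial>?M)
          \<le> (\<Sum>\<tau>\<in>good_trees. (\<integral>\<^sup>+x. ennreal (q x \<tau>) \<partial>?MJ) * ennreal \<delta>2)"
      proof (intro sum_mono)
        fix \<tau> assume \<tau>: "\<tau> \<in> good_trees"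
        have "(\<integral>\<^sup>+D. ennreal (q (restrict D J) \<tau>) * indicator (S \<tau>) (restrict D ?K) \<partial>PiM (J \<union> ?K) (\<lambda>_. Z))
          = (\<integral>\<^sup>+x. ennreal (q x \<tau>) \<partial>?MJ) * (\<integral>\<^sup>+y. indicator (S \<tau>) y \<partial>?MK)"
          using S(1)[OF \<tau>] V(1) finJ by (intro nn_integral_PiM_product) auto
        also have "\<dots> \<le> (\<integral>\<^sup>+x. ennreal (q x \<tau>) \<partial>?MJ) * ennreal \<delta>2"
          using S(1,3)[OF \<tau>] by (intro mult_left_mono) auto
        finally show "(\<integral>\<^sup>+D. ennreal (q (restrict D J) \<tau>) * indicator (S \<tau>) (restrict D ?K) \<partial>?M) \<le> \<dots>"
          unfolding VJ .
      qed
      also have "\<dots> = (\<integral>\<^sup>+x. (\<Sum>\<tau>\<in>good_trees. ennreal (q x \<tau>)) \<partial>?MJ) * ennreal \<delta>2"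
        by (subst nn_integral_sum) (auto simp: sum_distrib_right)
      also have "\<dots> \<le> (\<integral>\<^sup>+x. 1 \<partial>?MJ) * ennreal \<delta>2"
        using q0 q_good by (intro mult_right_mono nn_integral_mono) (auto simp: sum_ennreal)
      finally show ?thesis by (simp add: MJ.emeasure_space_1)
    qed
    finally show ?thesis using pos by (simp add: add_mono)
  qed
  have "(\<Sum>\<tau>\<in>bounded_trees d d. q D \<tau> * block_mse H N \<tau> D) \<le> thr + 3 * f D"
    if D: "D \<in> space ?M" "regular V D" for D
  proof -
    have resp: "\<bar>snd (D j)\<bar> \<le> 1" if "j \<in> V" for j using regular_response[OF D(2) that] .
    have le3: "block_mse H N \<tau> D \<le> 3" for \<tau> using H N resp by (intro block_mse_le) auto
    have spJ: "restrict D J \<in> space ?MJ" and spK: "restrict D ?K \<in> space ?MK"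
      using measurable_space[OF rJ D(1)] measurable_space[OF rK D(1)] by auto
    have good_le: "q D \<tau> * block_mse H N \<tau> D \<le> q D \<tau> * thr + 3 * (q D \<tau> * indicator (S \<tau>) (restrict D ?K))"
      if \<tau>: "\<tau> \<in> good_trees" for \<tau>
    proof (cases "restrict D ?K \<in> S \<tau>")
      case True
      have "block_mse H N \<tau> D \<le> thr + 3" using le3[of \<tau>] pos(1) by linarith
      then have "q D \<tau> * block_mse H N \<tau> D \<le> q D \<tau> * (thr + 3)" using q0 by (intro mult_left_mono) auto
      then show ?thesis using True by (simp add: algebra_simps)
    next
      case False
      have "block_mse H N \<tau> (restrict D ?K) = block_mse H N \<tau> D"
        using H by (intro block_mse_cong) auto
      moreover have "regular ?K (restrict D ?K)" using D(2) by (simp add: regular_def)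
      ultimately have "block_mse H N \<tau> D \<le> thr" using S(2)[OF \<tau>] False spK by (auto simp: not_less)
      then show ?thesis using False q0 by (simp add: mult_left_mono)
    qed
    have bad_le: "(\<Sum>\<tau>\<in>bad_trees. q D \<tau>) \<le> indicator T (restrict D J)"
    proof (cases "restrict D J \<in> T")
      case True
      have "(\<Sum>\<tau>\<in>bad_trees. q D \<tau>) \<le> (\<Sum>\<tau>\<in>bounded_trees d d. q D \<tau>)"
        using q0 finite_bounded_trees by (intro sum_mono2) (auto simp: bad_trees_def)
      then show ?thesis using True q1 by simp
    next
      case False
      have "q (restrict D J) \<tau> = 0" if "\<tau> \<in> bad_trees" for \<tau>
      proof (rule ccontr)
        assume "q (restrict D J) \<tau> \<noteq> 0"
        then have "\<tau> \<in> set_pmf (full_tree (best_splits d (restrict D J) J) d (cube d))"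
          by (simp add: q_def pmf_eq_0_set_pmf)
        moreover have "\<forall>j\<in>J. \<bar>snd (restrict D J j)\<bar> \<le> 1" using resp V(2) by auto
        ultimately have "restrict D J \<in> T" using T(2) spJ that by (auto simp: bad_trees_def)
        then show False using False by simp
      qed
      then have "(\<Sum>\<tau>\<in>bad_trees. q D \<tau>) = 0" unfolding q_restrict by (intro sum.neutral) auto
      then show ?thesis by simp
    qed
    have union: "bounded_trees d d = good_trees \<union> bad_trees" "good_trees \<inter> bad_trees = {}"
      by (auto simp: good_trees_def bad_trees_def)
    have "(\<Sum>\<tau>\<in>bounded_trees d d. q D \<tau> * block_mse H N \<tau> D)
        = (\<Sum>\<tau>\<in>good_trees. q D \<tau> * block_mse H N \<tau> D) + (\<Sum>\<tau>\<in>bad_trees. q D \<tau> * block_mse H N \<tau> D)"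
      unfolding union(1) by (rule sum.union_disjoint[OF fin union(2)])
    moreover have "(\<Sum>\<tau>\<in>good_trees. q D \<tau> * block_mse H N \<tau> D)
        \<le> (\<Sum>\<tau>\<in>good_trees. q D \<tau>) * thr + 3 * (\<Sum>\<tau>\<in>good_trees. q D \<tau> * indicator (S \<tau>) (restrict D ?K))"
      unfolding sum_distrib_left sum_distrib_right sum.distrib[symmetric] by (intro sum_mono good_le)
    moreover have "(\<Sum>\<tau>\<in>good_trees. q D \<tau>) * thr \<le> 1 * thr" using q_good pos(1) by (intro mult_right_mono)
    moreover have "(\<Sum>\<tau>\<in>bad_trees. q D \<tau> * block_mse H N \<tau> D) \<le> (\<Sum>\<tau>\<in>bad_trees. q D \<tau>) * 3"
      unfolding sum_distrib_right using le3 q0 by (intro sum_mono mult_left_mono) auto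
    moreover have "X \<le> y + 3 * (i + c)"
      if "X = a + b" "a \<le> g + 3 * c" "g \<le> 1 * y" "b \<le> e * 3" "e \<le> i" for X a b c e g i y :: real
      using that by argo
    ultimately show ?thesis unfolding f_def q_restrict using bad_le by blast
  qed
  then show thesis using that[OF f_meas f0 int] unfolding q_def by blast
qed

text \<open>The failure functions of all permutations are averaged into \<open>F\<close>, whose
  integral is at most \<open>\<delta>1 + \<delta>2\<close>. Markov's inequality at level
  \<open>1 / n\<close> costs the factor \<open>n\<close>, and below that level failures add less
  than \<open>3 / n\<close> to the error.\<close>

lemma forest_mse_tail:
  fixes H0 :: "nat \<Rightarrow> nat set" and thr \<delta>1 \<delta>2 c :: real
  assumes grown: "fully_grown d n s t Dx E m" and s: "0 < s" and n: "0 < n"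
    and J0: "J0 \<subseteq> {..<n}" "card J0 = s div 2"
    and H0: "disjoint_family_on H0 {..<N}" "\<And>b. b < N \<Longrightarrow> H0 b \<subseteq> {..<n} - J0"
      "\<And>b. b < N \<Longrightarrow> card (H0 b) = s - s div 2" and N: "0 < N"
    and good: "\<And>J H \<tau>. J \<subseteq> {..<n} \<Longrightarrow> card J = s div 2 \<Longrightarrow> disjoint_family_on H {..<N} \<Longrightarrow>
      (\<And>b. b < N \<Longrightarrow> H b \<subseteq> {..<n} - J) \<Longrightarrow> (\<And>b. b < N \<Longrightarrow> card (H b) = s - s div 2) \<Longrightarrow> splits_first R \<tau> {} \<Longrightarrow>
      outer_le (PiM ({..<n} - J) (\<lambda>_. Z)) {D. regular ({..<n} - J) D \<and> thr < block_mse H N \<tau> D} \<delta>2"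
    and bad: "\<And>J. J \<subseteq> {..<n} \<Longrightarrow> card J = s div 2 \<Longrightarrow>
      outer_le (PiM J (\<lambda>_. Z)) {D. (\<forall>j\<in>J. \<bar>snd (D j)\<bar> \<le> 1) \<and>
        (\<exists>\<tau>\<in>set_pmf (full_tree (best_splits d D J) d (cube d)). \<not> splits_first R \<tau> {})} \<delta>1"
    and pos: "0 \<le> thr" "0 \<le> \<delta>1" "0 \<le> \<delta>2" and c: "thr + 3 / n \<le> c"
  shows "emeasure (sample_dist n Dx E m) {D \<in> space (sample_dist n Dx E m). c < mse Dx m (forest d n s t D)}
    \<le> ennreal (n * (\<delta>1 + \<delta>2))"
proof -
  let ?M = "PiM {..<n} (\<lambda>_. Z)"
  define S where "S = {\<sigma>. \<sigma> permutes {..<n}}"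
  have finS: "finite S" unfolding S_def by (intro finite_permutations) simp
  have cardS: "real (card S) = fact n" unfolding S_def using card_permutations[of "{..<n}" n] by simp
  let ?T = "bounded_trees d d"
  let ?q = "\<lambda>\<sigma> D \<tau>. pmf (full_tree (best_splits d D (\<sigma> ` J0)) d (cube d)) \<tau>"
  let ?H = "\<lambda>\<sigma> b. \<sigma> ` H0 b"
  have "\<exists>f. f \<in> borel_measurable ?M \<and> (\<forall>D. 0 \<le> f D) \<and> (\<integral>\<^sup>+D. ennreal (f D) \<partial>?M) \<le> ennreal (\<delta>1 + \<delta>2) \<and>
      (\<forall>D\<in>space ?M. regular {..<n} D \<longrightarrow> (\<Sum>\<tau>\<in>?T. ?q \<sigma> D \<tau> * block_mse (?H \<sigma>) N \<tau> D) \<le> thr + 3 * f D)"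
    if "\<sigma> \<in> S" for \<sigma>
  proof -
    have p: "\<sigma> permutes {..<n}" using that by (simp add: S_def)
    note inj = permutes_inj[OF p] and im = permutes_image[OF p]
    have J: "\<sigma> ` J0 \<subseteq> {..<n}" "card (\<sigma> ` J0) = s div 2"
      using J0 im card_image[OF inj_on_subset[OF inj], of J0] by auto
    have H: "?H \<sigma> b \<subseteq> {..<n} - \<sigma> ` J0" "card (?H \<sigma> b) = s - s div 2" if "b < N" for b
      using image_mono[OF H0(2)[OF that], of \<sigma>] im H0(3)[OF that] card_image[OF inj_on_subset[OF inj], of "H0 b"]
      by (auto simp: image_set_diff[OF inj])
    have disj: "disjoint_family_on (?H \<sigma>) {..<N}"
      using H0(1) unfolding disjoint_family_on_def by (simp add: image_Int[OF inj, symmetric])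
    show ?thesis
      by (rule structure_average_block_mse[OF finite_lessThan J(1) H(1) N good[OF J disj H] bad[OF J] pos]) blast+
  qed
  then have "\<forall>\<sigma>\<in>S. \<exists>f. f \<in> borel_measurable ?M \<and> (\<forall>D. 0 \<le> f D) \<and> (\<integral>\<^sup>+D. ennreal (f D) \<partial>?M) \<le> ennreal (\<delta>1 + \<delta>2) \<and>
      (\<forall>D\<in>space ?M. regular {..<n} D \<longrightarrow> (\<Sum>\<tau>\<in>?T. ?q \<sigma> D \<tau> * block_mse (?H \<sigma>) N \<tau> D) \<le> thr + 3 * f D)"
    by blast
  from bchoice[OF this] obtain f where f: "\<And>\<sigma>. \<sigma> \<in> S \<Longrightarrow> f \<sigma> \<in> borel_measurable ?M"
      "\<And>\<sigma> D. \<sigma> \<in> S \<Longrightarrow> 0 \<le> f \<sigma> D" "\<And>\<sigma>. \<sigma> \<in> S \<Longrightarrow> (\<integral>\<^sup>+D. ennreal (f \<sigma> D) \<partial>?M) \<le> ennreal (\<delta>1 + \<delta>2)"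
      "\<And>\<sigma> D. \<sigma> \<in> S \<Longrightarrow> D \<in> space ?M \<Longrightarrow> regular {..<n} D \<Longrightarrow>
        (\<Sum>\<tau>\<in>?T. ?q \<sigma> D \<tau> * block_mse (?H \<sigma>) N \<tau> D) \<le> thr + 3 * f \<sigma> D"
    by (elim exE) blast
  define F where "F D = (\<Sum>\<sigma>\<in>S. f \<sigma> D) / fact n" for D
  have F_meas [measurable]: "F \<in> borel_measurable ?M" unfolding F_def using f(1) by measurable
  have F0: "0 \<le> F D" for D unfolding F_def using f(2) by (intro divide_nonneg_nonneg sum_nonneg) auto
  have int: "(\<integral>\<^sup>+D. ennreal (F D) \<partial>?M) \<le> ennreal (\<delta>1 + \<delta>2)"
  proof -
    have "(\<integral>\<^sup>+D. ennreal (F D) \<partial>?M) = (\<integral>\<^sup>+D. ennreal (1 / fact n) * (\<Sum>\<sigma>\<in>S. ennreal (f \<sigma> D)) \<partial>?M)"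
      unfolding F_def using f(2) by (intro nn_integral_cong) (simp add: sum_ennreal sum_nonneg ennreal_mult[symmetric])
    also have "\<dots> = ennreal (1 / fact n) * (\<Sum>\<sigma>\<in>S. \<integral>\<^sup>+D. ennreal (f \<sigma> D) \<partial>?M)"
      using f(1) by (subst nn_integral_cmult) (auto simp: nn_integral_sum)
    also have "\<dots> \<le> ennreal (1 / fact n) * (\<Sum>\<sigma>\<in>S. ennreal (\<delta>1 + \<delta>2))"
      by (intro mult_left_mono sum_mono f(3)) auto
    also have "\<dots> = ennreal (1 / fact n * (card S * (\<delta>1 + \<delta>2)))"
      using pos by (simp add: ennreal_mult[symmetric] ennreal_of_nat_eq_real_of_nat del: ennreal_plus)
    also have "\<dots> = ennreal (\<delta>1 + \<delta>2)" unfolding cardS by simp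
    finally show ?thesis .
  qed
  have bound: "mse Dx m (forest d n s t D) \<le> thr + 3 * F D"
    if D: "D \<in> space ?M" "regular {..<n} D" and g: "grown d n s t D" for D
  proof -
    have cube: "fst (D j) \<in> cube d" if "j < n" for j using D(2) that by (simp add: regular_def)
    let ?p = "\<lambda>(\<sigma>, \<tau>). ?q \<sigma> D \<tau> / fact n"
    let ?a = "\<lambda>x (\<sigma>, \<tau>). (\<Sum>b<N. cell_mean D (?H \<sigma> b) (resolved_cell D (?H \<sigma> b) \<tau> (cube d) x)) / N"
    have fst: "forest d n s t D x = (\<Sum>i\<in>S \<times> ?T. ?p i * ?a x i)" for x
      using forest_eq_block_average[OF g cube s J0 H0(2,3) N, where x = x]
      unfolding S_def by (simp add: sum.cartesian_product split_beta)
    have p1: "(\<Sum>i\<in>S \<times> ?T. ?p i) = 1"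
    proof -
      have "(\<Sum>i\<in>S \<times> ?T. ?p i) = (\<Sum>\<sigma>\<in>S. (\<Sum>\<tau>\<in>?T. ?q \<sigma> D \<tau>) / fact n)"
        by (simp add: sum.cartesian_product split_beta sum_divide_distrib)
      also have "\<dots> = real (card S) / fact n" by (simp add: sum_pmf_full_tree)
      finally show ?thesis by (simp add: cardS)
    qed
    have "mse Dx m (forest d n s t D) = (\<Sum>x\<in>cube d. (m x - forest d n s t D x)\<^sup>2 * pmf Dx x)"
      unfolding mse_def using set_pmf_Dx finite_cube by (intro integral_measure_pmf_real) auto
    also have "\<dots> \<le> (\<Sum>x\<in>cube d. (\<Sum>i\<in>S \<times> ?T. ?p i * (m x - ?a x i)\<^sup>2) * pmf Dx x)"
      unfolding fst using finS finite_bounded_trees p1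
      by (intro sum_mono mult_right_mono weighted_square_le) auto
    also have "\<dots> = (\<Sum>i\<in>S \<times> ?T. ?p i * (\<Sum>x\<in>cube d. pmf Dx x * (m x - ?a x i)\<^sup>2))"
      by (simp only: sum_distrib_right sum_distrib_left mult_ac) (rule sum.swap)
    also have "\<dots> = (\<Sum>\<sigma>\<in>S. (\<Sum>\<tau>\<in>?T. ?q \<sigma> D \<tau> * block_mse (?H \<sigma>) N \<tau> D) / fact n)"
      by (simp add: sum.cartesian_product split_beta sum_divide_distrib block_mse_def)
    also have "\<dots> \<le> (\<Sum>\<sigma>\<in>S. (thr + 3 * f \<sigma> D) / fact n)"
      using f(4)[OF _ D] by (intro sum_mono divide_right_mono) auto
    also have "\<dots> = (real (card S) * thr + 3 * (\<Sum>\<sigma>\<in>S. f \<sigma> D)) / fact n"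
      by (simp add: sum_divide_distrib[symmetric] sum.distrib sum_distrib_left)
    also have "\<dots> = thr + 3 * F D" unfolding cardS F_def by (simp add: add_divide_distrib)
    finally show ?thesis .
  qed
  have AE_regular: "AE D in ?M. regular {..<n} D"
  proof -
    have "AE D in ?M. \<forall>j\<in>{..<n}. fst (D j) \<in> cube d \<and> \<bar>snd (D j) - m (fst (D j))\<bar> \<le> 1 / 2"
    proof (rule AE_finite_allI)
      fix j assume "j \<in> {..<n}"
      then show "AE D in ?M. fst (D j) \<in> cube d \<and> \<bar>snd (D j) - m (fst (D j))\<bar> \<le> 1 / 2"
        by (rule AE_PiM_component[OF Z.prob_space_axioms _ AE_Z])
    qed simp
    then show ?thesis unfolding regular_def noise_def .
  qed
  have AE_grown: "AE D in ?M. grown d n s t D"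
    using grown unfolding fully_grown_def sample_dist_def grown_def .
  \<comment> \<open>This set is measurable and contains the event almost surely, so the bound does
    not rest on the measurability of the event.\<close>
  let ?B = "{D \<in> space ?M. 1 \<le> ennreal n * ennreal (F D)}"
  have "emeasure ?M {D \<in> space ?M. c < mse Dx m (forest d n s t D)} \<le> emeasure ?M ?B"
  proof (rule emeasure_mono_AE)
    show "AE D in ?M. D \<in> {D \<in> space ?M. c < mse Dx m (forest d n s t D)} \<longrightarrow> D \<in> ?B"
      using AE_regular AE_grown
    proof eventually_elim
      case (elim D)
      show ?case
      proof
        assume D: "D \<in> {D \<in> space ?M. c < mse Dx m (forest d n s t D)}"
        then have "thr + 3 / n < thr + 3 * F D" using bound[OF _ elim] c by force
        then have "1 \<le> n * F D" using n by (simp add: field_simps)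
        then have "1 \<le> ennreal (n * F D)" by simp
        then show "D \<in> ?B" using D by (simp add: ennreal_mult')
      qed
    qed
  qed measurable
  also have "\<dots> \<le> ennreal n * (\<integral>\<^sup>+D. ennreal (F D) * indicator (space ?M) D \<partial>?M)"
    by (rule nn_integral_Markov_inequality) measurable
  also have "(\<integral>\<^sup>+D. ennreal (F D) * indicator (space ?M) D \<partial>?M) = (\<integral>\<^sup>+D. ennreal (F D) \<partial>?M)"
    by (intro nn_integral_cong) simp
  also have "ennreal n * \<dots> \<le> ennreal n * ennreal (\<delta>1 + \<delta>2)" by (intro mult_left_mono int) auto
  also have "\<dots> = ennreal (n * (\<delta>1 + \<delta>2))" using pos by (simp add: ennreal_mult')
  finally show ?thesis unfolding sample_dist_def .
qed

end

section \<open>Constants\<close>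

context regression
begin

lemma prob_agreeing:
  assumes "R \<subseteq> {..<d}" "z \<in> cube d"
  shows "\<mu> (agreeing d R z) = \<mu> {x. nths x R = nths z R}"
proof -
  have "agreeing d R z = {x. nths x R = nths z R} \<inter> set_pmf Dx"
    unfolding agreeing_eq_nths[OF assms(2,1)] set_pmf_Dx by auto
  then show ?thesis by (simp add: measure_Int_set_pmf)
qed

text \<open>The lower bounds for the \<open>2 ^ r\<close> patterns on one set of \<open>r\<close>
  coordinates add up to \<open>\<zeta>\<close>, while the probabilities add up to at most 1.\<close>

lemma lower_bounded_le_1:
  assumes "lower_bounded d Dx \<zeta> r" "R \<subseteq> {..<d}" "card R = r"
  shows "\<zeta> \<le> 1"
proof -
  let ?p = "map_pmf (\<lambda>x. nths x R) Dx"
  have fin: "finite (cube r)" by (rule finite_cube)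
  have "(\<Sum>w\<in>cube r. \<zeta> / 2 ^ r) \<le> (\<Sum>w\<in>cube r. pmf ?p w)"
    using assms by (intro sum_mono) (auto simp: pmf_map vimage_def lower_bounded_def)
  also have "\<dots> \<le> 1"
    unfolding measure_measure_pmf_finite[OF fin, symmetric] by (rule measure_pmf.prob_le_1)
  finally show ?thesis by (simp add: card_cube)
qed

end

text \<open>Powers of \<open>1 / 2\<close> above \<open>v / 2\<close>. As
  \<open>v \<ge> 1 / n\<close>, exponents up to \<open>1 + log 2 n\<close> suffice, so the number of
  levels does not involve the dimension.\<close>

lemma dyadic_levels:
  fixes v :: real and n :: nat
  assumes n: "0 < n" and v: "1 / n \<le> v"
  obtains L :: "real set" where "finite L" "\<And>a. a \<in> L \<Longrightarrow> v / 2 < a" "real (card L) \<le> 2 + log 2 n"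
    "\<And>u. v \<le> u \<Longrightarrow> u \<le> 1 \<Longrightarrow> \<exists>a\<in>L. a \<le> u \<and> u < 2 * a"
proof
  define K where "K = nat \<lfloor>1 + log 2 (real n)\<rfloor>"
  let ?L = "(\<lambda>i. (1 / 2) ^ i :: real) ` {i. i \<le> K \<and> v / 2 < (1 / 2) ^ i}"
  have log0: "0 \<le> log 2 (real n)" using n by simp
  have v0: "0 < v" using n v less_le_trans[of 0 "1 / real n" v] by simp
  show "finite ?L" by simp
  show "v / 2 < a" if "a \<in> ?L" for a using that by auto
  show "real (card ?L) \<le> 2 + log 2 n"
  proof -
    have "card ?L \<le> card {i. i \<le> K \<and> v / 2 < (1 / 2) ^ i}" by (rule card_image_le) simp
    also have "\<dots> \<le> card {..K}" by (intro card_mono) auto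
    finally have "real (card ?L) \<le> real K + 1" by simp
    also have "real K \<le> 1 + log 2 n" unfolding K_def using log0 by (simp add: of_nat_nat)
    finally show ?thesis by simp
  qed
  show "\<exists>a\<in>?L. a \<le> u \<and> u < 2 * a" if u: "v \<le> u" "u \<le> 1" for u
  proof -
    have u0: "0 < u" using v0 u by simp
    have ex: "\<exists>i. (1 / 2) ^ i \<le> u"
      using real_arch_pow_inv[OF u0, of "1 / 2"] by (auto intro: less_imp_le)
    define i where "i = (LEAST i. (1 / 2) ^ i \<le> u)"
    have le: "(1 / 2) ^ i \<le> u" unfolding i_def by (rule LeastI_ex[OF ex])
    have less: "u < 2 * (1 / 2) ^ i"
    proof (cases i)
      case 0
      then show ?thesis using u by simp
    next
      case (Suc j)
      have "\<not> (1 / 2) ^ j \<le> u" using not_less_Least[of j "\<lambda>i. (1 / 2) ^ i \<le> u"] Suc unfolding i_def by simp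
      then show ?thesis using Suc by simp
    qed
    have "i \<le> K"
    proof -
      have "v < 2 * (1 / 2) ^ i" using less u by linarith
      then have "1 / n < 2 * (1 / 2) ^ i" using v by linarith
      then have "2 ^ i < 2 * real n" using n by (simp add: power_one_over field_simps)
      then have "log 2 (2 ^ i) \<le> log 2 (2 * real n)" using n by (intro log_mono) auto
      then have "real i \<le> 1 + log 2 n" using n by (simp add: log_mult)
      then show ?thesis unfolding K_def by (rule le_nat_floor)
    qed
    then show ?thesis using le less u by (intro bexI[of _ "(1 / 2) ^ i"]) auto
  qed
qed

lemma ln_le_log2:
  assumes "1 \<le> (x::real)"
  shows "ln x \<le> log 2 x"
proof -
  have "ln x * ln 2 \<le> ln x * 1" using assms ln_2_less_1 by (intro mult_left_mono) auto
  then show ?thesis by (simp add: log_def le_divide_eq)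
qed

lemma exp_neg_log_le:
  assumes "1 \<le> (x::real)"
  shows "exp (- log 2 x) \<le> 1 / x"
proof -
  have "ln x \<le> log 2 x" using assms by (rule ln_le_log2)
  then have "exp (- log 2 x) \<le> exp (- ln x)" by simp
  also have "exp (- ln x) = 1 / x" using assms by (simp add: exp_minus divide_inverse)
  finally show ?thesis .
qed

text \<open>The constant 27040 is 10 times 2704. Both logarithmic factors are at least 1, so twice
  their product dominates their sum, and \<open>a / 2704\<close> is at least 5 times that sum. This
  pays for \<open>d / \<delta>\<close>, \<open>n\<^sup>2\<close>, \<open>4 ^ r\<close> and 19 at
  once.\<close>

lemma failure_probability_le:
  fixes a d n \<delta> :: real and r :: nat
  assumes d: "1 \<le> d" and n: "1 \<le> n" and \<delta>: "0 < \<delta>" "2 \<le> d / \<delta>"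
    and a: "27040 * log 2 (d / \<delta>) * L \<le> a" and L: "1 + log 2 n + r \<le> L"
  shows "19 * d * 4 ^ r * n\<^sup>2 * exp (- (a / 2704)) \<le> \<delta>"
proof -
  let ?\<Lambda> = "log 2 (d / \<delta>)"
  have n0: "0 \<le> log 2 n" using n by simp
  have \<Lambda>: "1 \<le> ?\<Lambda>" using \<delta> log_mono[of 2 2 "d / \<delta>"] by simp
  have L1: "1 \<le> L" using L n0 by linarith
  have "0 \<le> (?\<Lambda> - 1) * L + (L - 1) * ?\<Lambda>" using \<Lambda> L1 by (intro add_nonneg_nonneg mult_nonneg_nonneg) auto
  then have "?\<Lambda> + L \<le> 2 * (?\<Lambda> * L)" by (simp add: algebra_simps)
  then have "5 * (?\<Lambda> + L) \<le> 10 * (?\<Lambda> * L)" by simp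
  also have "10 * (?\<Lambda> * L) \<le> a / 2704" using a by (simp add: field_simps)
  finally have "5 * ?\<Lambda> + (5 + 5 * log 2 n + 5 * r) \<le> a / 2704" using L by simp
  then have "?\<Lambda> + 5 + 2 * log 2 n + 2 * r \<le> a / 2704" using \<Lambda> n0 by simp
  then have "exp (- (a / 2704)) \<le> exp (- ?\<Lambda>) * exp (- 5) * exp (- log 2 n) ^ 2 * exp (- 2) ^ r"
    by (simp add: exp_of_nat_mult[symmetric] exp_add[symmetric] power2_eq_square)
  also have "\<dots> \<le> 1 / (d / \<delta>) * (1 / 19) * (1 / n) ^ 2 * (1 / 4) ^ r"
  proof (intro mult_mono power_mono)
    show "exp (- ?\<Lambda>) \<le> 1 / (d / \<delta>)" using \<delta> by (intro exp_neg_log_le) linarith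
    show "exp (- log 2 n) \<le> 1 / n" using n by (rule exp_neg_log_le)
    have e: "(2::real) \<le> exp 1" using exp_ge_add_one_self[of "1::real"] by simp
    have "(2::real) ^ 2 \<le> exp 1 ^ 2" "(2::real) ^ 5 \<le> exp 1 ^ 5" using e by (intro power_mono; simp)+
    then have "(4::real) \<le> exp 2" "(19::real) \<le> exp 5" by (simp_all add: exp_of_nat_mult[symmetric])
    then show "exp (- 2) \<le> (1 / 4 :: real)" "exp (- 5) \<le> (1 / 19 :: real)"
      by (simp_all add: exp_minus field_simps)
  qed (use \<delta> d n in auto)
  finally have "exp (- (a / 2704)) \<le> 1 / (d / \<delta>) * (1 / 19) * (1 / n) ^ 2 * (1 / 4) ^ r" .
  then have "19 * d * 4 ^ r * n\<^sup>2 * exp (- (a / 2704)) \<le> 19 * d * 4 ^ r * n\<^sup>2 * (1 / (d / \<delta>) * (1 / 19) * (1 / n) ^ 2 * (1 / 4) ^ r)"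
    using d n by (intro mult_left_mono mult_nonneg_nonneg) auto
  also have "\<dots> = \<delta>" using d n \<delta> by (simp add: power_one_over field_simps)
  finally show ?thesis .
qed

context regression
begin

lemma forest_mse_bound:
  fixes \<beta> \<zeta> \<delta> c :: real
  assumes \<zeta>: "0 < \<zeta>" "lower_bounded d Dx \<zeta> r" and \<beta>: "0 < \<beta>" "\<beta> \<le> 1"
    and sparse: "strongly_partition_sparse d Dx m \<beta> r"
    and \<delta>: "0 < \<delta>" "2 \<le> d / \<delta>" and sn: "s \<le> n"
    and s: "27040 * size_rate d r \<beta> \<zeta> \<delta> * L \<le> s"
    and grown: "fully_grown d n s t Dx E m"
    and L: "1 \<le> L" "1 + log 2 n + r \<le> L"
    and c: "1095 * (1 + log 2 n) * s / n \<le> c"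
  shows "measure (sample_dist n Dx E m) {D \<in> space (sample_dist n Dx E m). c < mse Dx m (forest d n s t D)} \<le> \<delta>"
proof -
  obtain R where R: "sparse_with d m r R" and sps: "\<forall>A\<in>cells d. \<forall>T. T \<subseteq> {..<d} \<longrightarrow>
         (\<forall>j\<in>{..<d} - R. \<forall>i\<in>R - T. \<not> fixed_in A i \<longrightarrow>
           Vbar Dx m A (T \<union> {j}) - Vbar Dx m A T + \<beta> \<le> Vbar Dx m A (T \<union> {i}) - Vbar Dx m A T)"
    using sparse unfolding strongly_partition_sparse_def by (elim exE conjE)
  have Rd: "R \<subseteq> {..<d}" "card R = r" using R by (auto simp: sparse_with_def)
  \<comment> \<open>Sparsity is taken at \<open>T = {}\<close>: it compares single cuts of the
    current cell.\<close>
  have gap: "Vbar Dx m (agreeing d F z) {j} + \<beta> \<le> Vbar Dx m (agreeing d F z) {i}"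
    if "F \<subseteq> R" "z \<in> cube d" "i \<in> R - F" "j \<in> {..<d} - R" for F z i j
  proof -
    have "agreeing d F z \<in> cells d" using that Rd by (intro agreeing_in_cells) auto
    moreover have "\<not> fixed_in (agreeing d F z) i" using that Rd by (subst fixed_in_agreeing) auto
    moreover have "i \<in> R - {}" using that by simp
    ultimately have "Vbar Dx m (agreeing d F z) ({} \<union> {j}) - Vbar Dx m (agreeing d F z) {} + \<beta>
        \<le> Vbar Dx m (agreeing d F z) ({} \<union> {i}) - Vbar Dx m (agreeing d F z) {}"
      using sps that(4) by blast
    then show ?thesis by simp
  qed
  have \<zeta>1: "\<zeta> \<le> 1" by (rule lower_bounded_le_1[OF \<zeta>(2) Rd])
  define \<zeta>' where "\<zeta>' = \<zeta> / 2 ^ r"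
  \<comment> \<open>All failure exponents are at least \<open>a / 2704\<close>, apart from the
    constant 1 in \<open>exp (1 - h / 32)\<close>, which becomes a factor 3. The strictest one comes
    from the splits: 676 for the concentration, times 4 because the structure sample has at least
    \<open>s / 4\<close> points.\<close>
  define a where "a = s * \<zeta>' * \<beta>\<^sup>2"
  define X where "X = exp (- (a / 2704))"
  have "\<zeta> \<le> 2 ^ r" using \<zeta>1 one_le_power[of "2::real" r] by linarith
  then have \<zeta>': "0 < \<zeta>'" "\<zeta>' \<le> 1" using \<zeta>(1) by (auto simp: \<zeta>'_def divide_le_eq)
  have lower: "\<zeta>' \<le> \<mu> (agreeing d R z)" if "z \<in> cube d" for z
    using \<zeta>(2) Rd nths_in_cube[OF that Rd(1)] unfolding prob_agreeing[OF Rd(1) that] \<zeta>'_def lower_bounded_def by blast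
  have \<beta>2: "0 < \<beta>\<^sup>2" "\<beta>\<^sup>2 \<le> 1" using \<beta> by (auto simp: power_le_one)
  let ?\<Lambda> = "log 2 (d / \<delta>)"
  have \<Lambda>: "1 \<le> ?\<Lambda>" using \<delta> log_mono[of 2 2 "d / \<delta>"] by simp
  have d: "1 \<le> real d" using \<delta> by (cases d) auto
  have a_ge: "27040 * ?\<Lambda> * L \<le> a"
  proof -
    have "27040 * ?\<Lambda> * L = 27040 * size_rate d r \<beta> \<zeta> \<delta> * L * (\<zeta>' * \<beta>\<^sup>2)"
      using \<zeta>(1) \<beta>(1) by (simp add: size_rate_def \<zeta>'_def field_simps)
    also have "\<dots> \<le> s * (\<zeta>' * \<beta>\<^sup>2)" using s \<zeta>' \<beta>2 by (intro mult_right_mono) auto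
    finally show ?thesis by (simp add: a_def mult.assoc)
  qed
  have "1 * 1 \<le> ?\<Lambda> * L" using \<Lambda> L(1) by (intro mult_mono) auto
  then have a_big: "27040 \<le> a" using a_ge by simp
  have s\<zeta>: "a \<le> s * \<zeta>'" using \<zeta>' \<beta>2 mult_left_mono[of "\<beta>\<^sup>2" 1 "s * \<zeta>'"] by (simp add: a_def)
  have as: "a \<le> s" using s\<zeta> \<zeta>' mult_left_mono[of \<zeta>' 1 "real s"] by simp
  have s2: "2 \<le> s" using as a_big by linarith
  define k where "k = s div 2"
  define h where "h = s - s div 2"
  have kh: "0 < k" "0 < h" "k + h = s" "h \<le> n - k" "k \<le> n" using s2 sn by (auto simp: k_def h_def)
  \<comment> \<open>Rounding \<open>s div 2\<close> down loses at most a factor 2, since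
    \<open>2 \<le> s\<close>.\<close>
  have real_kh: "s / 4 \<le> k" "s / 2 \<le> h" "real h \<le> s" "2 * real k \<le> s"
    using s2 by (simp_all add: k_def h_def)
  define N where "N = (n - k) div h"
  have N: "0 < N" using kh by (simp add: N_def div_greater_zero_iff)
  have Nh: "N * h \<le> n - k" unfolding N_def by simp
  have "n - k < (N + 1) * h" unfolding N_def using kh(2) dividend_less_div_times[of h "n - k"] by simp
  also have "(N + 1) * h \<le> 2 * N * h" using N by (intro mult_right_mono) auto
  finally have nk: "n - k \<le> 2 * N * h" by simp
  have n4: "real n \<le> 4 * N * s"
  proof -
    have "real n \<le> 2 * real (n - k)" using kh(5) real_kh(4) sn by (simp add: of_nat_diff)
    also have "\<dots> \<le> 2 * real (2 * N * h)" using nk by (intro mult_left_mono of_nat_mono) auto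
    also have "\<dots> \<le> 2 * (2 * real N * real s)" using real_kh(3) by (simp add: mult_left_mono)
    finally show ?thesis by simp
  qed
  have n1: "1 \<le> real n" using s2 sn by simp
  have "N * 1 \<le> N * h" using kh(2) by (intro mult_left_mono) auto
  then have "N \<le> n" using Nh by linarith
  then have Nn: "real N \<le> n" by simp
  let ?l = "log 2 (real n)"
  have l0: "0 \<le> ?l" using n1 by simp
  have lnl: "ln n \<le> ?l" "0 \<le> ln (real n)"
    using n1 ln_le_log2 by simp_all
  have l_le: "?l \<le> n"
  proof -
    have "real n \<le> 2 ^ n" by (rule less_imp_le[OF of_nat_less_two_power])
    then have "?l \<le> log 2 (2 ^ n)" using n1 by (intro log_mono) auto
    then show ?thesis by simp
  qed
  \<comment> \<open>Chosen so that a level \<open>b > v / 2\<close> satisfies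
    \<open>h * b / 16 \<ge> 1 + 2 * ln n\<close>. The exponential is then at most
    \<open>1 / n\<^sup>2\<close>, and times \<open>N \<le> n\<close> it stays below the level
    itself.\<close>
  define v where "v = 32 * (1 + 2 * ln n) / h"
  have hv: "h * v = 32 * (1 + 2 * ln n)" using kh(2) by (simp add: v_def)
  have v_ge: "32 / n \<le> v"
  proof -
    have "32 / n \<le> 32 / real h" using real_kh(3) sn kh(2) by (intro divide_left_mono) auto
    also have "\<dots> \<le> v" unfolding v_def using lnl(2) by (intro divide_right_mono) auto
    finally show ?thesis .
  qed
  have "1 / n \<le> 32 / n" using n1 by (intro divide_right_mono) auto
  then have v1: "1 / n \<le> v" using v_ge by linarith
  have v0: "0 < v" using v_ge n1 less_le_trans[of 0 "32 / real n" v] by simp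
  obtain Lv :: "real set" where Lv: "finite Lv" "\<And>b. b \<in> Lv \<Longrightarrow> v / 2 < b" "real (card Lv) \<le> 2 + ?l"
    "\<And>u. v \<le> u \<Longrightarrow> u \<le> 1 \<Longrightarrow> \<exists>b\<in>Lv. b \<le> u \<and> u < 2 * b"
    using dyadic_levels[OF _ v1] n1 by auto
  have level: "N * exp (- (h * b / 16)) \<le> b" if "b \<in> Lv" for b :: real
  proof -
    have "h * (v / 2) \<le> h * b" using Lv(2)[OF that] by (intro mult_left_mono) auto
    then have "1 + 2 * ln n \<le> h * b / 16" using hv by simp
    then have "exp (- (h * b / 16)) \<le> exp (- (2 * ln n))" by simp
    also have "\<dots> = 1 / real n ^ 2" using n1 exp_of_nat_mult[of 2 "ln (real n)"] by (simp add: exp_minus divide_inverse)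
    finally have "N * exp (- (h * b / 16)) \<le> n * (1 / real n ^ 2)" using Nn by (intro mult_mono) auto
    also have "\<dots> = 1 / n" using n1 by (simp add: power2_eq_square)
    also have "\<dots> \<le> 16 / n" using n1 by (intro divide_right_mono) auto
    also have "\<dots> \<le> v / 2" using v_ge by simp
    finally show ?thesis using Lv(2)[OF that] by linarith
  qed
  define w where "w = v + 4 / h * (1 + max 0 (ln (1 / v)))"
  define thr where "thr = 4 * real h * w / real N + real (card Lv) / (2 * real N)"
  define \<delta>1 where "\<delta>1 = 8 * d * 4 ^ r * exp (- (k * \<zeta>' * \<beta>\<^sup>2 / 676))"
  define \<delta>2 where "\<delta>2 = real N * 2 ^ r * exp (- (real h * \<zeta>')) + real (card Lv) * exp (1 - real h / 32) + exp (- (2 * real h / 3))"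
  \<comment> \<open>The sum of \<open>32 * (1 + 2 * ln n)\<close> and \<open>4 * (1 + ln n)\<close>
    is \<open>36 + 68 * ln n\<close>.\<close>
  have hw: "h * w \<le> 68 * (1 + ?l)"
  proof -
    have "ln (1 / v) \<le> ln n"
      using v1 v0 n1 by (intro ln_mono) (auto simp: field_simps)
    then have "max 0 (ln (1 / v)) \<le> ln n" using lnl(2) by simp
    moreover have "h * w = h * v + 4 * (1 + max 0 (ln (1 / v)))" using kh(2) by (simp add: w_def distrib_left)
    ultimately have "h * w \<le> 32 * (1 + 2 * ln n) + 4 * (1 + ln n)" unfolding hv by simp
    then show ?thesis using lnl(1) by simp
  qed
  have w0: "0 \<le> w" unfolding w_def using v0 by (intro add_nonneg_nonneg mult_nonneg_nonneg) auto
  have thr0: "0 \<le> thr" unfolding thr_def using w0 by (intro add_nonneg_nonneg divide_nonneg_nonneg mult_nonneg_nonneg) auto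
  \<comment> \<open>Four times 68, plus 1 for the half of \<open>card Lv\<close>, is 273. The bound
    \<open>n \<le> 4 * N * s\<close> makes this 1092, and the term \<open>3 / n\<close> makes it
    1095.\<close>
  have thr: "thr + 3 / n \<le> c"
  proof -
    have "thr = (4 * (h * w) + card Lv / 2) / N" using N by (simp add: thr_def add_divide_distrib)
    also have "\<dots> \<le> (273 * (1 + ?l)) / N" using hw Lv(3) l0 by (intro divide_right_mono) auto
    also have "\<dots> \<le> 273 * (1 + ?l) * (4 * s / n)"
    proof -
      have "1 / N \<le> 4 * s / n" using n4 N n1 by (simp add: field_simps)
      then have "273 * (1 + ?l) * (1 / N) \<le> 273 * (1 + ?l) * (4 * s / n)" using l0 by (intro mult_left_mono) auto
      then show ?thesis by simp
    qed
    also have "\<dots> = 1092 * ((1 + ?l) * s / n)"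
    proof -
      have "273 * y * (4 * s / n) = 1092 * (y * s / n)" for y :: real by simp
      then show ?thesis .
    qed
    finally have 1: "thr \<le> 1092 * ((1 + ?l) * s / n)" .
    have "1 * 1 \<le> (1 + ?l) * s" using l0 s2 by (intro mult_mono) auto
    then have "3 / n \<le> 3 * ((1 + ?l) * s / n)" using n1 by (simp add: divide_right_mono)
    then have "thr + 3 / n \<le> 1095 * ((1 + ?l) * s / n)" using 1 by simp
    also have "\<dots> = 1095 * (1 + ?l) * s / n"
    proof -
      have "1095 * (y * s / n) = 1095 * y * s / n" for y :: real by simp
      then show ?thesis .
    qed
    also note c
    finally show ?thesis .
  qed
  have \<delta>_bound: "n * (\<delta>1 + \<delta>2) \<le> \<delta>"
  proof -
    have X: "exp (- y) \<le> X" if "a / 2704 \<le> y" for y using that by (simp add: X_def)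
    have X0: "0 \<le> X" by (simp add: X_def)
    have "a / 4 \<le> k * \<zeta>' * \<beta>\<^sup>2"
      using mult_right_mono[OF real_kh(1), of "\<zeta>' * \<beta>\<^sup>2"] \<zeta>' by (simp add: a_def mult_ac)
    then have "\<delta>1 \<le> 8 * d * 4 ^ r * X" unfolding \<delta>1_def by (intro mult_left_mono X) auto
    moreover have "s / 2 * \<zeta>' \<le> h * \<zeta>'" using real_kh(2) \<zeta>' by (intro mult_right_mono) auto
    then have "a / 2 \<le> h * \<zeta>'" using s\<zeta> by linarith
    then have "real N * 2 ^ r * exp (- (real h * \<zeta>')) \<le> real n * 2 ^ r * X"
      using Nn a_big by (intro mult_mono X mult_right_mono) auto
    moreover have "card Lv * exp (1 - h / 32) \<le> (2 + ?l) * (3 * X)"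
    proof (intro mult_mono Lv(3))
      have "exp (1 - h / 32) = exp 1 * exp (- (h / 32))" by (simp add: exp_add[symmetric])
      also have "\<dots> \<le> 3 * X" using exp_le real_kh(2) as a_big by (intro mult_mono X) auto
      finally show "exp (1 - h / 32) \<le> 3 * X" .
    qed (use l0 in auto)
    moreover have "exp (- (2 * real h / 3)) \<le> X" using real_kh(2) as a_big by (intro X) linarith
    ultimately have "\<delta>1 + \<delta>2 \<le> 8 * d * 4 ^ r * X + (real n * 2 ^ r * X + (2 + ?l) * (3 * X) + X)"
      unfolding \<delta>2_def by (intro add_mono)
    also have "\<dots> = (8 * d * 4 ^ r + n * 2 ^ r + 3 * (2 + ?l) + 1) * X" by (simp add: algebra_simps)
    \<comment> \<open>The coefficients are 8 for the splits, 1 for the hits, and 10 for the rest,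
      since \<open>log 2 n \<le> n\<close>.\<close>
    also have "\<dots> \<le> 19 * d * 4 ^ r * n * X"
    proof (intro mult_right_mono X0)
      have p4: "1 \<le> (4::real) ^ r" "(2::real) ^ r \<le> 4 ^ r" by (auto intro: power_mono)
      have dp: "1 \<le> d * (4::real) ^ r" using mult_mono[OF d p4(1)] by simp
      have dp2: "(2::real) ^ r \<le> d * 4 ^ r" using mult_mono[OF d p4(2)] by simp
      define P where "P = real d * 4 ^ r"
      have "8 * P * 1 \<le> 8 * P * real n" using n1 dp by (intro mult_left_mono) (auto simp: P_def)
      moreover have "real n * 2 ^ r \<le> real n * P" using dp2 by (intro mult_left_mono) (auto simp: P_def)
      moreover have "10 * real n * 1 \<le> 10 * real n * P" using dp by (intro mult_left_mono) (auto simp: P_def)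
      moreover have "3 * (2 + ?l) + 1 \<le> 10 * real n" using l_le n1 by simp
      ultimately have "8 * P + real n * 2 ^ r + (3 * (2 + ?l) + 1) \<le> 8 * P * real n + real n * P + 10 * real n * P"
        by argo
      also have "\<dots> = 19 * (P * real n)" by simp
      finally show "8 * d * 4 ^ r + n * 2 ^ r + 3 * (2 + ?l) + 1 \<le> 19 * d * 4 ^ r * n" by (simp add: P_def)
    qed
    finally have "n * (\<delta>1 + \<delta>2) \<le> n * (19 * d * 4 ^ r * n * X)" by (intro mult_left_mono) auto
    also have "\<dots> = 19 * d * 4 ^ r * (real n)\<^sup>2 * X" by (simp add: power2_eq_square)
    also have "\<dots> \<le> \<delta>"
      using failure_probability_le[OF d n1 \<delta> a_ge L(2)] by (simp add: X_def)
    finally show ?thesis .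
  qed
  have blocks: "k + b * h + h \<le> n" if "b < N" for b
  proof -
    have "(b + 1) * h \<le> N * h" using that by (intro mult_right_mono) auto
    then show ?thesis using Nh kh(5) by simp
  qed
  have "emeasure (sample_dist n Dx E m) {D \<in> space (sample_dist n Dx E m). c < mse Dx m (forest d n s t D)}
      \<le> ennreal (n * (\<delta>1 + \<delta>2))"
  proof (rule forest_mse_tail[OF grown, where ?J0.0 = "{..<k}" and ?H0.0 = "\<lambda>b. {k + b * h..<k + b * h + h}"
        and N = N and thr = thr and R = R])
    show "disjoint_family_on (\<lambda>b. {k + b * h..<k + b * h + h}) {..<N}"
    proof (unfold disjoint_family_on_def, intro ballI impI)
      fix b b' assume "b \<noteq> (b'::nat)"
      have *: "{k + b * h..<k + b * h + h} \<inter> {k + b' * h..<k + b' * h + h} = {}" if "b < b'" for b b' :: nat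
      proof -
        have "(b + 1) * h \<le> b' * h" using that by (intro mult_right_mono) auto
        then show ?thesis by auto
      qed
      show "{k + b * h..<k + b * h + h} \<inter> {k + b' * h..<k + b' * h + h} = {}"
        using *[of b b'] *[of b' b] \<open>b \<noteq> b'\<close> by (cases "b < b'") auto
    qed
    show "{k + b * h..<k + b * h + h} \<subseteq> {..<n} - {..<k}" if "b < N" for b using blocks[OF that] by auto
    show "outer_le (PiM ({..<n} - J) (\<lambda>_. Z)) {D. regular ({..<n} - J) D \<and> thr < block_mse H N \<tau> D} \<delta>2"
      if J: "J \<subseteq> {..<n}" "card J = s div 2" and H: "disjoint_family_on H {..<N}"
        "\<And>b. b < N \<Longrightarrow> H b \<subseteq> {..<n} - J" "\<And>b. b < N \<Longrightarrow> card (H b) = s - s div 2" and \<tau>: "splits_first R \<tau> {}" for J H \<tau>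
      unfolding thr_def \<delta>2_def w_def
    proof (rule outer_le_block_error[OF R \<tau> _ _ N kh(2) v0 H(1,2) _ lower Lv(1) _ Lv(4) level])
      have "card ({..<n} - J) = n - k" using J finite_subset[OF J(1)] by (simp add: card_Diff_subset k_def)
      then show "card ({..<n} - J) \<le> 2 * N * h" using nk by simp
      show "card (H b) = h" if "b < N" for b using H(3)[OF that] by (simp add: h_def)
      show "0 < b" if "b \<in> Lv" for b :: real using Lv(2)[OF that] v0 by linarith
    qed auto
    show "outer_le (PiM J (\<lambda>_. Z)) {D. (\<forall>j\<in>J. \<bar>snd (D j)\<bar> \<le> 1) \<and>
        (\<exists>\<tau>\<in>set_pmf (full_tree (best_splits d D J) d (cube d)). \<not> splits_first R \<tau> {})} \<delta>1"
      if J: "J \<subseteq> {..<n}" "card J = s div 2" for J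
    proof -
      have cJ: "card J = k" using J(2) by (simp add: k_def)
      show ?thesis unfolding \<delta>1_def cJ[symmetric]
        using kh(1) finite_subset[OF J(1)] unfolding cJ[symmetric]
        by (intro outer_le_not_splits_first[OF Rd _ _ gap \<beta> lower]) auto
    qed
    show "thr + 3 / n \<le> c" by (rule thr)
    show "0 \<le> \<delta>1" "0 \<le> \<delta>2" by (simp_all add: \<delta>1_def \<delta>2_def)
  qed (use s2 sn kh N thr0 in \<open>auto simp: k_def h_def\<close>)
  also have "\<dots> \<le> ennreal \<delta>" by (intro ennreal_leI \<delta>_bound)
  finally show ?thesis unfolding measure_def using \<delta>(1) by (intro enn2real_leI) auto
qed

end

text \<open>\<open>K1\<close> and \<open>p1\<close> fix how large \<open>s\<close> must be;
  \<open>C\<close> and \<open>q\<close> then say how far above this rate \<open>s\<close> may be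
  taken. The error bound is proportional to \<open>s / n\<close>, so \<open>K2\<close> and
  \<open>p2\<close> are chosen after them: \<open>p2 = q + 1\<close>, the extra power paying for
  \<open>1 + log 2 n\<close>. The condition \<open>2 \<le> real d / \<delta>\<close> makes the
  logarithm in \<open>size_rate\<close> at least 1.\<close>

theorem theorem4p5:
  shows "\<exists>K1>0. \<exists>p1. \<forall>C>0. \<forall>q. \<exists>K2>0. \<exists>p2.
    \<forall>(d::nat) (n::nat) (r::nat) (s::nat) (t::nat) (\<beta>::real) (\<zeta>::real) (\<delta>::real)
      (Dx :: point pmf) (E :: real measure) (m :: point \<Rightarrow> real).
      regression_model d Dx E m \<longrightarrow>
      0 < \<zeta> \<longrightarrow> lower_bounded d Dx \<zeta> r \<longrightarrow>
      0 < \<beta> \<longrightarrow> \<beta> \<le> 1 \<longrightarrow> strongly_partition_sparse d Dx m \<beta> r \<longrightarrow>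
      0 < \<delta> \<longrightarrow> \<delta> < 1 \<longrightarrow> 2 \<le> real d / \<delta> \<longrightarrow>
      s \<le> n \<longrightarrow>
      K1 * size_rate d r \<beta> \<zeta> \<delta> * polylog p1 n r \<beta> \<zeta> \<le> real s \<longrightarrow>
      real s \<le> C * size_rate d r \<beta> \<zeta> \<delta> * polylog q n r \<beta> \<zeta> \<longrightarrow>
      fully_grown d n s t Dx E m \<longrightarrow>
      measure (sample_dist n Dx E m)
        {D \<in> space (sample_dist n Dx E m).
           mse Dx m (forest d n s t D)
             > K2 * error_rate d n r \<beta> \<zeta> \<delta> * polylog p2 n r \<beta> \<zeta>} \<le> \<delta>"
proof (rule exI[of _ 27040], rule conjI, simp, rule exI[of _ 1], intro allI impI)
  fix C :: real and q :: nat
  assume C: "0 < C"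
  show "\<exists>K2>0. \<exists>p2. \<forall>(d::nat) (n::nat) (r::nat) (s::nat) (t::nat) (\<beta>::real) (\<zeta>::real) (\<delta>::real)
      (Dx :: point pmf) (E :: real measure) (m :: point \<Rightarrow> real).
      regression_model d Dx E m \<longrightarrow>
      0 < \<zeta> \<longrightarrow> lower_bounded d Dx \<zeta> r \<longrightarrow>
      0 < \<beta> \<longrightarrow> \<beta> \<le> 1 \<longrightarrow> strongly_partition_sparse d Dx m \<beta> r \<longrightarrow>
      0 < \<delta> \<longrightarrow> \<delta> < 1 \<longrightarrow> 2 \<le> real d / \<delta> \<longrightarrow>
      s \<le> n \<longrightarrow>
      27040 * size_rate d r \<beta> \<zeta> \<delta> * polylog 1 n r \<beta> \<zeta> \<le> real s \<longrightarrow>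
      real s \<le> C * size_rate d r \<beta> \<zeta> \<delta> * polylog q n r \<beta> \<zeta> \<longrightarrow>
      fully_grown d n s t Dx E m \<longrightarrow>
      measure (sample_dist n Dx E m)
        {D \<in> space (sample_dist n Dx E m).
           mse Dx m (forest d n s t D)
             > K2 * error_rate d n r \<beta> \<zeta> \<delta> * polylog p2 n r \<beta> \<zeta>} \<le> \<delta>"
  proof (rule exI[of _ "1095 * C"], rule conjI, use C in simp, rule exI[of _ "q + 1"], intro allI impI)
    fix d n r s t :: nat and \<beta> \<zeta> \<delta> :: real and Dx E m
    assume model: "regression_model d Dx E m" and \<zeta>: "0 < \<zeta>" "lower_bounded d Dx \<zeta> r"
      and \<beta>: "0 < \<beta>" "\<beta> \<le> 1" and sps: "strongly_partition_sparse d Dx m \<beta> r"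
      and \<delta>: "0 < \<delta>" "\<delta> < 1" "2 \<le> real d / \<delta>" and sn: "s \<le> n"
      and s: "27040 * size_rate d r \<beta> \<zeta> \<delta> * polylog 1 n r \<beta> \<zeta> \<le> real s"
        "real s \<le> C * size_rate d r \<beta> \<zeta> \<delta> * polylog q n r \<beta> \<zeta>"
      and grown: "fully_grown d n s t Dx E m"
    interpret regression d Dx E m using model by unfold_locales
    obtain R where "sparse_with d m r R" using sps unfolding strongly_partition_sparse_def by blast
    then have \<zeta>1: "\<zeta> \<le> 1" using lower_bounded_le_1[OF \<zeta>(2)] by (auto simp: sparse_with_def)
    define L where "L = polylog 1 n r \<beta> \<zeta>"
    have pL: "polylog p n r \<beta> \<zeta> = L ^ p" for p by (simp add: L_def polylog_def)
    \<comment> \<open>The case \<open>n = 0\<close> rests on the convention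
      \<open>ln 0 = 0\<close>.\<close>
    have l0: "0 \<le> log 2 (real n)" by (cases "n = 0") (auto simp: log_def)
    have "0 \<le> log 2 (1 / \<beta>)" "0 \<le> log 2 (1 / \<zeta>)" using \<beta> \<zeta>(1) \<zeta>1 by simp_all
    moreover have "log 2 (2 ^ r) = real r" by simp
    ultimately have L: "1 + log 2 n + r \<le> L" unfolding L_def polylog_def by simp
    have L1: "1 \<le> L" using L l0 by linarith
    show "measure (sample_dist n Dx E m)
        {D \<in> space (sample_dist n Dx E m).
           mse Dx m (forest d n s t D)
             > 1095 * C * error_rate d n r \<beta> \<zeta> \<delta> * polylog (q + 1) n r \<beta> \<zeta>} \<le> \<delta>"
    proof (rule forest_mse_bound[OF \<zeta> \<beta> sps \<delta>(1,3) sn _ grown L1 L])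
      show "27040 * size_rate d r \<beta> \<zeta> \<delta> * L \<le> s" using s(1) by (simp add: L_def)
      have "(1 + log 2 n) * s \<le> L * (C * size_rate d r \<beta> \<zeta> \<delta> * L ^ q)"
        using s(2) L l0 unfolding pL by (intro mult_mono) auto
      then have "1095 * ((1 + log 2 n) * s) / n \<le> 1095 * (L * (C * size_rate d r \<beta> \<zeta> \<delta> * L ^ q)) / n"
        by (intro divide_right_mono mult_left_mono) auto
      also have "\<dots> = 1095 * C * error_rate d n r \<beta> \<zeta> \<delta> * polylog (q + 1) n r \<beta> \<zeta>"
        unfolding pL error_rate_def size_rate_def by (simp add: field_simps)
      finally show "1095 * (1 + log 2 n) * s / n \<le> 1095 * C * error_rate d n r \<beta> \<zeta> \<delta> * polylog (q + 1) n r \<beta> \<zeta>"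
        by (simp only: mult.assoc)
    qed
  qed
qed

end
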